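(* Let $\beta:\Omega\times\mathbb{R}\to 2^{\mathbb{R}}$ be such that $\beta(x,\cdot)$ is strictly monotone for almost every $x\in\Omega$. For $f\in L^{1}(\Omega)$, let $(u,b)$ and $(\widetilde u,\widetilde b)$ be renormalized solutions of the problem $$(E,f)\qquad \beta(x,u)-\operatorname{div}\big(a(x,Du)+F(u)\big)\ni f \ \text{ in } \Omega,\qquad u=0 \ \text{ on } \partial\Omega .$$ Then $u=\widetilde u$ and $b=\widetilde b$ almost everywhere in $\Omega$.
   Context: Setting. $\Omega\subset\mathbb{R}^N$ ($N\ge 1$) is a bounded domain, with Lipschitz boundary $\partial\Omega$ if $N\ge 2$. The exponents $p_1,\dots,p_N\in(1,\infty)$ are given, $\overrightarrow{p}=(p_1,\dots,p_N)$ and $p_i'=p_i/(p_i-1)$. The anisotropic Sobolev space is $W^{1,\overrightarrow{p}}(\Omega)=\{u\in W^{1,1}(\Omega):\partial_{x_i}u\in L^{p_i}(\Omega),\ i=1,\dots,N\}$ with norm $\|u\|_{L^1(\Omega)}+\sum_{i=1}^N\|\partial_{x_i}u\|_{L^{p_i}(\Omega)}$, and $W^{1,\overrightarrow{p}}_0(\Omega)$ is the closure of $C_0^\infty(\Omega)$ in this norm. The function $F:\mathbb{R}\to\mathbb{R}^N$ is locally Lipschitz continuous. For a.e. $x\in\Omega$, $\beta(x,\cdot):\mathbb{R}\to 2^{\mathbb{R}}$ is a maximal monotone mapping with $0\in\beta(x,0)$ and domain $D(\beta(x,\cdot))=\{r:\beta(x,r)\ne\emptyset\}$; strictly monotone means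 that $s_1<s_2$ whenever $r_1<r_2$, $s_1\in\beta(x,r_1)$, $s_2\in\beta(x,r_2)$. The map $a=(a_1,\dots,a_N):\Omega\times\mathbb{R}^N\to\mathbb{R}^N$ is a Carathéodory function such that, for a.e. $x\in\Omega$ and all $\xi,\eta\in\mathbb{R}^N$: (coerciveness) $\sum_{i=1}^N a_i(x,\xi)\xi_i\ge\lambda\sum_{i=1}^N|\xi_i|^{p_i}$ for a constant $\lambda>0$; (growth) $|a_i(x,\xi)|\le\gamma\,(d_i(x)+|\xi_i|^{p_i-1})$ for $i=1,\dots,N$, with a constant $\gamma>0$ and positive functions $d_i\in L^{p_i'}(\Omega)$; (monotonicity) $(a(x,\xi)-a(x,\eta))\cdot(\xi-\eta)\ge 0$. Truncation. For $k>0$, $T_k(r)=\max(-k,\min(r,k))$. If $u:\Omega\to\mathbb{R}$ is measurable with $T_k(u)\in W^{1,\overrightarrow{p}}_0(\Omega)$ for all $k>0$, then $Du$ denotes the generalized gradient, i.e. the measurable function with $DT_k(u)=Du\,\chi_{\{|u|<k\}}$ a.e. for all $k>0$. Renormalized solution of $(E,f)$: a pair $(u,b)$ such that (R1) $u:\Omega\to\mathbb{R}$ is measurable, $b\in L^1(\Omega)$, $u(x)\in D(\beta(x,\cdot))$ and $b(x)\in\beta(x,u(x))$ for a.e. $x\in\Omega$; (R2) $T_k(u)\in W^{1,\overrightarrow{p}}_0(\Omega)$ for each $k>0$, and $$\int_\Omega b\,h(u)\phi+\int_\Omega (a(x,Du)+F(u))\cdot D(h(u)\phi)=\int_\Omega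 f\,h(u)\phi$$ for all $h\in C^1_c(\mathbb{R})$ and all $\phi\in W^{1,\overrightarrow{p}}_0(\Omega)\cap L^\infty(\Omega)$; (R3) $\int_{\{k<|u|<k+1\}}a(x,Du)\cdot Du\to 0$ as $k\to\infty$. *)

theory Defs
  imports "HOL-Analysis.Analysis"
begin

(* Functions on a domain \<Omega> are total functions of which only the values on \<Omega> matter;
   "measurable" and "a.e. in \<Omega>" refer to Lebesgue measure on \<Omega>, i.e. lebesgue_on \<Omega>. *)

definition bounded_domain :: "(real^'n) set \<Rightarrow> bool" where
  "bounded_domain \<Omega> \<longleftrightarrow> open \<Omega> \<and> connected \<Omega> \<and> bounded \<Omega> \<and> \<Omega> \<noteq> {}"

(* Near each boundary point, \<Omega> is the strict epigraph of a Lipschitz function.  The unit vector e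
   plays the role of the last axis in a rotated coordinate system: y has last coordinate y \<bullet> e, and
   its remaining N - 1 coordinates are represented by its projection to the hyperplane
   orthogonal to e. *)
definition lipschitz_boundary :: "(real^'n) set \<Rightarrow> bool" where
  "lipschitz_boundary \<Omega> \<longleftrightarrow>
     (\<forall>x\<in>frontier \<Omega>. \<exists>r>0. \<exists>e L. \<exists>g :: real^'n \<Rightarrow> real.
        norm e = 1 \<and> L-lipschitz_on {z. z \<bullet> e = 0} g \<and>
        \<Omega> \<inter> ball x r = {y \<in> ball x r. g (y - (y \<bullet> e) *\<^sub>R e) < y \<bullet> e})"

definition partial :: "'n \<Rightarrow> (real^'n \<Rightarrow> real) \<Rightarrow> real^'n \<Rightarrow> real" where
  "partial i \<phi> x = frechet_derivative \<phi> (at x) (axis i 1)"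

primrec Ck :: "nat \<Rightarrow> (real^'n \<Rightarrow> real) \<Rightarrow> bool" where
  "Ck 0 \<phi> \<longleftrightarrow> continuous_on UNIV \<phi>"
| "Ck (Suc k) \<phi> \<longleftrightarrow> (\<forall>x. \<phi> differentiable (at x)) \<and> (\<forall>i. Ck k (partial i \<phi>))"

(* Elements of C_0^\<infinity>(\<Omega>), extended by 0 to the whole space. *)
definition test_functions :: "(real^'n) set \<Rightarrow> (real^'n \<Rightarrow> real) set" where
  "test_functions \<Omega> =
     {\<phi>. (\<forall>k. Ck k \<phi>) \<and> compact (closure {x. \<phi> x \<noteq> 0}) \<and> closure {x. \<phi> x \<noteq> 0} \<subseteq> \<Omega>}"

definition C1_compact_support :: "(real \<Rightarrow> real) set" where
  "C1_compact_support = {h. h C1_differentiable_on UNIV \<and> compact (closure {r. h r \<noteq> 0})}"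

definition Lp :: "(real^'n) set \<Rightarrow> real \<Rightarrow> (real^'n \<Rightarrow> real) set" where
  "Lp \<Omega> q = {u \<in> borel_measurable (lebesgue_on \<Omega>). integrable (lebesgue_on \<Omega>) (\<lambda>x. \<bar>u x\<bar> powr q)}"

definition Lp_norm :: "(real^'n) set \<Rightarrow> real \<Rightarrow> (real^'n \<Rightarrow> real) \<Rightarrow> real" where
  "Lp_norm \<Omega> q u = (\<integral>x. \<bar>u x\<bar> powr q \<partial>lebesgue_on \<Omega>) powr (1 / q)"

definition Linf :: "(real^'n) set \<Rightarrow> (real^'n \<Rightarrow> real) set" where
  "Linf \<Omega> = {u \<in> borel_measurable (lebesgue_on \<Omega>). \<exists>M. AE x in lebesgue_on \<Omega>. \<bar>u x\<bar> \<le> M}"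

definition locally_integrable :: "(real^'n) set \<Rightarrow> (real^'n \<Rightarrow> real) \<Rightarrow> bool" where
  "locally_integrable \<Omega> u \<longleftrightarrow> (\<forall>K. compact K \<and> K \<subseteq> \<Omega> \<longrightarrow> integrable (lebesgue_on K) u)"

definition has_weak_grad :: "(real^'n) set \<Rightarrow> (real^'n \<Rightarrow> real) \<Rightarrow> (real^'n \<Rightarrow> real^'n) \<Rightarrow> bool" where
  "has_weak_grad \<Omega> u G \<longleftrightarrow>
     locally_integrable \<Omega> u \<and>
     (\<forall>i. locally_integrable \<Omega> (\<lambda>x. G x $ i) \<and>
        (\<forall>\<phi>\<in>test_functions \<Omega>.
           (\<integral>x. u x * partial i \<phi> x \<partial>lebesgue_on \<Omega>) = - (\<integral>x. G x $ i * \<phi> x \<partial>lebesgue_on \<Omega>)))"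

(* The weak gradient is unique up to null sets; this is one representative. *)
definition weak_grad :: "(real^'n) set \<Rightarrow> (real^'n \<Rightarrow> real) \<Rightarrow> real^'n \<Rightarrow> real^'n" where
  "weak_grad \<Omega> u = (SOME G. has_weak_grad \<Omega> u G)"

definition W11 :: "(real^'n) set \<Rightarrow> (real^'n \<Rightarrow> real) set" where
  "W11 \<Omega> = {u \<in> Lp \<Omega> 1. \<exists>G. has_weak_grad \<Omega> u G \<and> (\<forall>i. (\<lambda>x. G x $ i) \<in> Lp \<Omega> 1)}"

definition W1p :: "(real^'n) set \<Rightarrow> real^'n \<Rightarrow> (real^'n \<Rightarrow> real) set" where
  "W1p \<Omega> p = {u \<in> W11 \<Omega>. \<forall>i. (\<lambda>x. weak_grad \<Omega> u x $ i) \<in> Lp \<Omega> (p $ i)}"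

definition W1p_norm :: "(real^'n) set \<Rightarrow> real^'n \<Rightarrow> (real^'n \<Rightarrow> real) \<Rightarrow> real" where
  "W1p_norm \<Omega> p u = Lp_norm \<Omega> 1 u + (\<Sum>i\<in>UNIV. Lp_norm \<Omega> (p $ i) (\<lambda>x. weak_grad \<Omega> u x $ i))"

definition W1p_0 :: "(real^'n) set \<Rightarrow> real^'n \<Rightarrow> (real^'n \<Rightarrow> real) set" where
  "W1p_0 \<Omega> p =
     {u \<in> W1p \<Omega> p. \<forall>\<epsilon>>0. \<exists>\<phi>\<in>test_functions \<Omega>. W1p_norm \<Omega> p (\<lambda>x. u x - \<phi> x) < \<epsilon>}"

definition monotone_graph :: "(real \<Rightarrow> real set) \<Rightarrow> bool" where
  "monotone_graph B \<longleftrightarrow> (\<forall>r1 r2. \<forall>s1\<in>B r1. \<forall>s2\<in>B r2. 0 \<le> (s1 - s2) * (r1 - r2))"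

definition maximal_monotone_graph :: "(real \<Rightarrow> real set) \<Rightarrow> bool" where
  "maximal_monotone_graph B \<longleftrightarrow>
     monotone_graph B \<and> (\<forall>B'. monotone_graph B' \<and> (\<forall>r. B r \<subseteq> B' r) \<longrightarrow> B' = B)"

definition strictly_monotone_graph :: "(real \<Rightarrow> real set) \<Rightarrow> bool" where
  "strictly_monotone_graph B \<longleftrightarrow> (\<forall>r1 r2. \<forall>s1\<in>B r1. \<forall>s2\<in>B r2. r1 < r2 \<longrightarrow> s1 < s2)"

definition graph_domain :: "(real \<Rightarrow> real set) \<Rightarrow> real set" where
  "graph_domain B = {r. B r \<noteq> {}}"

definition caratheodory :: "(real^'n) set \<Rightarrow> (real^'n \<Rightarrow> real^'n \<Rightarrow> real^'n) \<Rightarrow> bool" where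
  "caratheodory \<Omega> a \<longleftrightarrow>
     (\<forall>\<xi>. (\<lambda>x. a x \<xi>) \<in> borel_measurable (lebesgue_on \<Omega>)) \<and>
     (AE x in lebesgue_on \<Omega>. continuous_on UNIV (a x))"

definition trunc :: "real \<Rightarrow> real \<Rightarrow> real" where
  "trunc k r = max (- k) (min r k)"

(* If all truncations of u lie in W1p_0, such a field exists and is unique up to null sets. *)
definition gen_grad :: "(real^'n) set \<Rightarrow> (real^'n \<Rightarrow> real) \<Rightarrow> real^'n \<Rightarrow> real^'n" where
  "gen_grad \<Omega> u =
     (SOME G. G \<in> borel_measurable (lebesgue_on \<Omega>) \<and>
        (\<forall>k>0. AE x in lebesgue_on \<Omega>.
           weak_grad \<Omega> (\<lambda>y. trunc k (u y)) x = indicat_real {y. \<bar>u y\<bar> < k} x *\<^sub>R G x))"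

definition renormalized_solution ::
  "(real^'n) set \<Rightarrow> real^'n \<Rightarrow> (real^'n \<Rightarrow> real \<Rightarrow> real set) \<Rightarrow> (real^'n \<Rightarrow> real^'n \<Rightarrow> real^'n) \<Rightarrow>
   (real \<Rightarrow> real^'n) \<Rightarrow> (real^'n \<Rightarrow> real) \<Rightarrow> (real^'n \<Rightarrow> real) \<Rightarrow> (real^'n \<Rightarrow> real) \<Rightarrow> bool" where
  "renormalized_solution \<Omega> p \<beta> a F f u b \<longleftrightarrow>
     (u \<in> borel_measurable (lebesgue_on \<Omega>) \<and> b \<in> Lp \<Omega> 1 \<and>
      (AE x in lebesgue_on \<Omega>. u x \<in> graph_domain (\<beta> x) \<and> b x \<in> \<beta> x (u x))) \<and>
     ((\<forall>k>0. (\<lambda>x. trunc k (u x)) \<in> W1p_0 \<Omega> p) \<and>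
      (\<forall>h\<in>C1_compact_support. \<forall>\<phi>\<in>W1p_0 \<Omega> p \<inter> Linf \<Omega>.
         (\<integral>x. b x * h (u x) * \<phi> x \<partial>lebesgue_on \<Omega>) +
         (\<integral>x. (a x (gen_grad \<Omega> u x) + F (u x)) \<bullet> weak_grad \<Omega> (\<lambda>y. h (u y) * \<phi> y) x \<partial>lebesgue_on \<Omega>) =
         (\<integral>x. f x * h (u x) * \<phi> x \<partial>lebesgue_on \<Omega>))) \<and>
     ((\<lambda>k::real. \<integral>x\<in>{x \<in> \<Omega>. k < \<bar>u x\<bar> \<and> \<bar>u x\<bar> < k + 1}. a x (gen_grad \<Omega> u x) \<bullet> gen_grad \<Omega> u x \<partial>lebesgue)
        \<longlongrightarrow> 0) at_top"

end

theory Submission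
  imports Defs
begin

text \<open>
  The uniqueness proof is a comparison argument.  Subtract the equations of two solutions
  \<open>(u, b)\<close> and \<open>(u', b')\<close> and test, formally, with the indicator function of
  \<open>{u > u'}\<close>, whose gradient lives where \<open>u = u'\<close>.  The difference of the
  fluxes \<open>a(x, Du) - a(x, Du')\<close> then contributes a nonnegative term by monotonicity, and
  the convection \<open>F(u) - F(u')\<close> contributes nothing, because it vanishes where
  \<open>u = u'\<close>.  What remains is that the integral of \<open>b - b'\<close> over
  \<open>{u > u'}\<close> is at most 0.  Strict monotonicity of \<open>\<beta>\<close> makes
  \<open>b - b'\<close> positive there, so \<open>{u > u'}\<close> is a null set.

  To make this rigorous, the solutions are cut at a level \<open>l\<close>: let \<open>v\<close> and
  \<open>w\<close> be the truncations of \<open>u\<close> and \<open>u'\<close> at \<open>l + 1\<close>,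
  and let \<open>h\<close> be a cutoff that is 1 on \<open>[-l, l]\<close> and 0 outside
  \<open>[-l - 1, l + 1]\<close>.  The indicator is replaced by \<open>\<Phi> = e(m(v - w))\<close> with
  a large \<open>m\<close>, where \<open>e(t) = exp(-1/t)\<close> for \<open>t > 0\<close> and
  \<open>e(t) = 0\<close> otherwise. The equation of \<open>u\<close> is tested with
  \<open>h(u) \<Phi>\<close> and that of \<open>u'\<close> with \<open>h(u') \<Phi>\<close>.  Giving
  each equation its own cutoff is essential: then \<open>h'\<close> pairs the flux of a solution only
  with the gradient of the same solution, and such terms are bounded by the energy on
  \<open>{l < |u| < l + 1}\<close>, which tends to 0 by the definition of a renormalized solution. The
  price is that fluxes and convection now appear with different factors \<open>h(v)\<close> and
  \<open>h(w)\<close>; but in every error term a Lipschitz function of \<open>v\<close> minus the same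
  function of \<open>w\<close> meets the derivative \<open>m e'(m(v - w))\<close>, so that the error is
  at most a fixed integrable function times \<open>t e'(t)\<close> with \<open>t = m(v - w)\<close>.
  This weight is bounded and tends to 0 pointwise as \<open>m\<close> tends to infinity, and dominated
  convergence removes the error (lemmas \<open>flux_lower_bound\<close>,
  \<open>convection_lower_bound\<close>, \<open>comparison_at_level\<close>). Letting \<open>l\<close>
  tend to infinity gives the comparison.

  Once \<open>u = u'\<close>, the flux and convection terms of the two equations coincide, so
  \<open>(b - b') h(u)\<close> is orthogonal to all test functions and vanishes by the fundamental lemma
  of the calculus of variations.

  All Sobolev calculus rests on one observation: the functions used are \<open>C\<^sup>1\<close>
  functions of at most two functions in \<open>W\<^sub>0\<close>, which by definition are limits of test
  functions.  Chain rule, integration by parts and membership in \<open>W\<^sub>0\<close> therefore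
  follow from the classical calculus of test functions by passing to the limit (lemmas
  \<open>chain_rule\<close>, \<open>integral_chain_rule_eq_0\<close>,
  \<open>compose_approximates\<close>).
\<close>

section \<open>Smooth functions\<close>

text \<open>
  The function \<open>e\<close> that is \<open>exp(-1/t)\<close> for \<open>t > 0\<close> and 0 for
  \<open>t \<le> 0\<close> serves three purposes below: it builds bump functions, it smooths the
  indicator function of the positive reals, and the quotient \<open>e(t) / (e(t) + e(1 - t))\<close>
  gives the cutoffs. Its \<open>j\<close>-th derivative is \<open>flat j\<close>, a polynomial in
  \<open>1/t\<close> times \<open>exp(-1/t)\<close>.
\<close>

primrec flat_poly :: "nat \<Rightarrow> real poly" where
  "flat_poly 0 = 1"
| "flat_poly (Suc j) = monom 1 2 * (flat_poly j - pderiv (flat_poly j))"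

definition flat :: "nat \<Rightarrow> real \<Rightarrow> real" where
  "flat j t = (if t \<le> 0 then 0 else poly (flat_poly j) (1 / t) * exp (- (1 / t)))"

lemma poly_mult_exp_tendsto_0:
  fixes p :: "real poly"
  shows "((\<lambda>y. y ^ k * poly p y * exp (- y)) \<longlongrightarrow> 0) at_top"
proof (induction p arbitrary: k)
  case 0
  then show ?case by simp
next
  case (pCons a p)
  have 1: "((\<lambda>y::real. a * (y ^ k / exp y)) \<longlongrightarrow> a * 0) at_top"
    by (intro tendsto_intros tendsto_power_div_exp_0)
  have "((\<lambda>y. a * (y ^ k / exp y) + y ^ Suc k * poly p y * exp (- y)) \<longlongrightarrow> a * 0 + 0) at_top"
    by (intro tendsto_add 1 pCons.IH)
  then show ?case
    by (simp add: algebra_simps exp_minus divide_inverse)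
qed

lemma flat_has_derivative: "(flat j has_real_derivative flat (Suc j) t) (at t)"
proof -
  consider "t < 0" | "t = 0" | "t > 0" by linarith
  then show ?thesis
  proof cases
    case 1
    have "((\<lambda>_. 0) has_real_derivative 0) (at t)" by simp
    then show ?thesis
      by (rule DERIV_cong[OF has_field_derivative_transform_within_open[of _ _ _ "{..<0}"]])
        (use 1 in \<open>auto simp: flat_def\<close>)
  next
    case 3
    have "((\<lambda>t. poly (flat_poly j) (1 / t) * exp (- (1 / t))) has_real_derivative flat (Suc j) t) (at t)"
      using 3 by (auto intro!: derivative_eq_intros DERIV_chain2[OF poly_DERIV]
          simp: flat_def poly_monom field_simps power2_eq_square)
    then show ?thesis
      by (rule has_field_derivative_transform_within_open[of _ _ _ "{0<..}"])
        (use 3 in \<open>auto simp: flat_def\<close>)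
  next
    case 2
    have lim: "((\<lambda>y. poly (flat_poly j) y * exp (- y) * y) \<longlongrightarrow> 0) at_top"
      using poly_mult_exp_tendsto_0[of 1 "flat_poly j"] by (simp add: mult_ac)
    have "((\<lambda>h. poly (flat_poly j) (inverse h) * exp (- inverse h) * inverse h) \<longlongrightarrow> 0) (at_right 0)"
      by (rule filterlim_compose[OF lim filterlim_inverse_at_top_right])
    then have r: "((\<lambda>h. flat j h / h) \<longlongrightarrow> 0) (at_right 0)"
      by (rule Lim_transform_eventually)
        (auto simp: flat_def eventually_at_filter divide_inverse)
    have l: "((\<lambda>h. flat j h / h) \<longlongrightarrow> 0) (at_left 0)"
      by (rule Lim_transform_eventually[OF tendsto_const])
        (auto simp: flat_def eventually_at_filter)
    have "((\<lambda>h. flat j h / h) \<longlongrightarrow> 0) (at 0)"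
      using l r by (simp add: filterlim_split_at)
    then show ?thesis
      using 2 by (simp add: DERIV_def flat_def)
  qed
qed

lemma isCont_flat: "isCont (flat j) t"
  using flat_has_derivative DERIV_isCont by blast

lemma flat_0_nonpos: "t \<le> 0 \<Longrightarrow> flat j t = 0"
  by (simp add: flat_def)

lemma flat_0_nonneg: "0 \<le> flat 0 t" and flat_0_le_1: "flat 0 t \<le> 1"
  and flat_0_pos: "0 < t \<Longrightarrow> 0 < flat 0 t"
  by (auto simp: flat_def)

lemma flat_1_nonneg: "0 \<le> flat 1 t"
  by (auto simp: flat_def poly_monom)

lemma flat_1_le: "flat 1 t \<le> 2"
proof (cases "t \<le> 0")
  case False
  then have "1 + (1/t) + (1/t)\<^sup>2 / 2 \<le> exp (1/t)"
    by (intro exp_lower_Taylor_quadratic) simp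
  moreover have "1/t > 0" using False by simp
  ultimately have "(1/t)\<^sup>2 \<le> 2 * exp (1/t)" by linarith
  then have "(1/t)\<^sup>2 * exp (-(1/t)) \<le> 2 * exp (1/t) * exp (-(1/t))"
    by (intro mult_right_mono) auto
  also have "\<dots> = 2" by (simp add: exp_minus)
  finally have "(1/t)\<^sup>2 * exp (-(1/t)) \<le> 2" .
  then show ?thesis using False by (simp add: flat_def poly_monom)
qed (simp add: flat_def)

text \<open>
  The function \<open>t e'(t)\<close>, for \<open>e = flat 0\<close>, is the weight of all error terms
  in the comparison argument; it is bounded and decays at infinity.
\<close>

lemma mult_flat_1_le: "t * flat 1 t \<le> 1"
proof (cases "t \<le> 0")
  case False
  have "1 + 1/t \<le> exp (1/t)" by (rule exp_ge_add_one_self)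
  then have "(1/t) * exp (-(1/t)) \<le> 1"
    using False by (simp add: exp_minus field_simps)
  then show ?thesis using False by (simp add: flat_def poly_monom power2_eq_square)
qed (simp add: flat_def)

lemma mult_flat_1_nonneg: "0 \<le> t * flat 1 t"
  by (auto simp: flat_def poly_monom)

lemma flat_0_tendsto: "(flat 0 \<longlongrightarrow> 1) at_top"
proof -
  have "((\<lambda>t::real. exp (- (1 / t))) \<longlongrightarrow> exp (- 0)) at_top"
    by (intro tendsto_intros tendsto_divide_0[OF tendsto_const] filterlim_at_top_imp_at_infinity filterlim_ident)
  then have "((\<lambda>t::real. exp (- (1 / t))) \<longlongrightarrow> 1) at_top" by simp
  then show ?thesis
    by (rule Lim_transform_eventually) (use eventually_gt_at_top[of 0] in eventually_elim, simp add: flat_def)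
qed

lemma mult_flat_1_tendsto: "((\<lambda>t. t * flat 1 t) \<longlongrightarrow> 0) at_top"
proof (rule tendsto_sandwich[where f="\<lambda>_. 0" and h="\<lambda>t. 1 / t"])
  show "((\<lambda>t::real. 1 / t) \<longlongrightarrow> 0) at_top"
    by (intro tendsto_divide_0[OF tendsto_const] filterlim_at_top_imp_at_infinity filterlim_ident)
  show "\<forall>\<^sub>F t in at_top. t * flat 1 t \<le> 1 / t"
    using eventually_gt_at_top[of 0]
    by eventually_elim (simp add: flat_def poly_monom power2_eq_square field_simps)
qed (use mult_flat_1_nonneg in auto)

lemma partial_eqI: "(\<phi> has_derivative D) (at x) \<Longrightarrow> partial i \<phi> x = D (axis i 1)"
  by (simp add: partial_def frechet_derivative_at[symmetric])

lemma Ck_Suc_differentiable: "Ck (Suc k) \<phi> \<Longrightarrow> \<phi> differentiable (at x)"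
  by simp

lemma partial_const: "partial i (\<lambda>x. c) = (\<lambda>x. 0)"
  by (rule ext) (rule partial_eqI, rule has_derivative_const)

lemma partial_add:
  assumes "f differentiable (at x)" "g differentiable (at x)"
  shows "partial i (\<lambda>x. f x + g x) x = partial i f x + partial i g x"
  using partial_eqI[OF has_derivative_add[OF assms[unfolded frechet_derivative_works]], of i]
  by (simp add: partial_def)

lemma partial_mult:
  assumes "f differentiable (at x)" "g differentiable (at x)"
  shows "partial i (\<lambda>x. f x * g x) x = f x * partial i g x + partial i f x * g x"
  using partial_eqI[OF has_derivative_mult[OF assms[unfolded frechet_derivative_works]], of i]
  by (simp add: partial_def)

lemma partial_compose_real:
  assumes "f differentiable (at x)" "(g has_real_derivative g') (at (f x))"
  shows "partial i (\<lambda>x. g (f x)) x = g' * partial i f x"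
proof -
  have "(f has_derivative frechet_derivative f (at x)) (at x)"
    using assms(1) by (simp add: frechet_derivative_works)
  from has_derivative_compose[OF this, of g "\<lambda>h. g' * h"] assms(2)
  have "((\<lambda>x. g (f x)) has_derivative (\<lambda>h. g' * frechet_derivative f (at x) h)) (at x)"
    by (simp add: has_field_derivative_def)
  from partial_eqI[OF this] show ?thesis
    by (simp add: partial_def)
qed

lemma Ck_SucD: "Ck (Suc k) \<phi> \<Longrightarrow> Ck k \<phi>"
proof (induction k arbitrary: \<phi>)
  case 0
  then show ?case
    by (auto intro!: continuous_at_imp_continuous_on differentiable_imp_continuous_within)
qed auto

lemma Ck_const: "Ck k (\<lambda>x. c)"
  by (induction k arbitrary: c) (auto simp: partial_const)

lemma Ck_add: "Ck k f \<Longrightarrow> Ck k g \<Longrightarrow> Ck k (\<lambda>x. f x + g x)"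
proof (induction k arbitrary: f g)
  case 0
  then show ?case by (auto intro: continuous_intros)
next
  case (Suc k)
  then have "partial i (\<lambda>x. f x + g x) = (\<lambda>x. partial i f x + partial i g x)" for i
    by (auto intro!: ext partial_add)
  with Suc show ?case by auto
qed

lemma Ck_mult: "Ck k f \<Longrightarrow> Ck k g \<Longrightarrow> Ck k (\<lambda>x. f x * g x)"
proof (induction k arbitrary: f g)
  case 0
  then show ?case by (auto intro: continuous_intros)
next
  case (Suc k)
  then have "partial i (\<lambda>x. f x * g x) = (\<lambda>x. f x * partial i g x + partial i f x * g x)" for i
    by (auto intro!: ext partial_mult)
  moreover have "Ck k f" "Ck k g" using Suc.prems Ck_SucD by auto
  ultimately show ?case using Suc by (auto intro!: Ck_add)
qed

lemma Ck_cmult: "Ck k f \<Longrightarrow> Ck k (\<lambda>x. c * f x)"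
  by (intro Ck_mult Ck_const)

lemma Ck_minus: "Ck k f \<Longrightarrow> Ck k (\<lambda>x. - f x)"
  using Ck_cmult[of k f "-1"] by simp

lemma Ck_diff: "Ck k f \<Longrightarrow> Ck k g \<Longrightarrow> Ck k (\<lambda>x. f x - g x)"
  using Ck_add[of k f "\<lambda>x. - g x"] Ck_minus[of k g] by simp

lemma Ck_prod: "finite I \<Longrightarrow> (\<And>i. i \<in> I \<Longrightarrow> Ck k (f i)) \<Longrightarrow> Ck k (\<lambda>x. \<Prod>i\<in>I. f i x)"
  by (induction I rule: finite_induct) (auto intro: Ck_const Ck_mult)

lemma Ck_component: "Ck k (\<lambda>x. x $ i)"
proof (cases k)
  case (Suc l)
  have "partial j (\<lambda>x. x $ i) = (\<lambda>x. axis j 1 $ i)" for j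
    by (rule ext, rule partial_eqI) (rule bounded_linear_imp_has_derivative[OF bounded_linear_vec_nth])
  with Suc show ?thesis
    by (auto simp: Ck_const intro!: bounded_linear_imp_differentiable bounded_linear_vec_nth)
qed (auto intro: continuous_intros)

text \<open>
  Stated for a whole sequence of successive derivatives, because the induction on the order of
  differentiability passes from each derivative to the next.
\<close>

lemma Ck_compose_real:
  fixes D :: "nat \<Rightarrow> real \<Rightarrow> real"
  assumes D: "\<And>j r. (D j has_real_derivative D (Suc j) r) (at r)"
  shows "Ck k f \<Longrightarrow> Ck k (\<lambda>x. D j (f x))"
proof (induction k arbitrary: f j)
  case 0
  have c: "continuous_on UNIV (D j)"
    by (meson D DERIV_isCont continuous_at_imp_continuous_on)
  show ?case
    unfolding Ck.simps by (rule continuous_on_compose2[OF c 0[unfolded Ck.simps]]) simp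
next
  case (Suc k)
  then have "partial i (\<lambda>x. D j (f x)) = (\<lambda>x. D (Suc j) (f x) * partial i f x)" for i
    by (intro ext partial_compose_real D) simp
  moreover have "(\<lambda>x. D j (f x)) differentiable (at x)" for x
  proof (rule differentiable_compose[of "D j"])
    show "D j differentiable at (f x)"
      using D[of j "f x"] by (auto simp: real_differentiable_def)
  qed (use Suc.prems in simp)
  moreover have "Ck k (\<lambda>x. D (Suc j) (f x) * partial i f x)" for i
    using Suc.prems Ck_SucD[OF Suc.prems] by (intro Ck_mult Suc.IH) auto
  ultimately show ?case
    by simp
qed

definition smooth :: "(real^'n \<Rightarrow> real) \<Rightarrow> bool" where
  "smooth \<phi> \<longleftrightarrow> (\<forall>k. Ck k \<phi>)"

lemma smooth_differentiable: "smooth \<phi> \<Longrightarrow> \<phi> differentiable (at x)"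
  using Ck_Suc_differentiable[of 0 \<phi> x] by (auto simp: smooth_def simp del: Ck.simps)

lemma smooth_continuous: "smooth \<phi> \<Longrightarrow> continuous_on UNIV \<phi>"
  unfolding smooth_def by (metis Ck.simps(1))

lemma smooth_partial: "smooth \<phi> \<Longrightarrow> smooth (partial i \<phi>)"
  unfolding smooth_def by (metis Ck.simps(2))

lemma smooth_diff: "smooth f \<Longrightarrow> smooth g \<Longrightarrow> smooth (\<lambda>x. f x - g x)"
  and smooth_cmult: "smooth f \<Longrightarrow> smooth (\<lambda>x. c * f x)"
  by (auto simp: smooth_def Ck_diff Ck_cmult)

lemma smooth_flat: "smooth f \<Longrightarrow> smooth (\<lambda>x. flat j (f x))"
  unfolding smooth_def using Ck_compose_real[of flat, OF flat_has_derivative] by blast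

lemma partial_eq_0_outside:
  assumes "x \<notin> closure {x. \<phi> x \<noteq> 0}"
  shows "partial i \<phi> x = 0"
proof (rule partial_eqI[where D="\<lambda>_. 0"])
  have "((\<lambda>_. 0) has_derivative (\<lambda>_. 0)) (at x)" by simp
  then show "(\<phi> has_derivative (\<lambda>_. 0)) (at x)"
    by (rule has_derivative_transform_within_open[where s="- closure {x. \<phi> x \<noteq> 0}"])
      (use assms closure_subset[of "{x. \<phi> x \<noteq> 0}"] in auto)
qed

section \<open>Test functions, and integrals of derivatives\<close>

lemma integrable_lborel_translation:
  fixes f :: "'a::euclidean_space \<Rightarrow> real"
  assumes "integrable lborel f"
  shows "integrable lborel (\<lambda>x. f (x + c))" and "(\<integral>x. f (x + c) \<partial>lborel) = (\<integral>x. f x \<partial>lborel)"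
proof -
  have d: "lborel = distr lborel borel ((+) c)" by (simp add: lborel_distr_plus)
  have m: "(+) c \<in> borel_measurable lborel" by simp
  have f: "f \<in> borel_measurable borel" using assms by (simp add: borel_measurable_integrable)
  have "integrable (distr lborel borel ((+) c)) f" using assms d by simp
  then show "integrable lborel (\<lambda>x. f (x + c))"
    by (subst (asm) integrable_distr_eq[OF m f]) (simp add: add.commute)
  have "(\<integral>x. f x \<partial>lborel) = (\<integral>x. f x \<partial>distr lborel borel ((+) c))" using d by simp
  also have "\<dots> = (\<integral>x. f (x + c) \<partial>lborel)"
    by (subst integral_distr[OF m f]) (simp add: add.commute)
  finally show "(\<integral>x. f (x + c) \<partial>lborel) = (\<integral>x. f x \<partial>lborel)" by simp
qed

lemma integrable_continuous_bounded_support: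
  fixes f :: "'a::euclidean_space \<Rightarrow> real"
  assumes "continuous_on UNIV f" "\<And>x. R < norm x \<Longrightarrow> f x = 0"
  shows "integrable lborel f"
proof -
  have "integrable lborel (\<lambda>x. indicator (cball 0 R) x *\<^sub>R f x)"
    using assms(1) by (intro borel_integrable_compact) (auto intro: continuous_on_subset)
  also have "(\<lambda>x. indicator (cball 0 R) x *\<^sub>R f x) = f"
    using assms(2) by (auto simp: fun_eq_iff indicator_def not_le)
  finally show ?thesis .
qed

text \<open>
  The integral of \<open>f\<close> is invariant under translations, so the difference quotients of
  \<open>f\<close> in the direction \<open>v\<close> integrate to 0; by dominated convergence so does
  the derivative.
\<close>

lemma integral_directional_derivative_eq_0:
  fixes f g :: "'a::euclidean_space \<Rightarrow> real" and v :: 'a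
  assumes f: "continuous_on UNIV f" and g: "continuous_on UNIV g"
    and deriv: "\<And>x. ((\<lambda>t. f (x + t *\<^sub>R v)) has_real_derivative g x) (at 0)"
    and supp: "\<And>x. R < norm x \<Longrightarrow> f x = 0"
  shows "(\<integral>x. g x \<partial>lborel) = 0"
proof -
  define t :: "nat \<Rightarrow> real" where "t n = 1 / real (Suc n)" for n
  have t: "0 < t n" "t n \<le> 1" for n by (auto simp: t_def)
  have t0: "t \<longlonglongrightarrow> 0" unfolding t_def by (rule LIMSEQ_Suc) (rule lim_const_over_n)
  define q where "q n x = (f (x + t n *\<^sub>R v) - f x) / t n" for n x
  have int_f: "integrable lborel f" by (rule integrable_continuous_bounded_support[OF f supp])
  have deriv': "((\<lambda>t. f (x + t *\<^sub>R v)) has_real_derivative g (x + s *\<^sub>R v)) (at s)" for x s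
    using deriv[of "x + s *\<^sub>R v"] DERIV_shift[of "\<lambda>t. f (x + t *\<^sub>R v)" "g (x + s *\<^sub>R v)" 0 s]
    by (simp add: algebra_simps)
  have lim: "(\<lambda>n. q n x) \<longlonglongrightarrow> g x" for x
  proof -
    have "((\<lambda>h. (f (x + h *\<^sub>R v) - f x) / h) \<longlongrightarrow> g x) (at 0)"
      using deriv[of x] by (simp add: DERIV_def)
    moreover have "filterlim t (at 0) sequentially"
      using t0 t by (auto simp: filterlim_at intro!: always_eventually less_imp_neq[symmetric])
    ultimately show ?thesis
      unfolding q_def by (rule filterlim_compose)
  qed
  \<comment> \<open>For step lengths at most 1 the difference quotients vanish beyond \<open>R + norm v\<close>, and the mean value theorem evaluates \<open>g\<close> at most \<open>norm v\<close> further out.\<close>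
  let ?K = "cball (0::'a) (R + 2 * norm v)"
  have "bounded (g ` ?K)"
    using g by (intro compact_imp_bounded compact_continuous_image) (auto intro: continuous_on_subset)
  then obtain B where B: "\<And>x. x \<in> ?K \<Longrightarrow> \<bar>g x\<bar> \<le> B"
    unfolding bounded_iff by (metis imageI real_norm_def)
  have bound: "\<bar>q n x\<bar> \<le> indicator (cball 0 (R + norm v)) x *\<^sub>R B" for n x
  proof (cases "norm x \<le> R + norm v")
    case True
    have "\<exists>z. 0 < z \<and> z < t n \<and> f (x + t n *\<^sub>R v) - f (x + 0 *\<^sub>R v) = (t n - 0) * g (x + z *\<^sub>R v)"
      using t by (intro MVT2 deriv') auto
    then obtain z where z: "0 < z" "z < t n" and q: "q n x = g (x + z *\<^sub>R v)"
      using t[of n] by (auto simp: q_def)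
    have "norm (x + z *\<^sub>R v) \<le> norm x + \<bar>z\<bar> * norm v"
      using norm_triangle_ineq[of x "z *\<^sub>R v"] by simp
    also have "\<bar>z\<bar> * norm v \<le> 1 * norm v"
      using z t[of n] by (intro mult_right_mono) auto
    finally have "x + z *\<^sub>R v \<in> ?K" using True by simp
    then show ?thesis using True B q by simp
  next
    case False
    have "t n * norm v \<le> 1 * norm v" using t by (intro mult_right_mono) auto
    moreover have "norm x \<le> norm (x + t n *\<^sub>R v) + \<bar>t n\<bar> * norm v"
      using norm_triangle_ineq4[of "x + t n *\<^sub>R v" "t n *\<^sub>R v"] by simp
    ultimately have "R < norm (x + t n *\<^sub>R v)" using False t(1)[of n] by simp
    moreover have "R < norm x" using False norm_ge_zero[of v] by linarith
    ultimately show ?thesis using supp False by (simp add: q_def)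
  qed
  have "(\<integral>x. q n x \<partial>lborel) = 0" for n
    unfolding q_def
    using integrable_lborel_translation[OF int_f, of "t n *\<^sub>R v"] int_f by simp
  moreover have "(\<lambda>n. \<integral>x. q n x \<partial>lborel) \<longlonglongrightarrow> (\<integral>x. g x \<partial>lborel)"
  proof (rule integral_dominated_convergence)
    show "g \<in> borel_measurable lborel" using g by (simp add: borel_measurable_continuous_onI)
    have [measurable]: "f \<in> borel_measurable borel" using f by (simp add: borel_measurable_continuous_onI)
    show "q n \<in> borel_measurable lborel" for n unfolding q_def by measurable
    show "integrable lborel (\<lambda>x. indicator (cball 0 (R + norm v)) x *\<^sub>R B)"
      by (intro borel_integrable_compact) auto
  qed (use lim bound in auto)
  ultimately show ?thesis
    by (simp add: LIMSEQ_const_iff)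
qed

lemma test_functionsD:
  assumes "\<phi> \<in> test_functions \<Omega>"
  shows "smooth \<phi>" "compact (closure {x. \<phi> x \<noteq> 0})" "closure {x. \<phi> x \<noteq> 0} \<subseteq> \<Omega>"
  using assms by (auto simp: test_functions_def smooth_def)

lemma test_functionsI:
  assumes "smooth \<phi>" "compact K" "K \<subseteq> \<Omega>" "\<And>x. x \<notin> K \<Longrightarrow> \<phi> x = 0"
  shows "\<phi> \<in> test_functions \<Omega>"
proof -
  have "closure {x. \<phi> x \<noteq> 0} \<subseteq> K"
    using assms by (intro closure_minimal) (auto simp: compact_imp_closed)
  then show ?thesis
    using assms compact_closure bounded_subset[OF compact_imp_bounded[OF \<open>compact K\<close>]]
      closure_subset[of "{x. \<phi> x \<noteq> 0}"]
    by (auto simp: test_functions_def smooth_def)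
qed

lemma test_functions_partial:
  assumes "\<phi> \<in> test_functions \<Omega>" shows "partial i \<phi> \<in> test_functions \<Omega>"
  using test_functionsD[OF assms]
  by (intro test_functionsI[where K="closure {x. \<phi> x \<noteq> 0}"] smooth_partial partial_eq_0_outside)

lemma test_functions_compose2:
  assumes "\<phi> \<in> test_functions \<Omega>" "\<psi> \<in> test_functions \<Omega>"
    and "smooth (\<lambda>x. K (\<phi> x) (\<psi> x))" "K 0 0 = 0"
  shows "(\<lambda>x. K (\<phi> x) (\<psi> x)) \<in> test_functions \<Omega>"
proof (rule test_functionsI[where K="closure {x. \<phi> x \<noteq> 0} \<union> closure {x. \<psi> x \<noteq> 0}"])
  fix x assume "x \<notin> closure {x. \<phi> x \<noteq> 0} \<union> closure {x. \<psi> x \<noteq> 0}"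
  then have "\<phi> x = 0" "\<psi> x = 0"
    using closure_subset[of "{x. \<phi> x \<noteq> 0}"] closure_subset[of "{x. \<psi> x \<noteq> 0}"] by auto
  then show "K (\<phi> x) (\<psi> x) = 0" using assms by simp
qed (use assms test_functionsD[OF assms(1)] test_functionsD[OF assms(2)] in auto)

lemma test_functions_bounded:
  assumes "\<phi> \<in> test_functions \<Omega>" obtains B where "\<And>x. \<bar>\<phi> x\<bar> \<le> B"
proof -
  let ?K = "closure {x. \<phi> x \<noteq> 0}"
  have "bounded (\<phi> ` ?K)"
    using test_functionsD[OF assms] smooth_continuous
    by (intro compact_imp_bounded compact_continuous_image) (auto intro: continuous_on_subset)
  then obtain B where B: "\<And>x. x \<in> ?K \<Longrightarrow> \<bar>\<phi> x\<bar> \<le> B"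
    by (auto simp: bounded_iff)
  have "\<bar>\<phi> x\<bar> \<le> max B 0" for x
    using B[of x] closure_subset[of "{x. \<phi> x \<noteq> 0}"] by (cases "\<phi> x = 0") auto
  then show ?thesis using that by blast
qed

lemma test_functions_measurable [measurable]:
  "\<phi> \<in> test_functions \<Omega> \<Longrightarrow> \<phi> \<in> borel_measurable (lebesgue_on S)"
  by (intro measurable_restrict_space1 measurable_completion)
    (auto intro!: borel_measurable_continuous_onI smooth_continuous dest: test_functionsD(1))

lemma integrable_locally_mult_test:
  assumes \<Omega>: "\<Omega> \<in> sets lebesgue" and g: "locally_integrable \<Omega> g" and \<phi>: "\<phi> \<in> test_functions \<Omega>"
  shows "integrable (lebesgue_on \<Omega>) (\<lambda>x. g x * \<phi> x)"
proof -
  let ?K = "closure {x. \<phi> x \<noteq> 0}"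
  note \<phi>' = test_functionsD[OF \<phi>]
  obtain B where B: "\<And>x. \<bar>\<phi> x\<bar> \<le> B" using test_functions_bounded[OF \<phi>] by auto
  have K: "?K \<in> sets lebesgue" by (simp)
  have gK: "integrable (lebesgue_on ?K) g" using g \<phi>' by (auto simp: locally_integrable_def)
  have "integrable (lebesgue_on ?K) (\<lambda>x. g x * \<phi> x)"
  proof (rule Bochner_Integration.integrable_bound[OF integrable_mult_right[OF integrable_abs[OF gK], of B]])
    show "(\<lambda>x. g x * \<phi> x) \<in> borel_measurable (lebesgue_on ?K)"
      using gK \<phi> by (intro borel_measurable_times) auto
    show "AE x in lebesgue_on ?K. norm (g x * \<phi> x) \<le> norm (B * \<bar>g x\<bar>)"
    proof (rule AE_I2)
      fix x
      have "norm (g x * \<phi> x) = \<bar>\<phi> x\<bar> * \<bar>g x\<bar>" by (simp add: abs_mult)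
      also have "\<dots> \<le> \<bar>B\<bar> * \<bar>g x\<bar>" using B[of x] by (intro mult_right_mono) auto
      finally show "norm (g x * \<phi> x) \<le> norm (B * \<bar>g x\<bar>)" by (simp add: abs_mult)
    qed
  qed
  then have "integrable lebesgue (\<lambda>x. indicator ?K x *\<^sub>R (g x * \<phi> x))"
    using K by (simp add: integrable_restrict_space)
  moreover have "(\<lambda>x. indicator ?K x *\<^sub>R (g x * \<phi> x)) = (\<lambda>x. indicator \<Omega> x *\<^sub>R (g x * \<phi> x))"
  proof
    show "indicator ?K x *\<^sub>R (g x * \<phi> x) = indicator \<Omega> x *\<^sub>R (g x * \<phi> x)" for x
      using \<phi>'(3) closure_subset[of "{x. \<phi> x \<noteq> 0}"]
      by (cases "\<phi> x = 0") (auto simp: indicator_def)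
  qed
  ultimately have "integrable lebesgue (\<lambda>x. indicator \<Omega> x *\<^sub>R (g x * \<phi> x))"
    by simp
  with \<Omega> show ?thesis
    by (subst integrable_restrict_space) auto
qed

text \<open>
  Products of one-dimensional bumps converge to the indicator function of a box, which lets boxes
  replace test functions in the fundamental lemma.
\<close>

lemma bump_in_box:
  fixes a b :: "real^'n"
  assumes "cbox a b \<subseteq> \<Omega>"
  defines "\<phi> \<equiv> \<lambda>j x. \<Prod>i\<in>UNIV. flat 0 (real j * (x $ i - a $ i)) * flat 0 (real j * (b $ i - x $ i))"
  shows "\<phi> j \<in> test_functions \<Omega>" and "\<bar>\<phi> j x\<bar> \<le> 1"
    and "(\<lambda>j. \<phi> j x) \<longlonglongrightarrow> indicator (box a b) x" and "x \<notin> box a b \<Longrightarrow> \<phi> j x = 0"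
proof -
  show out: "\<phi> j x = 0" if "x \<notin> box a b" for j x
  proof -
    from that obtain i where "x $ i \<le> a $ i \<or> b $ i \<le> x $ i"
      by (auto simp: mem_box_cart not_less)
    then have "flat 0 (real j * (x $ i - a $ i)) * flat 0 (real j * (b $ i - x $ i)) = 0"
      by (auto simp: flat_0_nonpos mult_nonneg_nonpos)
    then show ?thesis
      unfolding \<phi>_def by (intro prod_zero) auto
  qed
  show "\<phi> j \<in> test_functions \<Omega>"
  proof (rule test_functionsI[OF _ compact_cbox assms(1)])
    have "Ck k (\<lambda>x. flat 0 (real j * (x $ i - a $ i)))" "Ck k (\<lambda>x. flat 0 (real j * (b $ i - x $ i)))" for k i
      by (intro Ck_compose_real[of flat, OF flat_has_derivative] Ck_cmult Ck_diff Ck_component Ck_const)+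
    then show "smooth (\<phi> j)"
      unfolding smooth_def \<phi>_def by (auto intro!: Ck_prod Ck_mult)
    show "\<phi> j x = 0" if "x \<notin> cbox a b" for x
      using out that box_subset_cbox by blast
  qed
  show "\<bar>\<phi> j x\<bar> \<le> 1"
    unfolding \<phi>_def abs_prod
    by (intro prod_le_1) (auto simp: abs_mult flat_0_nonneg intro!: mult_le_one flat_0_le_1)
  show "(\<lambda>j. \<phi> j x) \<longlonglongrightarrow> indicator (box a b) x"
  proof (cases "x \<in> box a b")
    case True
    have *: "(\<lambda>j. flat 0 (real j * c)) \<longlonglongrightarrow> 1" if "c > 0" for c
    proof (rule filterlim_compose[OF flat_0_tendsto])
      show "filterlim (\<lambda>j. real j * c) at_top sequentially"
        using filterlim_tendsto_pos_mult_at_top[OF tendsto_const that filterlim_real_sequentially]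
        by (simp add: mult.commute)
    qed
    have "(\<lambda>j. \<phi> j x) \<longlonglongrightarrow> (\<Prod>i\<in>(UNIV::'n set). 1 * 1)"
      unfolding \<phi>_def using True
      by (intro tendsto_prod tendsto_mult *) (auto simp: mem_box_cart)
    then show ?thesis using True by simp
  qed (simp add: out)
qed

lemma sigma_sets_box: "sigma_sets UNIV (range (\<lambda>(a, b). box a b :: 'a::euclidean_space set)) = sets borel"
  by (simp add: borel_eq_box)

text \<open>
  Boxes form a generator of the Borel sets that is closed under intersection, so the hypothesis extends
  to all Borel sets, and then to Lebesgue sets by ignoring null sets; integrate \<open>g\<close> over
  \<open>{g > 0}\<close> and \<open>{g < 0}\<close>.
\<close>

lemma integral_zero_on_boxes_imp_AE_zero:
  fixes g :: "'a::euclidean_space \<Rightarrow> real"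
  assumes g: "integrable lebesgue g"
    and box0: "\<And>c d. (\<integral>x. indicator (box c d) x * g x \<partial>lebesgue) = 0"
  shows "AE x in lebesgue. g x = 0"
proof -
  have int_mult: "integrable lebesgue (\<lambda>x. indicator A x * g x)" if "A \<in> sets lebesgue" for A
    using integrable_mult_indicator[OF that g] by simp
  have total: "(\<integral>x. g x \<partial>lebesgue) = 0"
  proof -
    have "(\<lambda>k. \<integral>x. indicator (box (- (real k *\<^sub>R One)) (real k *\<^sub>R One)) x * g x \<partial>lebesgue) \<longlonglongrightarrow> (\<integral>x. g x \<partial>lebesgue)"
    proof (rule integral_dominated_convergence[OF _ _ integrable_norm[OF g]])
      show "AE x in lebesgue. (\<lambda>k. indicat_real (box (- (real k *\<^sub>R One)) (real k *\<^sub>R One)) x * g x) \<longlonglongrightarrow> g x"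
      proof (rule AE_I2)
        fix x :: 'a
        have "\<forall>\<^sub>F k in sequentially. norm x < real k"
          using filterlim_real_sequentially by (auto simp: filterlim_at_top_dense)
        then have "\<forall>\<^sub>F k in sequentially. indicat_real (box (- (real k *\<^sub>R One)) (real k *\<^sub>R One)) x * g x = g x"
        proof eventually_elim
          case (elim k)
          have "\<bar>x \<bullet> i\<bar> < real k" if "i \<in> Basis" for i
            using Basis_le_norm[OF that, of x] elim by simp
          then show ?case
            by (auto simp: mem_box abs_less_iff minus_less_iff)
        qed
        then show "(\<lambda>k. indicat_real (box (- (real k *\<^sub>R One)) (real k *\<^sub>R One)) x * g x) \<longlonglongrightarrow> g x"
          by (rule tendsto_eventually)
      qed
    qed (use g int_mult in \<open>auto intro: borel_measurable_integrable simp: indicator_def\<close>)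
    then show ?thesis by (simp add: box0 LIMSEQ_const_iff)
  qed
  have borel0: "(\<integral>x. indicator A x * g x \<partial>lebesgue) = 0" if "A \<in> sets borel" for A
  proof -
    have stable: "Int_stable (range (\<lambda>(a, b). box a b :: 'a set))"
      by (auto simp: Int_stable_def box_Int_box)
    have pow: "range (\<lambda>(a, b). box a b :: 'a set) \<subseteq> Pow UNIV" by simp
    from stable pow that[folded sigma_sets_box]
    show ?thesis
    proof (induction rule: sigma_sets_induct_disjoint)
      case (basic A)
      then show ?case using box0 by auto
    next
      case empty
      then show ?case by simp
    next
      case (compl A)
      have A: "A \<in> sets lebesgue" using compl(1) by (simp add: sigma_sets_box)
      have "(\<integral>x. indicator (UNIV - A) x * g x \<partial>lebesgue) = (\<integral>x. g x - indicator A x * g x \<partial>lebesgue)"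
        by (intro Bochner_Integration.integral_cong) (auto simp: indicator_def)
      also have "\<dots> = 0"
        using compl(2) total int_mult[OF A] g by simp
      finally show ?case .
    next
      case (union A)
      have A: "A i \<in> sets lebesgue" for i using union(2) by (auto simp: sigma_sets_box)
      have "(\<integral>x\<in>(\<Union>i. A i). g x \<partial>lebesgue) = (\<Sum>i. \<integral>x\<in>A i. g x \<partial>lebesgue)"
      proof (rule lebesgue_integral_countable_add[OF A])
        show "A i \<inter> A j = {}" if "i \<noteq> j" for i j
          using union(1) that by (auto simp: disjoint_family_on_def)
        show "set_integrable lebesgue (\<Union>i. A i) g"
          unfolding set_integrable_def using A by (intro integrable_mult_indicator g) auto
      qed
      then show ?case
        using union(3) by (simp add: set_lebesgue_integral_def)
    qed
  qed
  have lebesgue0: "(\<integral>x. indicator A x * g x \<partial>lebesgue) = 0" if A: "A \<in> sets lebesgue" for A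
  proof -
    have "(\<integral>x. indicator A x * g x \<partial>lebesgue) = (\<integral>x. indicator (main_part lborel A) x * g x \<partial>lebesgue)"
    proof (rule integral_cong_AE)
      have "AE x in lborel. x \<in> main_part lborel A \<longleftrightarrow> x \<in> A"
        using A by (rule AE_in_main_part)
      then show "AE x in lebesgue. indicat_real A x * g x = indicat_real (main_part lborel A) x * g x"
        by (intro AE_completion) (auto elim!: eventually_mono)
    qed (use A int_mult[of A] int_mult[of "main_part lborel A"] in
        \<open>auto intro!: borel_measurable_integrable sets_completionI_sets\<close>)
    also have "\<dots> = 0" using A by (intro borel0) (metis main_part_sets sets_lborel)
    finally show ?thesis .
  qed
  have m: "g \<in> borel_measurable lebesgue" using g by (rule borel_measurable_integrable)
  let ?P = "{x \<in> space lebesgue. 0 < g x}" and ?N = "{x \<in> space lebesgue. g x < 0}"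
  have P: "?P \<in> sets lebesgue" and N: "?N \<in> sets lebesgue" using m by measurable
  have "AE x in lebesgue. indicator ?P x * g x = 0"
    using lebesgue0[OF P] int_mult[OF P]
    by (subst (asm) integral_nonneg_eq_0_iff_AE) (auto simp: indicator_def)
  moreover have "AE x in lebesgue. - (indicator ?N x * g x) = 0"
  proof (subst integral_nonneg_eq_0_iff_AE[symmetric])
    show "integrable lebesgue (\<lambda>x. - (indicator ?N x * g x))" using int_mult[OF N] by simp
    show "(\<integral>x. - (indicator ?N x * g x) \<partial>lebesgue) = 0" using lebesgue0[OF N] by simp
  qed (auto simp: indicator_def)
  ultimately show ?thesis
    by eventually_elim (auto simp: indicator_def split: if_splits)
qed

section \<open>The fundamental lemma and uniqueness of weak gradients\<close>

lemma integrable_lebesgue_on_iff: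
  fixes f :: "'a::euclidean_space \<Rightarrow> real"
  assumes "S \<in> sets lebesgue"
  shows "integrable (lebesgue_on S) f \<longleftrightarrow> integrable lebesgue (\<lambda>x. indicator S x *\<^sub>R f x)"
  using assms by (intro integrable_restrict_space) auto

text \<open>
  Testing with bumps that approximate a box whose closure lies in \<open>\<Omega>\<close> shows that the
  integrals of \<open>g\<close> over such boxes vanish; countably many of them, up to their boundaries,
  cover \<open>\<Omega>\<close>.
\<close>

lemma fundamental_lemma:
  fixes g :: "real^'n \<Rightarrow> real"
  assumes \<Omega>: "open \<Omega>" and g: "locally_integrable \<Omega> g"
    and zero: "\<And>\<phi>. \<phi> \<in> test_functions \<Omega> \<Longrightarrow> (\<integral>x. g x * \<phi> x \<partial>lebesgue_on \<Omega>) = 0"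
  shows "AE x in lebesgue_on \<Omega>. g x = 0"
proof -
  have \<Omega>m: "\<Omega> \<in> sets lebesgue" using \<Omega> by simp
  have box_zero: "(\<integral>x. indicator (box c d) x * g x \<partial>lebesgue_on \<Omega>) = 0"
    if cd: "cbox c d \<subseteq> \<Omega>" for c d
  proof -
    let ?\<phi> = "\<lambda>j x. \<Prod>i\<in>UNIV. flat 0 (real j * (x $ i - c $ i)) * flat 0 (real j * (d $ i - x $ i))"
    note \<phi> = bump_in_box[OF cd]
    have gK: "integrable lebesgue (\<lambda>x. indicator (cbox c d) x *\<^sub>R g x)"
      using g cd integrable_lebesgue_on_iff[of "cbox c d" g] by (auto simp: locally_integrable_def)
    then have dom: "integrable (lebesgue_on \<Omega>) (\<lambda>x. indicator (cbox c d) x *\<^sub>R \<bar>g x\<bar>)"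
    proof -
      have "(\<lambda>x. indicator \<Omega> x *\<^sub>R (indicator (cbox c d) x *\<^sub>R \<bar>g x\<bar>)) = (\<lambda>x. \<bar>indicator (cbox c d) x *\<^sub>R g x\<bar>)"
        using cd by (auto simp: indicator_def fun_eq_iff)
      with gK show ?thesis
        using \<Omega>m by (subst integrable_restrict_space) (auto intro: integrable_abs)
    qed
    have "(\<lambda>j. \<integral>x. g x * ?\<phi> j x \<partial>lebesgue_on \<Omega>) \<longlonglongrightarrow> (\<integral>x. indicator (box c d) x * g x \<partial>lebesgue_on \<Omega>)"
    proof (rule integral_dominated_convergence[OF _ _ dom])
      show meas: "(\<lambda>x. g x * ?\<phi> j x) \<in> borel_measurable (lebesgue_on \<Omega>)" for j
        using integrable_locally_mult_test[OF \<Omega>m g \<phi>(1)] by (rule borel_measurable_integrable)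
      show lim: "AE x in lebesgue_on \<Omega>. (\<lambda>j. g x * ?\<phi> j x) \<longlonglongrightarrow> indicator (box c d) x * g x"
        using tendsto_mult[OF tendsto_const \<phi>(3)] by (auto simp: mult.commute)
      show "(\<lambda>x. indicator (box c d) x * g x) \<in> borel_measurable (lebesgue_on \<Omega>)"
        by (rule borel_measurable_LIMSEQ_real[OF _ meas])
          (use tendsto_mult[OF tendsto_const \<phi>(3)] in \<open>auto simp: mult.commute\<close>)
      show "AE x in lebesgue_on \<Omega>. norm (g x * ?\<phi> j x) \<le> indicator (cbox c d) x *\<^sub>R \<bar>g x\<bar>" for j
      proof (rule AE_I2)
        fix x
        show "norm (g x * ?\<phi> j x) \<le> indicator (cbox c d) x *\<^sub>R \<bar>g x\<bar>"
        proof (cases "x \<in> cbox c d")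
          case True
          have "norm (g x * ?\<phi> j x) \<le> \<bar>g x\<bar> * 1"
            unfolding real_norm_def abs_mult by (intro mult_left_mono \<phi>(2)) auto
          then show ?thesis using True by simp
        next
          case False
          then have "?\<phi> j x = 0" using \<phi>(4) box_subset_cbox by blast
          then show ?thesis by (simp only: mult_zero_right norm_zero) simp
        qed
      qed
    qed
    then show ?thesis
      using zero[OF \<phi>(1)] by (simp add: LIMSEQ_const_iff)
  qed
  have ae_box: "AE x in lebesgue. x \<in> cbox c d \<longrightarrow> g x = 0" if cd: "cbox c d \<subseteq> \<Omega>" for c d
  proof -
    \<comment> \<open>Only local integrability of \<open>g\<close> is known, so \<open>g\<close> is restricted to one box; boxes intersected with it are again boxes in \<open>\<Omega>\<close>.\<close>
    define G where "G x = indicator (box c d) x * g x" for x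
    have "integrable lebesgue (\<lambda>x. indicator (cbox c d) x *\<^sub>R g x)"
      using g cd integrable_lebesgue_on_iff[of "cbox c d" g] by (auto simp: locally_integrable_def)
    then have "integrable lebesgue (\<lambda>x. indicator (box c d) x *\<^sub>R (indicator (cbox c d) x *\<^sub>R g x))"
      by (rule integrable_mult_indicator[rotated]) auto
    also have "(\<lambda>x. indicator (box c d) x *\<^sub>R (indicator (cbox c d) x *\<^sub>R g x)) = G"
      using box_subset_cbox[of c d] by (auto simp: G_def fun_eq_iff indicator_def)
    finally have G: "integrable lebesgue G" .
    have "AE x in lebesgue. G x = 0"
    proof (rule integral_zero_on_boxes_imp_AE_zero[OF G])
      fix e h :: "real^'n"
      obtain r s where rs: "box e h \<inter> box c d = box r s"
        unfolding box_Int_box by blast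
      have "(\<integral>x. indicator (box e h) x * G x \<partial>lebesgue) = (\<integral>x. indicator (box r s) x * g x \<partial>lebesgue)"
        by (intro Bochner_Integration.integral_cong) (auto simp: G_def rs[symmetric] indicator_def)
      also have "\<dots> = 0"
      proof (cases "box r s = {}")
        case False
        then have "cbox r s \<subseteq> cbox c d"
          using rs by (metis closure_box closure_minimal closed_cbox box_subset_cbox inf_le2 subset_trans)
        then have "cbox r s \<subseteq> \<Omega>" using cd by blast
        from box_zero[OF this]
        have "(\<integral>x. indicator \<Omega> x *\<^sub>R (indicator (box r s) x * g x) \<partial>lebesgue) = 0"
          using \<Omega>m by (simp add: integral_restrict_space)
        also have "(\<lambda>x. indicator \<Omega> x *\<^sub>R (indicator (box r s) x * g x)) = (\<lambda>x. indicator (box r s) x * g x)"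
          using \<open>cbox r s \<subseteq> \<Omega>\<close> box_subset_cbox[of r s] by (auto simp: indicator_def fun_eq_iff)
        finally show ?thesis .
      qed simp
      finally show "(\<integral>x. indicator (box e h) x * G x \<partial>lebesgue) = 0" .
    qed
    moreover have "AE x in lebesgue. x \<notin> cbox c d - box c d"
      by (rule AE_not_in) (use negligible_frontier_interval[of c d] in \<open>simp add: negligible_iff_null_sets\<close>)
    ultimately show ?thesis
      by eventually_elim (auto simp: G_def)
  qed
  obtain D where D: "countable D" "D \<subseteq> Pow \<Omega>" "\<And>X. X \<in> D \<Longrightarrow> \<exists>a b. X = cbox a b" "\<Union>D = \<Omega>"
    by (rule open_countable_Union_open_cbox[OF \<Omega>]) blast
  have "AE x in lebesgue. \<forall>X\<in>D. x \<in> X \<longrightarrow> g x = 0"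
    unfolding AE_ball_countable[OF D(1)]
  proof
    fix X assume X: "X \<in> D"
    from D(3)[OF X] obtain c d where cd: "X = cbox c d" by auto
    with D(2) X have "cbox c d \<subseteq> \<Omega>" by auto
    from ae_box[OF this] show "AE x in lebesgue. x \<in> X \<longrightarrow> g x = 0" by (simp add: cd)
  qed
  then have "AE x in lebesgue. x \<in> \<Omega> \<longrightarrow> g x = 0"
    by eventually_elim (use D(4) in auto)
  then show ?thesis
    using \<Omega>m by (simp add: AE_restrict_space_iff)
qed

lemma locally_integrable_diff:
  "locally_integrable \<Omega> f \<Longrightarrow> locally_integrable \<Omega> g \<Longrightarrow> locally_integrable \<Omega> (\<lambda>x. f x - g x)"
  by (auto simp: locally_integrable_def)

lemma integrable_imp_locally_integrable:
  assumes \<Omega>: "\<Omega> \<in> sets lebesgue" and g: "integrable (lebesgue_on \<Omega>) g"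
  shows "locally_integrable \<Omega> g"
  unfolding locally_integrable_def
proof (intro allI impI)
  fix K assume K: "compact K \<and> K \<subseteq> \<Omega>"
  then have Km: "K \<in> sets lebesgue" by (simp add: lmeasurable_compact fmeasurableD)
  have "integrable lebesgue (\<lambda>x. indicator \<Omega> x *\<^sub>R g x)"
    using g \<Omega> by (simp only: integrable_lebesgue_on_iff)
  then have "integrable lebesgue (\<lambda>x. indicator K x *\<^sub>R (indicator \<Omega> x *\<^sub>R g x))"
    by (rule integrable_mult_indicator[OF Km])
  also have "(\<lambda>x. indicator K x *\<^sub>R (indicator \<Omega> x *\<^sub>R g x)) = (\<lambda>x. indicator K x *\<^sub>R g x)"
    using K by (auto simp: indicator_def fun_eq_iff)
  finally show "integrable (lebesgue_on K) g"
    using Km by (subst integrable_restrict_space) auto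
qed

lemma has_weak_gradD:
  assumes "has_weak_grad \<Omega> u G"
  shows "locally_integrable \<Omega> u" "locally_integrable \<Omega> (\<lambda>x. G x $ i)"
    and "\<phi> \<in> test_functions \<Omega> \<Longrightarrow>
      (\<integral>x. u x * partial i \<phi> x \<partial>lebesgue_on \<Omega>) = - (\<integral>x. G x $ i * \<phi> x \<partial>lebesgue_on \<Omega>)"
  using assms by (auto simp: has_weak_grad_def)

lemma has_weak_grad_unique:
  assumes \<Omega>: "open \<Omega>" and G: "has_weak_grad \<Omega> u G" and H: "has_weak_grad \<Omega> u H"
  shows "AE x in lebesgue_on \<Omega>. G x = H x"
proof -
  have \<Omega>m: "\<Omega> \<in> sets lebesgue" using \<Omega> by simp
  have "AE x in lebesgue_on \<Omega>. G x $ i - H x $ i = 0" for i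
  proof (rule fundamental_lemma[OF \<Omega>])
    show "locally_integrable \<Omega> (\<lambda>x. G x $ i - H x $ i)"
      by (intro locally_integrable_diff has_weak_gradD(2)[OF G] has_weak_gradD(2)[OF H])
    fix \<phi> assume \<phi>: "\<phi> \<in> test_functions \<Omega>"
    show "(\<integral>x. (G x $ i - H x $ i) * \<phi> x \<partial>lebesgue_on \<Omega>) = 0"
      using has_weak_gradD(3)[OF G \<phi>, of i] has_weak_gradD(3)[OF H \<phi>, of i]
        integrable_locally_mult_test[OF \<Omega>m has_weak_gradD(2)[OF G] \<phi>, of i]
        integrable_locally_mult_test[OF \<Omega>m has_weak_gradD(2)[OF H] \<phi>, of i]
      by (simp add: left_diff_distrib)
  qed
  then have "AE x in lebesgue_on \<Omega>. \<forall>i. G x $ i - H x $ i = 0"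
    by (simp add: AE_all_countable)
  then show ?thesis
    by eventually_elim (simp add: vec_eq_iff)
qed

lemma has_weak_grad_weak_grad: "has_weak_grad \<Omega> u G \<Longrightarrow> has_weak_grad \<Omega> u (weak_grad \<Omega> u)"
  unfolding weak_grad_def by (rule someI[of "has_weak_grad \<Omega> u"])

lemma weak_grad_eq_AE:
  assumes "open \<Omega>" "has_weak_grad \<Omega> u G"
  shows "AE x in lebesgue_on \<Omega>. weak_grad \<Omega> u x = G x"
  using has_weak_grad_unique[OF assms(1) has_weak_grad_weak_grad[OF assms(2)] assms(2)] .

lemma has_weak_grad_diff:
  assumes \<Omega>: "open \<Omega>" and G: "has_weak_grad \<Omega> u G" and H: "has_weak_grad \<Omega> v H"
  shows "has_weak_grad \<Omega> (\<lambda>x. u x - v x) (\<lambda>x. G x - H x)"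
proof -
  have \<Omega>m: "\<Omega> \<in> sets lebesgue" using \<Omega> by simp
  note G' = has_weak_gradD[OF G] and H' = has_weak_gradD[OF H]
  show ?thesis
    unfolding has_weak_grad_def
  proof (intro conjI allI ballI)
    fix i and \<phi> assume \<phi>: "\<phi> \<in> test_functions \<Omega>"
    note int = integrable_locally_mult_test[OF \<Omega>m _ \<phi>]
      integrable_locally_mult_test[OF \<Omega>m _ test_functions_partial[OF \<phi>]]
    show "(\<integral>x. (u x - v x) * partial i \<phi> x \<partial>lebesgue_on \<Omega>) = - (\<integral>x. (G x - H x) $ i * \<phi> x \<partial>lebesgue_on \<Omega>)"
      using G'(3)[OF \<phi>, of i] H'(3)[OF \<phi>, of i]
      by (simp add: left_diff_distrib int G' H')
  qed (use G' H' in \<open>auto intro: locally_integrable_diff\<close>)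
qed

text \<open>
  The predicates coincide as functions, hence so do the chosen weak gradients: two solutions that agree
  almost everywhere have literally the same \<open>weak_grad\<close>.
\<close>

lemma has_weak_grad_cong_AE:
  assumes \<Omega>: "open \<Omega>" and uv: "AE x in lebesgue_on \<Omega>. u x = v x"
    and u: "u \<in> borel_measurable (lebesgue_on \<Omega>)" and v: "v \<in> borel_measurable (lebesgue_on \<Omega>)"
  shows "has_weak_grad \<Omega> u = has_weak_grad \<Omega> v"
proof -
  have \<Omega>m: "\<Omega> \<in> sets lebesgue" using \<Omega> by simp
  have "integrable (lebesgue_on K) u = integrable (lebesgue_on K) v" if K: "compact K" "K \<subseteq> \<Omega>" for K
  proof (rule integrable_cong_AE)
    have Km: "K \<in> sets lebesgue" using K by (simp add: lmeasurable_compact fmeasurableD)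
    show "u \<in> borel_measurable (lebesgue_on K)" "v \<in> borel_measurable (lebesgue_on K)"
      using u v K(2) by (auto intro: measurable_restrict_mono)
    show "AE x in lebesgue_on K. u x = v x"
      using uv K(2) Km \<Omega>m by (auto simp: AE_restrict_space_iff elim!: eventually_mono)
  qed
  then have "locally_integrable \<Omega> u = locally_integrable \<Omega> v"
    by (auto simp: locally_integrable_def)
  moreover have "(\<integral>x. u x * partial i \<phi> x \<partial>lebesgue_on \<Omega>) = (\<integral>x. v x * partial i \<phi> x \<partial>lebesgue_on \<Omega>)"
    if "\<phi> \<in> test_functions \<Omega>" for i \<phi>
    using uv u v test_functions_measurable[OF test_functions_partial[OF that]]
    by (intro integral_cong_AE borel_measurable_times) (auto elim!: eventually_mono)
  ultimately show ?thesis
    unfolding has_weak_grad_def by (intro ext) (simp cong: conj_cong)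
qed

lemma weak_grad_cong_AE:
  assumes "open \<Omega>" "AE x in lebesgue_on \<Omega>. u x = v x"
    "u \<in> borel_measurable (lebesgue_on \<Omega>)" "v \<in> borel_measurable (lebesgue_on \<Omega>)"
  shows "weak_grad \<Omega> u = weak_grad \<Omega> v"
  unfolding weak_grad_def has_weak_grad_cong_AE[OF assms] ..

lemma smooth_directional:
  assumes "smooth \<phi>"
  shows "((\<lambda>t. \<phi> (x + t *\<^sub>R axis i 1)) has_real_derivative partial i \<phi> x) (at 0)"
proof -
  let ?D = "frechet_derivative \<phi> (at x)"
  have D: "(\<phi> has_derivative ?D) (at x)"
    using smooth_differentiable[OF assms, of x] by (simp add: frechet_derivative_works)
  have "((\<lambda>t. \<phi> (x + t *\<^sub>R axis i 1)) has_derivative (\<lambda>t. ?D (t *\<^sub>R axis i 1))) (at 0)"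
    using D by (intro has_derivative_compose[of "\<lambda>t. x + t *\<^sub>R axis i 1" _ _ _ \<phi>])
      (auto intro!: derivative_eq_intros)
  moreover have "(\<lambda>t. ?D (t *\<^sub>R axis i 1)) = (\<lambda>t. partial i \<phi> x * t)"
    using has_derivative_linear[OF D] by (simp add: linear_scale partial_def mult.commute fun_eq_iff)
  ultimately show ?thesis
    by (simp add: has_field_derivative_def)
qed

lemma integral_derivative_compact_support:
  fixes f g :: "real^'n \<Rightarrow> real"
  assumes f: "continuous_on UNIV f" and g: "continuous_on UNIV g"
    and deriv: "\<And>x. ((\<lambda>t. f (x + t *\<^sub>R axis i 1)) has_real_derivative g x) (at 0)"
    and K: "compact K" "K \<subseteq> \<Omega>" "\<And>x. x \<notin> K \<Longrightarrow> f x = 0" and \<Omega>: "\<Omega> \<in> sets lebesgue"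
  shows "(\<integral>x. g x \<partial>lebesgue_on \<Omega>) = 0"
proof -
  obtain R where R: "\<And>x. x \<in> K \<Longrightarrow> norm x \<le> R"
    using K(1) by (meson bounded_iff compact_imp_bounded)
  have "(\<integral>x. g x \<partial>lborel) = 0"
    by (rule integral_directional_derivative_eq_0[OF f g deriv, of R]) (use R K in force)
  moreover have "g x = 0" if x: "x \<notin> K" for x
  proof -
    have "open (- K)" using K(1) by (simp add: compact_imp_closed open_Compl)
    then have "\<forall>\<^sub>F y in nhds x. y \<in> - K" using x by (intro eventually_nhds_in_open) auto
    moreover have "filterlim (\<lambda>t::real. x + t *\<^sub>R axis i 1) (nhds x) (nhds 0)"
    proof -
      have "isCont (\<lambda>t::real. x + t *\<^sub>R axis i 1) 0" by (intro continuous_intros)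
      then have "filterlim (\<lambda>t::real. x + t *\<^sub>R axis i 1) (nhds (x + 0 *\<^sub>R axis i 1)) (nhds 0)"
        unfolding isCont_def by (rule tendsto_at_iff_tendsto_nhds[of "\<lambda>t::real. x + t *\<^sub>R axis i 1" 0, THEN iffD1])
      then show ?thesis by simp
    qed
    ultimately have "\<forall>\<^sub>F t in nhds 0. x + t *\<^sub>R axis i 1 \<in> - K"
      by (rule eventually_compose_filterlim)
    then have "\<forall>\<^sub>F t in nhds 0. f (x + t *\<^sub>R axis i 1) = 0"
      by eventually_elim (use K in auto)
    then have "((\<lambda>t. 0) has_real_derivative g x) (at 0)"
      using deriv[of x] by (subst (asm) DERIV_cong_ev[OF refl _ refl]) 
    then show ?thesis by (metis DERIV_const DERIV_unique)
  qed
  moreover have "g \<in> borel_measurable lborel" using g by (simp add: borel_measurable_continuous_onI)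
  ultimately have "(\<integral>x. g x \<partial>lebesgue) = 0" by (simp add: integral_completion)
  also have "(\<lambda>x. g x) = (\<lambda>x. indicator \<Omega> x *\<^sub>R g x)"
    using \<open>\<And>x. x \<notin> K \<Longrightarrow> g x = 0\<close> K(2) by (auto simp: indicator_def fun_eq_iff)
  finally show ?thesis using \<Omega> by (simp add: integral_restrict_space)
qed

lemma continuous_imp_locally_integrable:
  fixes f :: "real^'n \<Rightarrow> real"
  assumes "continuous_on UNIV f" shows "locally_integrable \<Omega> f"
  unfolding locally_integrable_def
proof (intro allI impI)
  fix K assume K: "compact K \<and> K \<subseteq> \<Omega>"
  have "integrable lborel (\<lambda>x. indicator K x *\<^sub>R f x)"
    using K assms by (intro borel_integrable_compact) (auto intro: continuous_on_subset)
  then have "integrable lebesgue (\<lambda>x. indicator K x *\<^sub>R f x)"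
    by (simp add: integrable_completion borel_measurable_integrable)
  with K show "integrable (lebesgue_on K) f"
    by (simp only: integrable_lebesgue_on_iff lmeasurable_compact fmeasurableD)
qed

lemma integration_by_parts_test:
  fixes f g :: "real^'n \<Rightarrow> real"
  assumes f: "continuous_on UNIV f" and g: "continuous_on UNIV g"
    and deriv: "\<And>x. ((\<lambda>t. f (x + t *\<^sub>R axis i 1)) has_real_derivative g x) (at 0)"
    and \<Omega>: "\<Omega> \<in> sets lebesgue" and \<eta>: "\<eta> \<in> test_functions \<Omega>"
  shows "(\<integral>x. f x * partial i \<eta> x \<partial>lebesgue_on \<Omega>) = - (\<integral>x. g x * \<eta> x \<partial>lebesgue_on \<Omega>)"
proof -
  note s = test_functionsD[OF \<eta>]
  have "(\<integral>x. g x * \<eta> x + partial i \<eta> x * f x \<partial>lebesgue_on \<Omega>) = 0"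
  proof (rule integral_derivative_compact_support[where f="\<lambda>x. f x * \<eta> x" and K="closure {x. \<eta> x \<noteq> 0}" and i=i])
    show "((\<lambda>t. f (x + t *\<^sub>R axis i 1) * \<eta> (x + t *\<^sub>R axis i 1)) has_real_derivative
        g x * \<eta> x + partial i \<eta> x * f x) (at 0)" for x
      using DERIV_mult[OF deriv smooth_directional[OF s(1)], of x x i] by simp
    show "f x * \<eta> x = 0" if "x \<notin> closure {x. \<eta> x \<noteq> 0}" for x
      using that closure_subset[of "{x. \<eta> x \<noteq> 0}"] by auto
    show "continuous_on UNIV (\<lambda>x. f x * \<eta> x)"
      by (intro continuous_on_mult f smooth_continuous s)
    show "continuous_on UNIV (\<lambda>x. g x * \<eta> x + partial i \<eta> x * f x)"
      by (intro continuous_on_add continuous_on_mult f g smooth_continuous smooth_partial s)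
  qed (use s \<Omega> in auto)
  moreover have "integrable (lebesgue_on \<Omega>) (\<lambda>x. g x * \<eta> x)"
    "integrable (lebesgue_on \<Omega>) (\<lambda>x. f x * partial i \<eta> x)"
    by (intro integrable_locally_mult_test \<Omega> \<eta> test_functions_partial continuous_imp_locally_integrable f g)+
  ultimately show ?thesis by (simp add: mult.commute[of "partial i \<eta> _"])
qed

section \<open>Convergence in the q-th mean\<close>

lemma powr_add_le:
  fixes a b q :: real
  assumes "0 \<le> q"
  shows "\<bar>a + b\<bar> powr q \<le> 2 powr q * (\<bar>a\<bar> powr q + \<bar>b\<bar> powr q)"
proof -
  have "\<bar>a + b\<bar> powr q \<le> (2 * max \<bar>a\<bar> \<bar>b\<bar>) powr q"
    using assms by (intro powr_mono2) auto
  also have "\<dots> = 2 powr q * max \<bar>a\<bar> \<bar>b\<bar> powr q" by (simp add: powr_mult)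
  also have "\<dots> \<le> 2 powr q * (\<bar>a\<bar> powr q + \<bar>b\<bar> powr q)"
    by (intro mult_left_mono) (auto simp: max_def)
  finally show ?thesis .
qed

lemma integrable_powr_add:
  fixes f g :: "'a \<Rightarrow> real"
  assumes q: "0 \<le> q" and f: "f \<in> borel_measurable M" "integrable M (\<lambda>x. \<bar>f x\<bar> powr q)"
    and g: "g \<in> borel_measurable M" "integrable M (\<lambda>x. \<bar>g x\<bar> powr q)"
  shows "integrable M (\<lambda>x. \<bar>f x + g x\<bar> powr q)" "integrable M (\<lambda>x. \<bar>f x - g x\<bar> powr q)"
proof -
  note [measurable] = f(1) g(1)
  have dom: "integrable M (\<lambda>x. 2 powr q * (\<bar>f x\<bar> powr q + \<bar>g x\<bar> powr q))"
    using f g by simp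
  show "integrable M (\<lambda>x. \<bar>f x + g x\<bar> powr q)"
    by (rule Bochner_Integration.integrable_bound[OF dom])
      (use powr_add_le[OF q, of "f _" "g _"] in auto)
  show "integrable M (\<lambda>x. \<bar>f x - g x\<bar> powr q)"
    by (rule Bochner_Integration.integrable_bound[OF dom])
      (use powr_add_le[OF q, of "f _" "- g _"] in auto)
qed

text \<open>
  Convergence in the \<open>q\<close>-th mean.  Only the differences are asked to have integrable
  powers; integrability of the limit is a separate hypothesis where it matters.
\<close>

definition Lp_conv :: "'a measure \<Rightarrow> real \<Rightarrow> (nat \<Rightarrow> 'a \<Rightarrow> real) \<Rightarrow> ('a \<Rightarrow> real) \<Rightarrow> bool" where
  "Lp_conv M q f g \<longleftrightarrow> (\<forall>n. f n \<in> borel_measurable M) \<and> g \<in> borel_measurable M \<and>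
     (\<forall>n. integrable M (\<lambda>x. \<bar>f n x - g x\<bar> powr q)) \<and>
     (\<lambda>n. \<integral>x. \<bar>f n x - g x\<bar> powr q \<partial>M) \<longlonglongrightarrow> 0"

lemma Lp_convD:
  assumes "Lp_conv M q f g"
  shows "f n \<in> borel_measurable M" "g \<in> borel_measurable M"
    "integrable M (\<lambda>x. \<bar>f n x - g x\<bar> powr q)" "(\<lambda>n. \<integral>x. \<bar>f n x - g x\<bar> powr q \<partial>M) \<longlonglongrightarrow> 0"
  using assms by (auto simp: Lp_conv_def)

lemma Lp_conv_dominated:
  assumes f: "\<And>n. f n \<in> borel_measurable M" and g: "g \<in> borel_measurable M"
    and D: "\<And>n. integrable M (D n)" "(\<lambda>n. \<integral>x. D n x \<partial>M) \<longlonglongrightarrow> 0"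
    and le: "\<And>n. AE x in M. \<bar>f n x - g x\<bar> powr q \<le> D n x"
  shows "Lp_conv M q f g"
proof -
  note [measurable] = f g
  have int: "integrable M (\<lambda>x. \<bar>f n x - g x\<bar> powr q)" for n
    by (rule Bochner_Integration.integrable_bound[OF D(1)[of n]]) (use le[of n] in \<open>auto elim!: eventually_mono\<close>)
  moreover have "(\<lambda>n. \<integral>x. \<bar>f n x - g x\<bar> powr q \<partial>M) \<longlonglongrightarrow> 0"
  proof (rule tendsto_sandwich[OF _ _ tendsto_const D(2)])
    show "\<forall>\<^sub>F n in sequentially. (\<integral>x. \<bar>f n x - g x\<bar> powr q \<partial>M) \<le> (\<integral>x. D n x \<partial>M)"
      by (intro always_eventually allI integral_mono_AE int D le)
  qed simp
  ultimately show ?thesis using f g by (simp add: Lp_conv_def)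
qed

lemma Lp_conv_add:
  assumes "0 \<le> q" "Lp_conv M q f g" "Lp_conv M q f' g'"
  shows "Lp_conv M q (\<lambda>n x. f n x + f' n x) (\<lambda>x. g x + g' x)"
proof (rule Lp_conv_dominated)
  note 1 = Lp_convD[OF assms(2)] and 2 = Lp_convD[OF assms(3)]
  let ?D = "\<lambda>n x. 2 powr q * (\<bar>f n x - g x\<bar> powr q + \<bar>f' n x - g' x\<bar> powr q)"
  show "integrable M (?D n)" for n using 1 2 by simp
  show "(\<lambda>n. \<integral>x. ?D n x \<partial>M) \<longlonglongrightarrow> 0"
    using tendsto_mult[OF tendsto_const[of "2 powr q"] tendsto_add[OF 1(4) 2(4)]] 1 2 by simp
  show "AE x in M. \<bar>f n x + f' n x - (g x + g' x)\<bar> powr q \<le> ?D n x" for n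
    using powr_add_le[OF assms(1), of "f n _ - g _" "f' n _ - g' _"] by (simp add: algebra_simps)
qed (use Lp_convD[OF assms(2)] Lp_convD[OF assms(3)] in auto)

text \<open>
  In \<open>c f - c' g = c (f - g) + (c - c') g\<close> the first part is small in the mean, and the
  second tends to 0 by dominated convergence with the fixed majorant \<open>(2 B |g|)\<^sup>q\<close>.
  This is how coefficients that converge only almost everywhere are multiplied with gradients that
  converge only in the mean.
\<close>

lemma Lp_conv_mult_bounded:
  fixes f c :: "nat \<Rightarrow> 'a \<Rightarrow> real"
  assumes q: "0 < q" and fg: "Lp_conv M q f g" and g: "integrable M (\<lambda>x. \<bar>g x\<bar> powr q)"
    and c: "\<And>n. c n \<in> borel_measurable M" "c' \<in> borel_measurable M"
    and B: "\<And>n x. \<bar>c n x\<bar> \<le> B" and lim: "AE x in M. (\<lambda>n. c n x) \<longlonglongrightarrow> c' x"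
  shows "Lp_conv M q (\<lambda>n x. c n x * f n x) (\<lambda>x. c' x * g x)"
proof (rule Lp_conv_dominated)
  note 1 = Lp_convD[OF fg]
  note [measurable] = c 1(1,2)
  have B0: "0 \<le> B" using B[of 0 undefined] by linarith
  have c': "AE x in M. \<bar>c' x\<bar> \<le> B"
    using lim
  proof eventually_elim
    case (elim x)
    from tendsto_rabs[OF elim] show ?case by (rule LIMSEQ_le_const2) (use B in auto)
  qed
  let ?E = "\<lambda>n x. \<bar>c n x - c' x\<bar> powr q * \<bar>g x\<bar> powr q"
  let ?D = "\<lambda>n x. 2 powr q * (B powr q * \<bar>f n x - g x\<bar> powr q + ?E n x)"
  have dom: "integrable M (\<lambda>x. (2 * B) powr q * \<bar>g x\<bar> powr q)" using g by simp
  have E_le: "AE x in M. norm (?E n x) \<le> (2 * B) powr q * \<bar>g x\<bar> powr q" for n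
    using c'
  proof eventually_elim
    case (elim x)
    have "\<bar>c n x - c' x\<bar> \<le> 2 * B" using B[of n x] elim by linarith
    then show ?case using q by (auto intro!: mult_right_mono powr_mono2)
  qed
  have E_int: "integrable M (?E n)" for n
    by (rule Bochner_Integration.integrable_bound[OF dom]) (use E_le[of n] in \<open>auto elim!: eventually_mono\<close>)
  have "(\<lambda>n. \<integral>x. ?E n x \<partial>M) \<longlonglongrightarrow> (\<integral>x. 0 \<partial>M)"
  proof (rule integral_dominated_convergence[OF _ _ dom _ E_le])
    show "AE x in M. (\<lambda>n. ?E n x) \<longlonglongrightarrow> 0"
      using lim
    proof eventually_elim
      case (elim x)
      have "(\<lambda>n. \<bar>c n x - c' x\<bar>) \<longlonglongrightarrow> 0"
        using tendsto_rabs[OF tendsto_diff[OF elim tendsto_const[of "c' x"]]] by simp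
      then have "(\<lambda>n. \<bar>c n x - c' x\<bar> powr q) \<longlonglongrightarrow> 0"
        using q by (intro tendsto_zero_powrI[OF _ tendsto_const]) auto
      then show ?case by (rule tendsto_mult_left_zero)
    qed
  qed auto
  then have E0: "(\<lambda>n. \<integral>x. ?E n x \<partial>M) \<longlonglongrightarrow> 0" by simp
  show "integrable M (?D n)" for n using 1 E_int by simp
  show "(\<lambda>n. \<integral>x. ?D n x \<partial>M) \<longlonglongrightarrow> 0"
    using tendsto_mult[OF tendsto_const[of "2 powr q"] tendsto_add[OF tendsto_mult[OF tendsto_const[of "B powr q"] 1(4)] E0]]
      1 E_int by simp
  show "AE x in M. \<bar>c n x * f n x - c' x * g x\<bar> powr q \<le> ?D n x" for n
  proof (rule AE_I2)
    fix x
    have "c n x * f n x - c' x * g x = c n x * (f n x - g x) + (c n x - c' x) * g x"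
      by (simp add: algebra_simps)
    then have "\<bar>c n x * f n x - c' x * g x\<bar> powr q \<le>
      2 powr q * (\<bar>c n x * (f n x - g x)\<bar> powr q + \<bar>(c n x - c' x) * g x\<bar> powr q)"
      using powr_add_le[of q "c n x * (f n x - g x)" "(c n x - c' x) * g x"] q by simp
    also have "\<dots> \<le> ?D n x"
      using q B[of n x] by (auto simp: abs_mult powr_mult intro!: mult_right_mono powr_mono2)
    finally show "\<bar>c n x * f n x - c' x * g x\<bar> powr q \<le> ?D n x" .
  qed
qed (use c Lp_convD[OF fg] in auto)

lemma Lp_conv_subseq:
  assumes "Lp_conv M q f g" "strict_mono r"
  shows "Lp_conv M q (\<lambda>n. f (r n)) g"
  using Lp_convD[OF assms(1)] LIMSEQ_subseq_LIMSEQ[OF _ assms(2)]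
  by (auto simp: Lp_conv_def o_def)

text \<open>
  On a finite measure space this replaces the Hoelder inequality: the constant \<open>e\<close> is
  arbitrarily small, and the other term is controlled by the \<open>q\<close>-th mean.
\<close>

lemma abs_le_powr_scaled:
  fixes e t q :: real
  assumes "0 < e" "1 \<le> q"
  shows "\<bar>t\<bar> \<le> e + e powr (1 - q) * \<bar>t\<bar> powr q"
proof (cases "\<bar>t\<bar> \<le> e")
  case False
  then have "\<bar>t\<bar> = \<bar>t\<bar> powr (1 - q) * \<bar>t\<bar> powr q"
    using assms by (simp flip: powr_add)
  also have "\<dots> \<le> e powr (1 - q) * \<bar>t\<bar> powr q"
    using False assms by (intro mult_right_mono powr_mono2') auto
  finally show ?thesis using assms by linarith
qed (simp add: add_increasing2)

lemma (in finite_measure) integrable_of_powr: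
  fixes g :: "'a \<Rightarrow> real"
  assumes "1 \<le> q" "g \<in> borel_measurable M" "integrable M (\<lambda>x. \<bar>g x\<bar> powr q)"
  shows "integrable M g"
proof (rule Bochner_Integration.integrable_bound)
  show "integrable M (\<lambda>x. 1 + 1 powr (1 - q) * \<bar>g x\<bar> powr q)" using assms by simp
  show "AE x in M. norm (g x) \<le> norm (1 + 1 powr (1 - q) * \<bar>g x\<bar> powr q)"
    using abs_le_powr_scaled[of 1 q "g _"] assms(1) by simp
qed (use assms in simp)

lemma (in finite_measure) Lp_conv_imp_L1:
  assumes q: "1 \<le> q" and fg: "Lp_conv M q f g"
  shows "Lp_conv M 1 f g"
proof -
  note 1 = Lp_convD[OF fg]
  note [measurable] = 1(1,2)
  have int: "integrable M (\<lambda>x. \<bar>f n x - g x\<bar>)" for n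
    using integrable_of_powr[OF q _ 1(3)[of n]] by simp
  have "(\<lambda>n. \<integral>x. \<bar>f n x - g x\<bar> \<partial>M) \<longlonglongrightarrow> 0"
  proof (rule LIMSEQ_I)
    fix r :: real assume r: "0 < r"
    \<comment> \<open>The measure of the space times \<open>e\<close> is at most \<open>r / 2\<close>, also when the space is a null set.\<close>
    define e where "e = r / (2 * (measure M (space M) + 1))"
    have pos: "0 < measure M (space M) + 1" using measure_nonneg[of M "space M"] by linarith
    have e: "0 < e" using r pos by (simp add: e_def)
    have em: "e * measure M (space M) < r / 2 + r / 4"
    proof -
      have "e * measure M (space M) \<le> e * (measure M (space M) + 1)" using e by simp
      also have "\<dots> = r / 2"
      proof -
        have "r / (2 * c) * c = r / 2" if "0 < c" for c :: real using that by simp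
        from this[OF pos] show ?thesis by (simp only: e_def)
      qed
      finally show ?thesis using r by linarith
    qed
    have "(\<lambda>n. e powr (1 - q) * (\<integral>x. \<bar>f n x - g x\<bar> powr q \<partial>M)) \<longlonglongrightarrow> 0"
      using tendsto_mult[OF tendsto_const[of "e powr (1 - q)"] 1(4)] by simp
    then obtain N where N: "\<And>n. n \<ge> N \<Longrightarrow> \<bar>e powr (1 - q) * (\<integral>x. \<bar>f n x - g x\<bar> powr q \<partial>M)\<bar> < r / 4"
      using r LIMSEQ_D[of _ 0 "r / 4"] by fastforce
    show "\<exists>N. \<forall>n\<ge>N. norm ((\<integral>x. \<bar>f n x - g x\<bar> \<partial>M) - 0) < r"
    proof (intro exI allI impI)
      fix n assume "N \<le> n"
      have "(\<integral>x. \<bar>f n x - g x\<bar> \<partial>M) \<le> (\<integral>x. e + e powr (1 - q) * \<bar>f n x - g x\<bar> powr q \<partial>M)"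
        using abs_le_powr_scaled[OF e q] int 1(3) by (intro integral_mono) auto
      also have "\<dots> = e * measure M (space M) + e powr (1 - q) * (\<integral>x. \<bar>f n x - g x\<bar> powr q \<partial>M)"
        using 1(3) by simp
      finally show "norm ((\<integral>x. \<bar>f n x - g x\<bar> \<partial>M) - 0) < r"
        using N[OF \<open>N \<le> n\<close>] em by simp
    qed
  qed
  then show ?thesis using int 1 by (simp add: Lp_conv_def)
qed

lemma Lp_conv_1_integrable:
  assumes fg: "Lp_conv M 1 f g" and g: "integrable M g"
  shows "integrable M (f n)"
proof -
  note [measurable] = Lp_convD(1,2)[OF fg]
  have "integrable M (\<lambda>x. f n x - g x)"
    using Lp_convD(3)[OF fg, of n] by (simp add: integrable_abs_iff)
  then have "integrable M (\<lambda>x. (f n x - g x) + g x)" using g by (rule Bochner_Integration.integrable_add)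
  then show ?thesis by simp
qed

lemma integrable_mult_bounded:
  fixes f g :: "'a \<Rightarrow> real"
  assumes g: "integrable M g" and f: "f \<in> borel_measurable M" and B: "\<And>x. \<bar>f x\<bar> \<le> B"
  shows "integrable M (\<lambda>x. g x * f x)" "integrable M (\<lambda>x. f x * g x)"
proof -
  show "integrable M (\<lambda>x. g x * f x)"
  proof (rule Bochner_Integration.integrable_bound[OF integrable_mult_right[OF g, of B]])
    show "AE x in M. norm (g x * f x) \<le> norm (B * g x)"
    proof (rule AE_I2)
      fix x
      have "\<bar>g x\<bar> * \<bar>f x\<bar> \<le> \<bar>g x\<bar> * \<bar>B\<bar>" using B[of x] by (intro mult_left_mono) auto
      then show "norm (g x * f x) \<le> norm (B * g x)" by (simp add: abs_mult mult.commute)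
    qed
  qed (use f borel_measurable_integrable[OF g] in simp)
  then show "integrable M (\<lambda>x. f x * g x)" by (simp add: mult.commute)
qed

lemma Lp_conv_1_integral:
  assumes fg: "Lp_conv M 1 f g" and g: "integrable M g"
    and \<psi>: "\<psi> \<in> borel_measurable M" "\<And>x. \<bar>\<psi> x\<bar> \<le> B"
  shows "(\<lambda>n. \<integral>x. f n x * \<psi> x \<partial>M) \<longlonglongrightarrow> (\<integral>x. g x * \<psi> x \<partial>M)"
proof -
  note 1 = Lp_convD[OF fg]
  note [measurable] = 1(1,2)
  have int: "integrable M (\<lambda>x. \<bar>f n x - g x\<bar>)" for n using 1(3)[of n] by simp
  have 0: "(\<lambda>n. B * (\<integral>x. \<bar>f n x - g x\<bar> \<partial>M)) \<longlonglongrightarrow> 0"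
    using tendsto_mult[OF tendsto_const[of B] 1(4)] by simp
  have f: "integrable M (f n)" for n by (rule Lp_conv_1_integrable[OF fg g])
  note intm = integrable_mult_bounded(1)[OF _ \<psi>]
  have "(\<lambda>n. (\<integral>x. f n x * \<psi> x \<partial>M) - (\<integral>x. g x * \<psi> x \<partial>M)) \<longlonglongrightarrow> 0"
  proof (rule Lim_null_comparison[OF _ 0], intro always_eventually allI)
    fix n
    have "(\<integral>x. f n x * \<psi> x \<partial>M) - (\<integral>x. g x * \<psi> x \<partial>M) = (\<integral>x. (f n x - g x) * \<psi> x \<partial>M)"
      using intm[OF f[of n]] intm[OF g] by (simp add: left_diff_distrib)
    also have "norm \<dots> \<le> (\<integral>x. norm ((f n x - g x) * \<psi> x) \<partial>M)" by (rule integral_norm_bound)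
    also have "\<dots> \<le> (\<integral>x. B * \<bar>f n x - g x\<bar> \<partial>M)"
    proof (rule integral_mono)
      show "integrable M (\<lambda>x. norm ((f n x - g x) * \<psi> x))"
        using intm[OF Bochner_Integration.integrable_diff[OF f[of n] g]] by (rule integrable_norm)
      show "norm ((f n x - g x) * \<psi> x) \<le> B * \<bar>f n x - g x\<bar>" for x
        using mult_left_mono[OF \<psi>(2)[of x], of "\<bar>f n x - g x\<bar>"] by (simp add: abs_mult mult.commute)
    qed (use int in simp)
    also have "\<dots> = B * (\<integral>x. \<bar>f n x - g x\<bar> \<partial>M)" by simp
    finally show "norm ((\<integral>x. f n x * \<psi> x \<partial>M) - (\<integral>x. g x * \<psi> x \<partial>M)) \<le> B * (\<integral>x. \<bar>f n x - g x\<bar> \<partial>M)" .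
  qed
  then show ?thesis by (rule LIM_zero_cancel)
qed

lemma Lp_conv_1_AE_subseq:
  assumes fg: "Lp_conv M 1 f g"
  obtains r :: "nat \<Rightarrow> nat" where "strict_mono r" "AE x in M. (\<lambda>n. f (r n) x) \<longlonglongrightarrow> g x"
proof -
  note 1 = Lp_convD[OF fg]
  note [measurable] = 1(1,2)
  have "\<exists>r::nat\<Rightarrow>nat. strict_mono r \<and> (AE x in M. (\<lambda>n. f (r n) x - g x) \<longlonglongrightarrow> 0)"
    using 1(3,4) by (intro tendsto_L1_AE_subseq) (auto simp: integrable_abs_iff)
  then show ?thesis using that by (auto simp: LIM_zero_iff)
qed

section \<open>Approximation by test functions\<close>

text \<open>
  \<open>K1\<close> and \<open>K2\<close> are the partial derivatives of the \<open>C\<^sup>1\<close>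
  function \<open>K\<close> of two variables.  Bounded derivatives keep the composition with Sobolev
  functions inside the same spaces.
\<close>

definition C1_bounded :: "(real \<Rightarrow> real \<Rightarrow> real) \<Rightarrow> (real \<Rightarrow> real \<Rightarrow> real) \<Rightarrow> (real \<Rightarrow> real \<Rightarrow> real) \<Rightarrow> bool" where
  "C1_bounded K K1 K2 \<longleftrightarrow>
     (\<forall>r s. ((\<lambda>z. K (fst z) (snd z)) has_derivative (\<lambda>h. K1 r s * fst h + K2 r s * snd h)) (at (r, s))) \<and>
     continuous_on UNIV (\<lambda>z. K1 (fst z) (snd z)) \<and> continuous_on UNIV (\<lambda>z. K2 (fst z) (snd z)) \<and>
     (\<exists>B. \<forall>r s. \<bar>K1 r s\<bar> \<le> B \<and> \<bar>K2 r s\<bar> \<le> B)"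

lemma C1_boundedD:
  assumes "C1_bounded K K1 K2"
  shows "((\<lambda>z. K (fst z) (snd z)) has_derivative (\<lambda>h. K1 r s * fst h + K2 r s * snd h)) (at (r, s))"
    "continuous_on UNIV (\<lambda>z. K1 (fst z) (snd z))" "continuous_on UNIV (\<lambda>z. K2 (fst z) (snd z))"
    "continuous_on UNIV (\<lambda>z. K (fst z) (snd z))"
proof -
  show 1: "((\<lambda>z. K (fst z) (snd z)) has_derivative (\<lambda>h. K1 r s * fst h + K2 r s * snd h)) (at (r, s))" for r s
    using assms by (simp add: C1_bounded_def)
  show "continuous_on UNIV (\<lambda>z. K (fst z) (snd z))"
    using has_derivative_continuous[OF 1] by (auto intro!: continuous_at_imp_continuous_on)
qed (use assms in \<open>auto simp: C1_bounded_def\<close>)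

lemma C1_bounded_obtain:
  assumes "C1_bounded K K1 K2"
  obtains B where "0 \<le> B" "\<And>r s. \<bar>K1 r s\<bar> \<le> B" "\<And>r s. \<bar>K2 r s\<bar> \<le> B"
    "\<And>r s r' s'. \<bar>K r s - K r' s'\<bar> \<le> B * (\<bar>r - r'\<bar> + \<bar>s - s'\<bar>)"
proof -
  obtain B where B: "\<And>r s. \<bar>K1 r s\<bar> \<le> B" "\<And>r s. \<bar>K2 r s\<bar> \<le> B"
    using assms unfolding C1_bounded_def by blast
  have B0: "0 \<le> B" using B(1)[of 0 0] by linarith
  have "\<bar>K r s - K r' s'\<bar> \<le> B * (\<bar>r - r'\<bar> + \<bar>s - s'\<bar>)" for r s r' s'
  proof -
    define k where "k t = K (r' + t * (r - r')) (s' + t * (s - s'))" for t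
    define k' where "k' t = K1 (r' + t * (r - r')) (s' + t * (s - s')) * (r - r') +
      K2 (r' + t * (r - r')) (s' + t * (s - s')) * (s - s')" for t
    have "(k has_real_derivative k' t) (at t)" for t
    proof -
      have "((\<lambda>t. (r' + t * (r - r'), s' + t * (s - s'))) has_derivative (\<lambda>h. (h * (r - r'), h * (s - s')))) (at t)"
        by (auto intro!: derivative_eq_intros)
      from has_derivative_compose[OF this C1_boundedD(1)[OF assms]]
      have "(k has_derivative (\<lambda>h. K1 (r' + t * (r - r')) (s' + t * (s - s')) * (h * (r - r')) +
        K2 (r' + t * (r - r')) (s' + t * (s - s')) * (h * (s - s')))) (at t)"
        by (simp add: k_def[abs_def])
      also have "(\<lambda>h. K1 (r' + t * (r - r')) (s' + t * (s - s')) * (h * (r - r')) +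
        K2 (r' + t * (r - r')) (s' + t * (s - s')) * (h * (s - s'))) = (*) (k' t)"
        by (simp add: k'_def fun_eq_iff distrib_left mult_ac)
      finally show ?thesis
        unfolding has_field_derivative_def .
    qed
    then have "\<exists>z>0. z < 1 \<and> k 1 - k 0 = (1 - 0) * k' z" by (intro MVT2) auto
    then obtain z where "k 1 - k 0 = k' z" by auto
    then have "\<bar>K r s - K r' s'\<bar> = \<bar>k' z\<bar>" by (simp add: k_def)
    also have "\<dots> \<le> B * \<bar>r - r'\<bar> + B * \<bar>s - s'\<bar>"
      unfolding k'_def
      by (rule order_trans[OF abs_triangle_ineq]) (auto simp: abs_mult B intro!: add_mono mult_right_mono)
    finally show ?thesis by (simp add: algebra_simps)
  qed
  with B B0 that show ?thesis by blast
qed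

text \<open>
  A function of \<open>W\<^sub>0\<close> together with its gradient is represented by a concrete
  sequence of test functions.  Convergence almost everywhere is included because nonlinear functions of
  \<open>v\<close> are passed to the limit by dominated convergence.
\<close>

definition approximates ::
  "(real^'n) set \<Rightarrow> real^'n \<Rightarrow> (nat \<Rightarrow> real^'n \<Rightarrow> real) \<Rightarrow> (real^'n \<Rightarrow> real) \<Rightarrow> (real^'n \<Rightarrow> real^'n) \<Rightarrow> bool" where
  "approximates \<Omega> p \<phi> v V \<longleftrightarrow>
     (\<forall>n. \<phi> n \<in> test_functions \<Omega>) \<and> (AE x in lebesgue_on \<Omega>. (\<lambda>n. \<phi> n x) \<longlonglongrightarrow> v x) \<and>
     integrable (lebesgue_on \<Omega>) v \<and> Lp_conv (lebesgue_on \<Omega>) 1 \<phi> v \<and>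
     (\<forall>i. integrable (lebesgue_on \<Omega>) (\<lambda>x. \<bar>V x $ i\<bar> powr (p $ i)) \<and>
          Lp_conv (lebesgue_on \<Omega>) (p $ i) (\<lambda>n. partial i (\<phi> n)) (\<lambda>x. V x $ i))"

lemma approximatesD:
  assumes "approximates \<Omega> p \<phi> v V"
  shows "\<phi> n \<in> test_functions \<Omega>" "AE x in lebesgue_on \<Omega>. (\<lambda>n. \<phi> n x) \<longlonglongrightarrow> v x"
    "integrable (lebesgue_on \<Omega>) v" "Lp_conv (lebesgue_on \<Omega>) 1 \<phi> v"
    "integrable (lebesgue_on \<Omega>) (\<lambda>x. \<bar>V x $ i\<bar> powr (p $ i))"
    "Lp_conv (lebesgue_on \<Omega>) (p $ i) (\<lambda>n. partial i (\<phi> n)) (\<lambda>x. V x $ i)"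
    "v \<in> borel_measurable (lebesgue_on \<Omega>)" "(\<lambda>x. V x $ i) \<in> borel_measurable (lebesgue_on \<Omega>)"
  using assms Lp_convD(2) unfolding approximates_def by blast+

lemma borel_measurable_AE_lebesgue_on:
  fixes f g :: "'a::euclidean_space \<Rightarrow> 'b::euclidean_space"
  assumes S: "S \<in> sets lebesgue" and f: "f \<in> borel_measurable (lebesgue_on S)"
    and fg: "AE x in lebesgue_on S. f x = g x"
  shows "g \<in> borel_measurable (lebesgue_on S)"
proof -
  have iff: "h \<in> borel_measurable (lebesgue_on S) \<longleftrightarrow> (\<lambda>x. indicator S x *\<^sub>R h x) \<in> borel_measurable lebesgue"
    for h :: "'a \<Rightarrow> 'b"
    using S by (intro borel_measurable_restrict_space_iff) auto
  have "AE x in lebesgue. indicator S x *\<^sub>R f x = indicator S x *\<^sub>R g x"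
    using fg S by (simp add: AE_restrict_space_iff) (auto elim!: eventually_mono simp: indicator_def)
  from borel_measurable_AE[OF f[unfolded iff] this] show ?thesis
    unfolding iff .
qed

text \<open>
  Lebesgue measure is complete, so either both functions are measurable or neither is, and in the latter
  case both integrals are 0.
\<close>

lemma integral_lebesgue_on_cong_AE:
  fixes f g :: "'a::euclidean_space \<Rightarrow> real"
  assumes S: "S \<in> sets lebesgue" and fg: "AE x in lebesgue_on S. f x = g x"
  shows "(\<integral>x. f x \<partial>lebesgue_on S) = (\<integral>x. g x \<partial>lebesgue_on S)"
proof (cases "f \<in> borel_measurable (lebesgue_on S)")
  case True
  then show ?thesis
    by (intro integral_cong_AE fg borel_measurable_AE_lebesgue_on[OF S True fg])
next
  case False
  have "AE x in lebesgue_on S. g x = f x" using fg by eventually_elim simp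
  with False have "g \<notin> borel_measurable (lebesgue_on S)"
    using borel_measurable_AE_lebesgue_on[OF S] by blast
  with False have "\<not> integrable (lebesgue_on S) f" "\<not> integrable (lebesgue_on S) g"
    using borel_measurable_integrable by blast+
  then show ?thesis by (simp add: not_integrable_integral_eq)
qed

locale anisotropic_domain =
  fixes \<Omega> :: "(real^'n) set" and p :: "real^'n"
  assumes open_domain: "open \<Omega>" and bounded_set: "bounded \<Omega>" and p_gt_1: "\<And>i. 1 < p $ i"
begin

abbreviation M :: "(real^'n) measure" where "M \<equiv> lebesgue_on \<Omega>"

sublocale finite_measure M
  using open_domain bounded_set by (intro finite_measure_lebesgue_on lmeasurable_open)

lemma domain_measurable: "\<Omega> \<in> sets lebesgue"
  using open_domain by simp

lemma p_pos: "0 < p $ i" "0 \<le> p $ i" "1 \<le> p $ i"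
  using p_gt_1[of i] by auto

lemma test_functions_integrable:
  assumes \<phi>: "\<phi> \<in> test_functions \<Omega>"
  shows "integrable M \<phi>" "0 \<le> q \<Longrightarrow> integrable M (\<lambda>x. \<bar>\<phi> x\<bar> powr q)"
proof -
  obtain B where B: "\<And>x. \<bar>\<phi> x\<bar> \<le> B" using test_functions_bounded[OF \<phi>] by auto
  note \<phi>m [measurable] = test_functions_measurable[OF \<phi>]
  show "integrable M \<phi>"
    by (rule integrable_const_bound[of _ B]) (use B \<phi>m in auto)
  show "integrable M (\<lambda>x. \<bar>\<phi> x\<bar> powr q)" if "0 \<le> q"
    by (rule integrable_const_bound[of _ "B powr q"]) (use B that in \<open>auto intro!: powr_mono2\<close>)
qed

lemma has_weak_grad_test:
  assumes \<phi>: "\<phi> \<in> test_functions \<Omega>"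
  shows "has_weak_grad \<Omega> \<phi> (\<lambda>x. \<chi> i. partial i \<phi> x)"
proof -
  note s = test_functionsD(1)[OF \<phi>]
  have "(\<integral>x. \<phi> x * partial i \<psi> x \<partial>M) = - (\<integral>x. partial i \<phi> x * \<psi> x \<partial>M)" if "\<psi> \<in> test_functions \<Omega>" for i \<psi>
    by (intro integration_by_parts_test smooth_continuous smooth_partial smooth_directional s domain_measurable that)
  then show ?thesis
    unfolding has_weak_grad_def
    by (auto intro!: continuous_imp_locally_integrable smooth_continuous smooth_partial s)
qed

lemma weak_gradD:
  assumes u: "u \<in> W1p \<Omega> p"
  shows "has_weak_grad \<Omega> u (weak_grad \<Omega> u)" "integrable M u"
    "(\<lambda>x. weak_grad \<Omega> u x $ i) \<in> borel_measurable M"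
    "integrable M (\<lambda>x. \<bar>weak_grad \<Omega> u x $ i\<bar> powr (p $ i))"
proof -
  show "has_weak_grad \<Omega> u (weak_grad \<Omega> u)"
    using u by (auto simp: W1p_def W11_def intro: has_weak_grad_weak_grad)
  have "u \<in> borel_measurable M" "integrable M (\<lambda>x. \<bar>u x\<bar> powr 1)"
    using u by (auto simp: W1p_def W11_def Lp_def)
  then show "integrable M u" by (auto simp: integrable_abs_iff)
  show "(\<lambda>x. weak_grad \<Omega> u x $ i) \<in> borel_measurable M"
    "integrable M (\<lambda>x. \<bar>weak_grad \<Omega> u x $ i\<bar> powr (p $ i))"
    using u by (auto simp: W1p_def Lp_def)
qed

text \<open>
  The definition of \<open>W\<^sub>0\<close> provides norm approximations for every tolerance; a
  subsequence converges almost everywhere.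
\<close>

lemma W1p_0_approximates:
  assumes u: "u \<in> W1p_0 \<Omega> p"
  obtains \<phi> where "approximates \<Omega> p \<phi> u (weak_grad \<Omega> u)"
proof -
  have W: "u \<in> W1p \<Omega> p" using u by (simp add: W1p_0_def)
  note w = weak_gradD[OF W]
  have u1: "u \<in> borel_measurable M" using w(2) by (rule borel_measurable_integrable)
  have "\<exists>\<phi>\<in>test_functions \<Omega>. W1p_norm \<Omega> p (\<lambda>x. u x - \<phi> x) < 1 / real (Suc n)" for n
    using u by (auto simp: W1p_0_def)
  then obtain \<phi> where \<phi>: "\<And>n. \<phi> n \<in> test_functions \<Omega>"
    and small: "\<And>n. W1p_norm \<Omega> p (\<lambda>x. u x - \<phi> n x) < 1 / real (Suc n)"
    by metis
  have grad: "AE x in M. weak_grad \<Omega> (\<lambda>x. u x - \<phi> n x) x = weak_grad \<Omega> u x - (\<chi> i. partial i (\<phi> n) x)" for n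
    by (intro weak_grad_eq_AE has_weak_grad_diff open_domain w has_weak_grad_test \<phi>)
  have nonneg: "0 \<le> Lp_norm \<Omega> q f" for q f by (simp add: Lp_norm_def)
  have lim: "(\<lambda>n. 1 / real (Suc n)) \<longlonglongrightarrow> 0" by (rule LIMSEQ_Suc) (rule lim_const_over_n)
  have m\<phi>: "\<phi> n \<in> borel_measurable M" "partial i (\<phi> n) \<in> borel_measurable M" for n i
    using test_functions_measurable[OF \<phi>] test_functions_measurable[OF test_functions_partial[OF \<phi>]] .
  note int\<phi> = test_functions_integrable(2)
  have conv0: "Lp_conv M 1 \<phi> u"
    unfolding Lp_conv_def
  proof (intro conjI allI m\<phi> u1)
    show int: "integrable M (\<lambda>x. \<bar>\<phi> n x - u x\<bar> powr 1)" for n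
      using w(2) int\<phi>[OF \<phi>[of n], of 1] m\<phi> by (auto simp: integrable_abs_iff)
    have "(\<integral>x. \<bar>\<phi> n x - u x\<bar> powr 1 \<partial>M) \<le> 1 / real (Suc n)" for n
    proof -
      have "(\<integral>x. \<bar>\<phi> n x - u x\<bar> powr 1 \<partial>M) = Lp_norm \<Omega> 1 (\<lambda>x. u x - \<phi> n x)"
        by (simp add: Lp_norm_def abs_minus_commute)
      also have "\<dots> \<le> W1p_norm \<Omega> p (\<lambda>x. u x - \<phi> n x)"
        unfolding W1p_norm_def using nonneg by (simp add: sum_nonneg)
      finally show ?thesis using small[of n] by linarith
    qed
    then show "(\<lambda>n. \<integral>x. \<bar>\<phi> n x - u x\<bar> powr 1 \<partial>M) \<longlonglongrightarrow> 0"
      by (intro tendsto_sandwich[OF _ _ tendsto_const lim]) auto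
  qed
  have conv: "Lp_conv M (p $ i) (\<lambda>n. partial i (\<phi> n)) (\<lambda>x. weak_grad \<Omega> u x $ i)" for i
    unfolding Lp_conv_def
  proof (intro conjI allI m\<phi> w)
    show int: "integrable M (\<lambda>x. \<bar>partial i (\<phi> n) x - weak_grad \<Omega> u x $ i\<bar> powr (p $ i))" for n
      by (intro integrable_powr_add p_pos m\<phi> w int\<phi> test_functions_partial \<phi>)
    have bound: "(\<integral>x. \<bar>partial i (\<phi> n) x - weak_grad \<Omega> u x $ i\<bar> powr (p $ i) \<partial>M) \<le> (1 / real (Suc n)) powr (p $ i)" for n
    proof -
      have I: "(\<integral>x. \<bar>weak_grad \<Omega> (\<lambda>x. u x - \<phi> n x) x $ i\<bar> powr (p $ i) \<partial>M) =
          (\<integral>x. \<bar>partial i (\<phi> n) x - weak_grad \<Omega> u x $ i\<bar> powr (p $ i) \<partial>M)" (is "_ = ?I")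
        by (rule integral_lebesgue_on_cong_AE[OF domain_measurable])
          (use grad[of n] in \<open>eventually_elim, simp add: abs_minus_commute\<close>)
      have "?I powr (1 / p $ i) = Lp_norm \<Omega> (p $ i) (\<lambda>x. weak_grad \<Omega> (\<lambda>x. u x - \<phi> n x) x $ i)"
        by (simp add: Lp_norm_def I)
      also have "\<dots> \<le> (\<Sum>i\<in>UNIV. Lp_norm \<Omega> (p $ i) (\<lambda>x. weak_grad \<Omega> (\<lambda>x. u x - \<phi> n x) x $ i))"
        by (rule member_le_sum) (auto simp: nonneg)
      also have "\<dots> \<le> W1p_norm \<Omega> p (\<lambda>x. u x - \<phi> n x)"
        unfolding W1p_norm_def using nonneg by simp
      also have "\<dots> \<le> 1 / real (Suc n)" using small[of n] by linarith
      finally have "(?I powr (1 / p $ i)) powr (p $ i) \<le> (1 / real (Suc n)) powr (p $ i)"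
        by (intro powr_mono2) (use p_pos in auto)
      moreover have "(?I powr (1 / p $ i)) powr (p $ i) = ?I"
        using p_pos(1)[of i] by (simp add: powr_powr)
      ultimately show ?thesis by simp
    qed
    have lim': "(\<lambda>n. (1 / real (Suc n)) powr (p $ i)) \<longlonglongrightarrow> 0"
      using p_pos(1)[of i] by (intro tendsto_zero_powrI[OF lim tendsto_const]) auto
    show "(\<lambda>n. \<integral>x. \<bar>partial i (\<phi> n) x - weak_grad \<Omega> u x $ i\<bar> powr (p $ i) \<partial>M) \<longlonglongrightarrow> 0"
      by (rule tendsto_sandwich[OF _ _ tendsto_const lim']) (use bound in \<open>auto intro!: always_eventually\<close>)
  qed
  obtain r :: "nat \<Rightarrow> nat" where r: "strict_mono r" "AE x in M. (\<lambda>n. \<phi> (r n) x) \<longlonglongrightarrow> u x"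
    by (rule Lp_conv_1_AE_subseq[OF conv0])
  have "approximates \<Omega> p (\<lambda>n. \<phi> (r n)) u (weak_grad \<Omega> u)"
    unfolding approximates_def
    by (intro conjI allI \<phi> r(2) w Lp_conv_subseq[OF conv0 r(1)] Lp_conv_subseq[OF conv r(1)])
  then show ?thesis by (rule that)
qed

end

section \<open>The chain rule for functions of two Sobolev functions\<close>

lemma measurable_compose_pair:
  fixes K :: "real \<Rightarrow> real \<Rightarrow> real"
  assumes "continuous_on UNIV (\<lambda>z. K (fst z) (snd z))" "f \<in> borel_measurable N" "g \<in> borel_measurable N"
  shows "(\<lambda>x. K (f x) (g x)) \<in> borel_measurable N"
  using borel_measurable_continuous_on[OF assms(1) borel_measurable_Pair[OF assms(2,3)]] by simp

lemma tendsto_compose_pair: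
  fixes K :: "real \<Rightarrow> real \<Rightarrow> real"
  assumes "continuous_on UNIV (\<lambda>z. K (fst z) (snd z))" "(f \<longlongrightarrow> a) F" "(g \<longlongrightarrow> b) F"
  shows "((\<lambda>x. K (f x) (g x)) \<longlongrightarrow> K a b) F"
proof -
  have "isCont (\<lambda>z. K (fst z) (snd z)) (a, b)"
    using assms(1) by (simp add: continuous_on_eq_continuous_at)
  from isCont_tendsto_compose[OF this tendsto_Pair[OF assms(2,3)]] show ?thesis by simp
qed

context anisotropic_domain
begin

text \<open>
  A \<open>C\<^sup>1\<close> function of two approximated functions is approximated by the same function
  of the approximations.  Two variables are needed because the test functions of the comparison argument
  depend on both solutions.
\<close>

context
  fixes \<phi> \<psi> :: "nat \<Rightarrow> real^'n \<Rightarrow> real" and v w :: "real^'n \<Rightarrow> real" and V W :: "real^'n \<Rightarrow> real^'n"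
    and K K1 K2 :: "real \<Rightarrow> real \<Rightarrow> real"
  assumes v: "approximates \<Omega> p \<phi> v V" and w: "approximates \<Omega> p \<psi> w W" and K: "C1_bounded K K1 K2"
begin

lemma compose_measurable:
  "(\<lambda>x. K (v x) (w x)) \<in> borel_measurable M" "(\<lambda>x. K1 (v x) (w x)) \<in> borel_measurable M"
  "(\<lambda>x. K2 (v x) (w x)) \<in> borel_measurable M" "(\<lambda>x. K (\<phi> n x) (\<psi> n x)) \<in> borel_measurable M"
  "(\<lambda>x. K1 (\<phi> n x) (\<psi> n x)) \<in> borel_measurable M" "(\<lambda>x. K2 (\<phi> n x) (\<psi> n x)) \<in> borel_measurable M"
  using C1_boundedD(2-4)[OF K] approximatesD(7)[OF v] approximatesD(7)[OF w]
    test_functions_measurable[OF approximatesD(1)[OF v]] test_functions_measurable[OF approximatesD(1)[OF w]]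
  by (auto intro: measurable_compose_pair)

lemma compose_AE:
  fixes H :: "real \<Rightarrow> real \<Rightarrow> real"
  assumes "continuous_on UNIV (\<lambda>z. H (fst z) (snd z))"
  shows "AE x in M. (\<lambda>n. H (\<phi> n x) (\<psi> n x)) \<longlonglongrightarrow> H (v x) (w x)"
  using approximatesD(2)[OF v] approximatesD(2)[OF w]
  by eventually_elim (rule tendsto_compose_pair[OF assms])

lemma compose_integrable: "integrable M (\<lambda>x. K (v x) (w x))"
proof -
  obtain B where B: "0 \<le> B" "\<And>r s r' s'. \<bar>K r s - K r' s'\<bar> \<le> B * (\<bar>r - r'\<bar> + \<bar>s - s'\<bar>)"
    using C1_bounded_obtain[OF K] by metis
  show ?thesis
  proof (rule Bochner_Integration.integrable_bound)
    show "integrable M (\<lambda>x. \<bar>K 0 0\<bar> + B * (\<bar>v x\<bar> + \<bar>w x\<bar>))"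
      using approximatesD(3)[OF v] approximatesD(3)[OF w] by simp
    show "AE x in M. norm (K (v x) (w x)) \<le> norm (\<bar>K 0 0\<bar> + B * (\<bar>v x\<bar> + \<bar>w x\<bar>))"
    proof (rule AE_I2)
      fix x
      show "norm (K (v x) (w x)) \<le> norm (\<bar>K 0 0\<bar> + B * (\<bar>v x\<bar> + \<bar>w x\<bar>))"
        using B(2)[of "v x" "w x" 0 0] by simp
    qed
  qed (rule compose_measurable)
qed

lemma compose_conv: "Lp_conv M 1 (\<lambda>n x. K (\<phi> n x) (\<psi> n x)) (\<lambda>x. K (v x) (w x))"
proof -
  obtain B where B: "0 \<le> B" "\<And>r s r' s'. \<bar>K r s - K r' s'\<bar> \<le> B * (\<bar>r - r'\<bar> + \<bar>s - s'\<bar>)"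
    using C1_bounded_obtain[OF K] by metis
  note c1 = Lp_convD(3,4)[OF approximatesD(4)[OF v]] and c2 = Lp_convD(3,4)[OF approximatesD(4)[OF w]]
  let ?D = "\<lambda>n x. B * (\<bar>\<phi> n x - v x\<bar> powr 1 + \<bar>\<psi> n x - w x\<bar> powr 1)"
  show ?thesis
  proof (rule Lp_conv_dominated)
    show "integrable M (?D n)" for n using c1 c2 by simp
    show "(\<lambda>n. \<integral>x. ?D n x \<partial>M) \<longlonglongrightarrow> 0"
      using tendsto_mult[OF tendsto_const[of B] tendsto_add[OF c1(2) c2(2)]] c1(1) c2(1) by simp
    show "AE x in M. \<bar>K (\<phi> n x) (\<psi> n x) - K (v x) (w x)\<bar> powr 1 \<le> ?D n x" for n
      using B(2) by simp
  qed (rule compose_measurable)+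
qed

lemma compose_grad_integrable:
  "integrable M (\<lambda>x. \<bar>K1 (v x) (w x) * V x $ i + K2 (v x) (w x) * W x $ i\<bar> powr (p $ i))"
proof -
  obtain B where B: "0 \<le> B" "\<And>r s. \<bar>K1 r s\<bar> \<le> B" "\<And>r s. \<bar>K2 r s\<bar> \<le> B"
    using C1_bounded_obtain[OF K] by metis
  have m: "\<bar>c x\<bar> powr (p $ i) \<le> B powr (p $ i)" if "\<And>x. \<bar>c x\<bar> \<le> B" for c :: "real^'n \<Rightarrow> real" and x
    using p_pos(2) that by (intro powr_mono2) auto
  have bounded_mult: "integrable M (\<lambda>x. \<bar>c x * U x $ i\<bar> powr (p $ i))"
    if "c \<in> borel_measurable M" "\<And>x. \<bar>c x\<bar> \<le> B" "integrable M (\<lambda>x. \<bar>U x $ i\<bar> powr (p $ i))" for c and U :: "real^'n \<Rightarrow> real^'n"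
    using integrable_mult_bounded(2)[OF that(3), of "\<lambda>x. \<bar>c x\<bar> powr (p $ i)" "B powr (p $ i)"] that m[of c]
    by (simp add: abs_mult powr_mult)
  show ?thesis
    by (intro integrable_powr_add p_pos borel_measurable_times compose_measurable B bounded_mult
        approximatesD(5,8)[OF v] approximatesD(5,8)[OF w])
qed

lemma compose_grad_conv:
  "Lp_conv M (p $ i) (\<lambda>n x. K1 (\<phi> n x) (\<psi> n x) * partial i (\<phi> n) x + K2 (\<phi> n x) (\<psi> n x) * partial i (\<psi> n) x)
     (\<lambda>x. K1 (v x) (w x) * V x $ i + K2 (v x) (w x) * W x $ i)"
proof -
  obtain B where B: "0 \<le> B" "\<And>r s. \<bar>K1 r s\<bar> \<le> B" "\<And>r s. \<bar>K2 r s\<bar> \<le> B"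
    using C1_bounded_obtain[OF K] by metis
  show ?thesis
    by (intro Lp_conv_add Lp_conv_mult_bounded[where B=B] p_pos approximatesD(5,6)[OF v] approximatesD(5,6)[OF w]
        compose_measurable B compose_AE C1_boundedD(2,3)[OF K])
qed

lemma compose_directional:
  "((\<lambda>t. K (\<phi> n (x + t *\<^sub>R axis i 1)) (\<psi> n (x + t *\<^sub>R axis i 1))) has_real_derivative
    K1 (\<phi> n x) (\<psi> n x) * partial i (\<phi> n) x + K2 (\<phi> n x) (\<psi> n x) * partial i (\<psi> n) x) (at 0)"
proof -
  have 1: "((\<lambda>t. \<phi> n (x + t *\<^sub>R axis i 1)) has_derivative (\<lambda>h. h * partial i (\<phi> n) x)) (at 0)"
    "((\<lambda>t. \<psi> n (x + t *\<^sub>R axis i 1)) has_derivative (\<lambda>h. h * partial i (\<psi> n) x)) (at 0)"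
    using smooth_directional[OF test_functionsD(1)[OF approximatesD(1)[OF v]]]
      smooth_directional[OF test_functionsD(1)[OF approximatesD(1)[OF w]]]
    by (simp_all add: has_field_derivative_def mult.commute[of _ "partial _ _ _"])
  have "((\<lambda>z. K (fst z) (snd z)) has_derivative (\<lambda>h. K1 (\<phi> n x) (\<psi> n x) * fst h + K2 (\<phi> n x) (\<psi> n x) * snd h))
    (at (\<phi> n (x + 0 *\<^sub>R axis i 1), \<psi> n (x + 0 *\<^sub>R axis i 1)))"
    using C1_boundedD(1)[OF K] by simp
  from has_derivative_compose[OF has_derivative_Pair[OF 1] this]
  have "((\<lambda>t. K (\<phi> n (x + t *\<^sub>R axis i 1)) (\<psi> n (x + t *\<^sub>R axis i 1))) has_derivative
    (\<lambda>h. K1 (\<phi> n x) (\<psi> n x) * (h * partial i (\<phi> n) x) + K2 (\<phi> n x) (\<psi> n x) * (h * partial i (\<psi> n) x))) (at 0)"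
    by simp
  then show ?thesis
    unfolding has_field_derivative_def
    by (rule has_derivative_eq_rhs) (simp add: fun_eq_iff algebra_simps)
qed

lemma compose_continuous:
  "continuous_on UNIV (\<lambda>x. K (\<phi> n x) (\<psi> n x))"
  "continuous_on UNIV (\<lambda>x. K1 (\<phi> n x) (\<psi> n x) * partial i (\<phi> n) x + K2 (\<phi> n x) (\<psi> n x) * partial i (\<psi> n) x)"
proof -
  note s = test_functionsD(1)[OF approximatesD(1)[OF v, of n]] test_functionsD(1)[OF approximatesD(1)[OF w, of n]]
  have c: "continuous_on UNIV (\<lambda>x. H (\<phi> n x) (\<psi> n x))"
    if "continuous_on UNIV (\<lambda>z. H (fst z) (snd z))" for H :: "real \<Rightarrow> real \<Rightarrow> real"
    using continuous_on_compose2[OF that continuous_on_Pair[OF smooth_continuous[OF s(1)] smooth_continuous[OF s(2)]]]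
    by simp
  show "continuous_on UNIV (\<lambda>x. K (\<phi> n x) (\<psi> n x))"
    by (rule c[OF C1_boundedD(4)[OF K]])
  show "continuous_on UNIV (\<lambda>x. K1 (\<phi> n x) (\<psi> n x) * partial i (\<phi> n) x + K2 (\<phi> n x) (\<psi> n x) * partial i (\<psi> n) x)"
    by (intro continuous_on_add continuous_on_mult c C1_boundedD(2,3)[OF K] smooth_continuous smooth_partial s)
qed

text \<open>
  Integration by parts holds for the compositions with test functions, which are
  \<open>C\<^sup>1\<close>, and both sides converge.
\<close>

lemma chain_rule:
  "has_weak_grad \<Omega> (\<lambda>x. K (v x) (w x)) (\<lambda>x. K1 (v x) (w x) *\<^sub>R V x + K2 (v x) (w x) *\<^sub>R W x)"
  unfolding has_weak_grad_def
proof (intro conjI allI ballI)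
  let ?f = "\<lambda>n x. K (\<phi> n x) (\<psi> n x)" and ?F = "\<lambda>x. K (v x) (w x)"
  let ?g = "\<lambda>i n x. K1 (\<phi> n x) (\<psi> n x) * partial i (\<phi> n) x + K2 (\<phi> n x) (\<psi> n x) * partial i (\<psi> n) x"
  let ?G = "\<lambda>i x. K1 (v x) (w x) * V x $ i + K2 (v x) (w x) * W x $ i"
  have G: "integrable M (?G i)" for i
    by (rule integrable_of_powr[OF p_pos(3) _ compose_grad_integrable]) (rule Lp_convD(2)[OF compose_grad_conv])
  show "locally_integrable \<Omega> ?F"
    by (rule integrable_imp_locally_integrable[OF domain_measurable compose_integrable])
  show "locally_integrable \<Omega> (\<lambda>x. (K1 (v x) (w x) *\<^sub>R V x + K2 (v x) (w x) *\<^sub>R W x) $ i)" for i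
    using integrable_imp_locally_integrable[OF domain_measurable G] by simp
  fix i \<eta> assume \<eta>: "\<eta> \<in> test_functions \<Omega>"
  note d\<eta> = test_functions_partial[OF \<eta>, of i]
  obtain B where B: "\<And>x. \<bar>\<eta> x\<bar> \<le> B" using test_functions_bounded[OF \<eta>] by blast
  obtain B' where B': "\<And>x. \<bar>partial i \<eta> x\<bar> \<le> B'" using test_functions_bounded[OF d\<eta>] by blast
  note conv_g = Lp_conv_imp_L1[OF p_pos(3) compose_grad_conv, of i]
  note m = test_functions_measurable[OF \<eta>] test_functions_measurable[OF d\<eta>]
  have l1: "(\<lambda>n. \<integral>x. ?f n x * partial i \<eta> x \<partial>M) \<longlonglongrightarrow> (\<integral>x. ?F x * partial i \<eta> x \<partial>M)"
    by (rule Lp_conv_1_integral[OF compose_conv compose_integrable m(2) B'])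
  have l2: "(\<lambda>n. \<integral>x. ?g i n x * \<eta> x \<partial>M) \<longlonglongrightarrow> (\<integral>x. ?G i x * \<eta> x \<partial>M)"
    by (rule Lp_conv_1_integral[OF conv_g G m(1) B])
  have eq: "(\<integral>x. ?f n x * partial i \<eta> x \<partial>M) = - (\<integral>x. ?g i n x * \<eta> x \<partial>M)" for n
    by (rule integration_by_parts_test[OF compose_continuous compose_directional domain_measurable \<eta>])
  have "(\<integral>x. ?F x * partial i \<eta> x \<partial>M) = - (\<integral>x. ?G i x * \<eta> x \<partial>M)"
    using LIMSEQ_unique[OF l1] tendsto_minus[OF l2] unfolding eq by blast
  then show "(\<integral>x. ?F x * partial i \<eta> x \<partial>M) =
      - (\<integral>x. (K1 (v x) (w x) *\<^sub>R V x + K2 (v x) (w x) *\<^sub>R W x) $ i * \<eta> x \<partial>M)"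
    by simp
qed

text \<open>
  Functions of \<open>W\<^sub>0\<close> vanish at the boundary in the weak sense that their derivatives
  integrate to 0. The condition \<open>K(0, 0) = 0\<close> makes the approximating compositions
  compactly supported.
\<close>

lemma integral_chain_rule_eq_0:
  assumes "K 0 0 = 0"
  shows "integrable M (\<lambda>x. K1 (v x) (w x) * V x $ i + K2 (v x) (w x) * W x $ i)"
    and "(\<integral>x. K1 (v x) (w x) * V x $ i + K2 (v x) (w x) * W x $ i \<partial>M) = 0"
proof -
  let ?g = "\<lambda>n x. K1 (\<phi> n x) (\<psi> n x) * partial i (\<phi> n) x + K2 (\<phi> n x) (\<psi> n x) * partial i (\<psi> n) x"
  let ?G = "\<lambda>x. K1 (v x) (w x) * V x $ i + K2 (v x) (w x) * W x $ i"
  show G: "integrable M ?G"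
    by (rule integrable_of_powr[OF p_pos(3) _ compose_grad_integrable]) (rule Lp_convD(2)[OF compose_grad_conv])
  have "(\<integral>x. ?g n x \<partial>M) = 0" for n
  proof (rule integral_derivative_compact_support[where f="\<lambda>x. K (\<phi> n x) (\<psi> n x)" and
        K="closure {x. \<phi> n x \<noteq> 0} \<union> closure {x. \<psi> n x \<noteq> 0}" and i=i])
    show "K (\<phi> n x) (\<psi> n x) = 0" if "x \<notin> closure {x. \<phi> n x \<noteq> 0} \<union> closure {x. \<psi> n x \<noteq> 0}" for x
    proof -
      have "\<phi> n x = 0" "\<psi> n x = 0"
        using that closure_subset[of "{x. \<phi> n x \<noteq> 0}"] closure_subset[of "{x. \<psi> n x \<noteq> 0}"] by auto
      then show ?thesis using assms by simp
    qed
  qed (use test_functionsD[OF approximatesD(1)[OF v, of n]] test_functionsD[OF approximatesD(1)[OF w, of n]]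
      domain_measurable compose_directional in \<open>auto intro: compose_continuous\<close>)
  then show "(\<integral>x. ?G x \<partial>M) = 0"
    using Lp_conv_1_integral[OF Lp_conv_imp_L1[OF p_pos(3) compose_grad_conv, of i] G borel_measurable_const, of 1 1]
    by (simp add: LIMSEQ_const_iff)
qed

text \<open>
  Membership in \<open>W\<^sub>0\<close> requires approximation by smooth functions, so here, unlike in
  \<open>chain_rule\<close>, \<open>K\<close> has to preserve smoothness.
\<close>

lemma compose_approximates:
  assumes smooth: "\<And>f g :: real^'n \<Rightarrow> real. smooth f \<Longrightarrow> smooth g \<Longrightarrow> smooth (\<lambda>x. K (f x) (g x))" and "K 0 0 = 0"
  shows "approximates \<Omega> p (\<lambda>n x. K (\<phi> n x) (\<psi> n x)) (\<lambda>x. K (v x) (w x))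
    (\<lambda>x. K1 (v x) (w x) *\<^sub>R V x + K2 (v x) (w x) *\<^sub>R W x)"
proof -
  have s: "smooth (\<lambda>x. K (\<phi> n x) (\<psi> n x))" for n
    by (intro smooth test_functionsD(1)[OF approximatesD(1)[OF v]] test_functionsD(1)[OF approximatesD(1)[OF w]])
  have "partial i (\<lambda>x. K (\<phi> n x) (\<psi> n x)) x =
    K1 (\<phi> n x) (\<psi> n x) * partial i (\<phi> n) x + K2 (\<phi> n x) (\<psi> n x) * partial i (\<psi> n) x" for n i x
    by (rule DERIV_unique[OF smooth_directional[OF s] compose_directional])
  then have "partial i (\<lambda>x. K (\<phi> n x) (\<psi> n x)) =
    (\<lambda>x. K1 (\<phi> n x) (\<psi> n x) * partial i (\<phi> n) x + K2 (\<phi> n x) (\<psi> n x) * partial i (\<psi> n) x)" for n i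
    by (rule ext)
  then show ?thesis
    unfolding approximates_def
    using test_functions_compose2[OF approximatesD(1)[OF v] approximatesD(1)[OF w] s assms(2)]
      compose_AE[OF C1_boundedD(4)[OF K]] compose_integrable compose_conv compose_grad_integrable compose_grad_conv
    by simp
qed

end

lemma C1_bounded_fst: "C1_bounded (\<lambda>r s. r) (\<lambda>_ _. 1) (\<lambda>_ _. 0)"
  unfolding C1_bounded_def by (auto intro!: derivative_eq_intros exI[of _ 1])

lemma approximates_has_weak_grad:
  assumes "approximates \<Omega> p \<phi> v V" shows "has_weak_grad \<Omega> v V"
  using chain_rule[OF assms assms C1_bounded_fst] by simp

lemma approximates_weak_grad:
  assumes "approximates \<Omega> p \<phi> v V" shows "AE x in M. weak_grad \<Omega> v x = V x"
  by (rule weak_grad_eq_AE[OF open_domain approximates_has_weak_grad[OF assms]])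

text \<open>
  The converse of \<open>W1p_0_approximates\<close>: a limit of test functions in the mean, with the
  limit of their gradients, is an element of \<open>W\<^sub>0\<close>.
\<close>

lemma approximates_W1p_0:
  assumes v: "approximates \<Omega> p \<phi> v V"
  shows "v \<in> W1p_0 \<Omega> p"
proof -
  note a = approximatesD[OF v]
  note ae = approximates_weak_grad[OF v]
  have m: "(\<lambda>x. weak_grad \<Omega> v x $ i) \<in> borel_measurable M" for i
    by (rule borel_measurable_AE_lebesgue_on[OF domain_measurable a(8)]) (use ae in \<open>eventually_elim, simp\<close>)
  have mem: "(\<lambda>x. weak_grad \<Omega> v x $ i) \<in> Lp \<Omega> (p $ i)" for i
  proof -
    have "integrable M (\<lambda>x. \<bar>weak_grad \<Omega> v x $ i\<bar> powr (p $ i))"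
    proof (rule integrable_cong_AE_imp[OF a(5)[of i]])
      show "(\<lambda>x. \<bar>weak_grad \<Omega> v x $ i\<bar> powr (p $ i)) \<in> borel_measurable M" using m[of i] by measurable
      show "AE x in M. \<bar>V x $ i\<bar> powr (p $ i) = \<bar>weak_grad \<Omega> v x $ i\<bar> powr (p $ i)"
        using ae by eventually_elim simp
    qed
    then show ?thesis using m by (simp add: Lp_def)
  qed
  have VL1: "(\<lambda>x. V x $ i) \<in> Lp \<Omega> 1" for i
    using integrable_of_powr[OF p_pos(3) a(8) a(5)] a(8) by (simp add: Lp_def)
  have "v \<in> W11 \<Omega>"
    using a(3,7) VL1 approximates_has_weak_grad[OF v] by (auto simp: W11_def Lp_def)
  then have W: "v \<in> W1p \<Omega> p" using mem by (simp add: W1p_def)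
  have norm: "W1p_norm \<Omega> p (\<lambda>x. v x - \<phi> n x) =
    (\<integral>x. \<bar>\<phi> n x - v x\<bar> powr 1 \<partial>M) + (\<Sum>i\<in>UNIV. (\<integral>x. \<bar>partial i (\<phi> n) x - V x $ i\<bar> powr (p $ i) \<partial>M) powr (1 / p $ i))" for n
  proof -
    have grad: "AE x in M. weak_grad \<Omega> (\<lambda>x. v x - \<phi> n x) x = V x - (\<chi> i. partial i (\<phi> n) x)"
      by (intro weak_grad_eq_AE has_weak_grad_diff open_domain approximates_has_weak_grad[OF v] has_weak_grad_test a)
    have "(\<integral>x. \<bar>weak_grad \<Omega> (\<lambda>x. v x - \<phi> n x) x $ i\<bar> powr (p $ i) \<partial>M) =
      (\<integral>x. \<bar>partial i (\<phi> n) x - V x $ i\<bar> powr (p $ i) \<partial>M)" for i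
      by (rule integral_lebesgue_on_cong_AE[OF domain_measurable])
        (use grad in \<open>eventually_elim, simp add: abs_minus_commute\<close>)
    then show ?thesis by (simp add: W1p_norm_def Lp_norm_def abs_minus_commute)
  qed
  have "(\<lambda>n. W1p_norm \<Omega> p (\<lambda>x. v x - \<phi> n x)) \<longlonglongrightarrow> 0 + (\<Sum>i\<in>(UNIV::'n set). 0)"
    unfolding norm
  proof (intro tendsto_add tendsto_sum)
    show "(\<lambda>n. \<integral>x. \<bar>\<phi> n x - v x\<bar> powr 1 \<partial>M) \<longlonglongrightarrow> 0" by (rule Lp_convD(4)[OF a(4)])
    show "(\<lambda>n. (\<integral>x. \<bar>partial i (\<phi> n) x - V x $ i\<bar> powr (p $ i) \<partial>M) powr (1 / p $ i)) \<longlonglongrightarrow> 0" for i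
      using p_pos(1)[of i] by (intro tendsto_zero_powrI[OF Lp_convD(4)[OF a(6)] tendsto_const]) auto
  qed
  then have lim: "(\<lambda>n. W1p_norm \<Omega> p (\<lambda>x. v x - \<phi> n x)) \<longlonglongrightarrow> 0" by simp
  have "\<exists>n. W1p_norm \<Omega> p (\<lambda>x. v x - \<phi> n x) < e" if "0 < e" for e
    using order_tendstoD(2)[OF lim that] eventually_happens'[OF sequentially_bot] by blast
  then show ?thesis
    using W a(1) by (auto simp: W1p_0_def)
qed

lemma test_functions_approximates:
  assumes "\<phi> \<in> test_functions \<Omega>"
  shows "approximates \<Omega> p (\<lambda>_. \<phi>) \<phi> (\<lambda>x. \<chi> i. partial i \<phi> x)"
  unfolding approximates_def Lp_conv_def
  using assms test_functions_integrable[OF assms] test_functions_integrable(2)[OF test_functions_partial[OF assms] p_pos(2)]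
    test_functions_measurable[OF assms] test_functions_measurable[OF test_functions_partial[OF assms]]
  by simp

end

section \<open>Truncations and the generalized gradient\<close>

text \<open>
  The condition \<open>f'(0) = 0\<close> makes the constant branch on the negative reals fit to
  \<open>f\<close> with a continuous derivative.
\<close>

lemma DERIV_positive_part:
  fixes f f' :: "real \<Rightarrow> real"
  assumes f: "\<And>t. 0 \<le> t \<Longrightarrow> (f has_real_derivative f' t) (at t)" and 0: "f' 0 = 0"
  shows "((\<lambda>t. f (max t 0)) has_real_derivative f' (max t 0)) (at t)"
proof -
  consider "t < 0" | "t = 0" | "t > 0" by linarith
  then show ?thesis
  proof cases
    case 1
    have "((\<lambda>_. f 0) has_real_derivative 0) (at t)" by simp
    then have "((\<lambda>t. f (max t 0)) has_real_derivative 0) (at t)"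
      by (rule has_field_derivative_transform_within_open[of _ _ _ "{..<0}"]) (use 1 in auto)
    then show ?thesis using 1 0 by simp
  next
    case 3
    have "((\<lambda>t. f (max t 0)) has_real_derivative f' t) (at t)"
      by (rule has_field_derivative_transform_within_open[OF f, of _ "{0<..}"]) (use 3 in auto)
    then show ?thesis using 3 by simp
  next
    case 2
    have r: "((\<lambda>h. (f (max h 0) - f 0) / h) \<longlongrightarrow> 0) (at_right 0)"
    proof -
      have "((\<lambda>h. (f h - f 0) / h) \<longlongrightarrow> 0) (at_right 0)"
        using f[of 0] 0 by (auto simp: DERIV_def intro: filterlim_mono[OF _ order_refl at_le])
      then show ?thesis
        by (rule Lim_transform_eventually) (auto simp: eventually_at_filter)
    qed
    have l: "((\<lambda>h. (f (max h 0) - f 0) / h) \<longlongrightarrow> 0) (at_left 0)"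
      by (rule Lim_transform_eventually[OF tendsto_const]) (auto simp: eventually_at_filter)
    have "((\<lambda>h. (f (max h 0) - f 0) / h) \<longlongrightarrow> 0) (at 0)"
      using l r by (simp add: filterlim_split_at)
    then show ?thesis
      using 2 0 by (simp add: DERIV_def)
  qed
qed

text \<open>
  The functions \<open>j m\<^sup>2 / (j m + 1)\<close> of the positive part \<open>m\<close> of
  \<open>t\<close> are \<open>C\<^sup>1\<close>, converge to \<open>m\<close>, and their derivatives
  \<open>1 - 1 / (j m + 1)\<^sup>2\<close> lie between 0 and 1 and converge everywhere to the indicator
  function of the positive reals.
\<close>

definition pos_approx :: "real \<Rightarrow> real \<Rightarrow> real" where
  "pos_approx j t = j * (max t 0)\<^sup>2 / (j * max t 0 + 1)"

definition pos_approx' :: "real \<Rightarrow> real \<Rightarrow> real" where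
  "pos_approx' j t = 1 - 1 / (j * max t 0 + 1)\<^sup>2"

lemma DERIV_pos_approx:
  assumes j: "0 < j" shows "(pos_approx j has_real_derivative pos_approx' j t) (at t)"
proof -
  have "((\<lambda>m. j * m\<^sup>2 / (j * m + 1)) has_real_derivative 1 - 1 / (j * m + 1)\<^sup>2) (at m)" if "0 \<le> m" for m
  proof -
    have pos: "0 < j * m + 1" using j that by (simp add: add_nonneg_pos)
    have "((\<lambda>m. j * m\<^sup>2 / (j * m + 1)) has_real_derivative
      (j * (2 * m) * (j * m + 1) - j * m\<^sup>2 * j) / ((j * m + 1) * (j * m + 1))) (at m)"
      using pos by (auto intro!: derivative_eq_intros)
    moreover have "(j * (2 * m) * (j * m + 1) - j * m\<^sup>2 * j) / ((j * m + 1) * (j * m + 1)) = 1 - 1 / (j * m + 1)\<^sup>2"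
    proof -
      have "1 - 1 / (j * m + 1)\<^sup>2 = ((j * m + 1)\<^sup>2 - 1) / (j * m + 1)\<^sup>2"
        using pos by (simp add: diff_divide_distrib)
      then show ?thesis by (simp add: power2_eq_square algebra_simps)
    qed
    ultimately show ?thesis by simp
  qed
  from DERIV_positive_part[OF this, of t] show ?thesis
    unfolding pos_approx_def[abs_def] pos_approx'_def by simp
qed

lemma pos_approx'_bounds:
  assumes "0 < j" shows "0 \<le> pos_approx' j t" "pos_approx' j t \<le> 1"
proof -
  have "1 \<le> (j * max t 0 + 1)\<^sup>2" using assms by (simp add: one_le_power)
  then show "0 \<le> pos_approx' j t" by (simp add: pos_approx'_def divide_le_eq)
  show "pos_approx' j t \<le> 1" by (simp add: pos_approx'_def)
qed

lemma isCont_pos_approx':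
  assumes "0 < j" shows "isCont (pos_approx' j) t"
proof -
  have "0 < j * max t 0 + 1" using assms by (simp add: add_nonneg_pos)
  then show ?thesis
    unfolding pos_approx'_def[abs_def] by (intro continuous_intros) auto
qed

lemma pos_approx_tendsto: "(\<lambda>n. pos_approx (real (Suc n)) t) \<longlonglongrightarrow> max t 0"
  and pos_approx'_tendsto: "(\<lambda>n. pos_approx' (real (Suc n)) t) \<longlonglongrightarrow> (if 0 < t then 1 else 0)"
proof -
  have lim: "(\<lambda>n. 1 / (real (Suc n) * t + 1)) \<longlonglongrightarrow> 0" if "0 < t"
  proof (rule tendsto_divide_0[OF tendsto_const], rule filterlim_at_top_imp_at_infinity)
    have "filterlim (\<lambda>n. t * real (Suc n)) at_top sequentially"
      by (rule filterlim_tendsto_pos_mult_at_top[OF tendsto_const that])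
        (rule filterlim_compose[OF filterlim_real_sequentially filterlim_Suc])
    then have "filterlim (\<lambda>n. 1 + t * real (Suc n)) at_top sequentially"
      by (rule filterlim_tendsto_add_at_top[OF tendsto_const])
    then show "filterlim (\<lambda>n. real (Suc n) * t + 1) at_top sequentially"
      by (simp add: add.commute mult.commute)
  qed
  show "(\<lambda>n. pos_approx (real (Suc n)) t) \<longlonglongrightarrow> max t 0"
  proof (cases "0 < t")
    case True
    have "pos_approx (real (Suc n)) t = t - t * (1 / (real (Suc n) * t + 1))" for n
    proof -
      have "0 < real (Suc n) * t + 1" using True by (simp add: add_pos_pos)
      then show ?thesis using True
        by (simp only: pos_approx_def) (simp add: field_simps power2_eq_square)
    qed
    moreover have "(\<lambda>n. t - t * (1 / (real (Suc n) * t + 1))) \<longlonglongrightarrow> t - t * 0"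
      by (intro tendsto_intros lim True)
    ultimately show ?thesis using True by simp
  qed (simp add: pos_approx_def)
  show "(\<lambda>n. pos_approx' (real (Suc n)) t) \<longlonglongrightarrow> (if 0 < t then 1 else 0)"
  proof (cases "0 < t")
    case True
    have "(\<lambda>n. 1 - (1 / (real (Suc n) * t + 1))\<^sup>2) \<longlonglongrightarrow> 1 - 0\<^sup>2"
      by (intro tendsto_intros lim True)
    then show ?thesis using True by (simp add: pos_approx'_def power_divide)
  qed (simp add: pos_approx'_def)
qed

text \<open>
  Since \<open>T\<^sub>k(r) = (r + k)\<^sup>+ - (k - r)\<^sup>+ - r\<close>, smoothing the positive
  parts gives \<open>C\<^sup>1\<close> functions whose derivatives converge at every point, including
  \<open>r = k\<close> and \<open>r = -k\<close>, to the indicator function of the open interval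
  \<open>(-k, k)\<close>.
\<close>

definition trunc_approx :: "real \<Rightarrow> real \<Rightarrow> real \<Rightarrow> real" where
  "trunc_approx j k r = pos_approx j (r + k) - pos_approx j (k - r) - r"

definition trunc_approx' :: "real \<Rightarrow> real \<Rightarrow> real \<Rightarrow> real" where
  "trunc_approx' j k r = pos_approx' j (r + k) + pos_approx' j (k - r) - 1"

lemma DERIV_trunc_approx:
  assumes "0 < j" shows "(trunc_approx j k has_real_derivative trunc_approx' j k r) (at r)"
  unfolding trunc_approx_def[abs_def] trunc_approx'_def
  by (rule DERIV_cong) (rule derivative_intros DERIV_chain2[OF DERIV_pos_approx[OF assms]] | simp)+

lemma C1_bounded_of_real:
  assumes d: "\<And>r. (g has_real_derivative g' r) (at r)" and c: "\<And>r. isCont g' r" and B: "\<And>r. \<bar>g' r\<bar> \<le> B"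
  shows "C1_bounded (\<lambda>r s. g r) (\<lambda>r s. g' r) (\<lambda>_ _. 0)"
  unfolding C1_bounded_def
proof (intro conjI allI exI[of _ B])
  fix r s :: real
  have "((\<lambda>z. g (fst z)) has_derivative (\<lambda>h. g' r * fst h)) (at (r, s))"
    using has_derivative_compose[of fst fst "(r, s)" UNIV g "(*) (g' r)"] d[of r]
    by (simp add: has_field_derivative_def has_derivative_fst)
  then show "((\<lambda>z. g (fst z)) has_derivative (\<lambda>h. g' r * fst h + 0 * snd h)) (at (r, s))" by simp
  have "continuous_on UNIV g'" using c by (simp add: continuous_at_imp_continuous_on)
  then show "continuous_on UNIV (\<lambda>z :: real \<times> real. g' (fst z))"
    by (rule continuous_on_compose2) (auto intro: continuous_intros)
  show "\<bar>0\<bar> \<le> B" using B[of 0] by linarith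
qed (use B in auto)

lemma trunc_eq: "0 \<le> k \<Longrightarrow> trunc k r = max (r + k) 0 - max (k - r) 0 - r"
  by (auto simp: trunc_def max_def min_def)

lemma trunc_approx_tendsto:
  assumes "0 < k"
  shows "(\<lambda>n. trunc_approx (real (Suc n)) k r) \<longlonglongrightarrow> trunc k r"
    and "(\<lambda>n. trunc_approx' (real (Suc n)) k r) \<longlonglongrightarrow> indicator {r. \<bar>r\<bar> < k} r"
proof -
  show "(\<lambda>n. trunc_approx (real (Suc n)) k r) \<longlonglongrightarrow> trunc k r"
    using assms unfolding trunc_approx_def by (subst trunc_eq) (simp, intro tendsto_intros pos_approx_tendsto)
  have "(\<lambda>n. trunc_approx' (real (Suc n)) k r) \<longlonglongrightarrow> (if 0 < r + k then 1 else 0) + (if 0 < k - r then 1 else 0) - 1"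
    unfolding trunc_approx'_def by (intro tendsto_intros pos_approx'_tendsto)
  also have "(if 0 < r + k then 1 else 0) + (if 0 < k - r then 1 else 0) - 1 = (indicator {r. \<bar>r\<bar> < k} r :: real)"
    using assms by (auto simp: indicator_def)
  finally show "(\<lambda>n. trunc_approx' (real (Suc n)) k r) \<longlonglongrightarrow> indicator {r. \<bar>r\<bar> < k} r" .
qed

lemma trunc_approx_bounds:
  assumes j: "0 < j"
  shows "\<bar>trunc_approx' j k r\<bar> \<le> 1" "\<bar>trunc_approx j k r\<bar> \<le> \<bar>r\<bar>"
proof -
  show b: "\<bar>trunc_approx' j k r\<bar> \<le> 1" for r
    using pos_approx'_bounds[OF j, of "r + k"] pos_approx'_bounds[OF j, of "k - r"]
    by (simp add: trunc_approx'_def abs_le_iff)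
  have "norm (trunc_approx j k r - trunc_approx j k 0) \<le> 1 * norm (r - 0)"
    by (rule field_differentiable_bound[of UNIV "trunc_approx j k" "trunc_approx' j k"])
      (use b DERIV_trunc_approx[OF j] in auto)
  then show "\<bar>trunc_approx j k r\<bar> \<le> \<bar>r\<bar>" by (simp add: trunc_approx_def)
qed

lemma borel_measurable_vec_iff:
  fixes f :: "'a \<Rightarrow> real^'n"
  shows "f \<in> borel_measurable N \<longleftrightarrow> (\<forall>i. (\<lambda>x. f x $ i) \<in> borel_measurable N)"
  by (subst borel_measurable_euclidean_space) (auto simp: Basis_vec_def inner_axis)

context anisotropic_domain
begin

lemma has_weak_grad_trunc:
  assumes w: "approximates \<Omega> p \<phi> w W" and k: "0 < k"
  shows "has_weak_grad \<Omega> (\<lambda>x. trunc k (w x)) (\<lambda>x. indicat_real {x. \<bar>w x\<bar> < k} x *\<^sub>R W x)"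
  unfolding has_weak_grad_def
proof (intro conjI allI ballI)
  note a = approximatesD[OF w]
  note [measurable] = a(7,8)
  have WL1: "integrable M (\<lambda>x. W x $ i)" for i
    by (rule integrable_of_powr[OF p_pos(3) a(8) a(5)])
  have ind: "(\<lambda>x. indicat_real {x. \<bar>w x\<bar> < k} x) = (\<lambda>x. indicator {r. \<bar>r\<bar> < k} (w x))"
    by (auto simp: indicator_def)
  have [measurable]: "(\<lambda>x. indicat_real {x. \<bar>w x\<bar> < k} x) \<in> borel_measurable M"
    unfolding ind by measurable
  have tr [measurable]: "(\<lambda>x. trunc k (w x)) \<in> borel_measurable M" unfolding trunc_def by measurable
  have "integrable M (\<lambda>x. trunc k (w x))"
    by (rule integrable_const_bound[of _ k]) (use k tr in \<open>auto simp: trunc_def\<close>)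
  then show "locally_integrable \<Omega> (\<lambda>x. trunc k (w x))"
    by (rule integrable_imp_locally_integrable[OF domain_measurable])
  have "integrable M (\<lambda>x. indicat_real {x. \<bar>w x\<bar> < k} x * W x $ i)" for i
    by (rule integrable_mult_bounded(2)[OF WL1, of _ 1]) (auto simp: indicator_def)
  then show "locally_integrable \<Omega> (\<lambda>x. (indicat_real {x. \<bar>w x\<bar> < k} x *\<^sub>R W x) $ i)" for i
    by (intro integrable_imp_locally_integrable[OF domain_measurable]) simp
  fix i \<eta> assume \<eta>: "\<eta> \<in> test_functions \<Omega>"
  note d\<eta> = test_functions_partial[OF \<eta>, of i]
  obtain B where B: "\<And>x. \<bar>\<eta> x\<bar> \<le> B" using test_functions_bounded[OF \<eta>] by blast
  obtain B' where B': "\<And>x. \<bar>partial i \<eta> x\<bar> \<le> B'" using test_functions_bounded[OF d\<eta>] by blast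
  note [measurable] = test_functions_measurable[OF \<eta>] test_functions_measurable[OF d\<eta>]
  define g where "g n = trunc_approx (real (Suc n)) k" for n
  define g' where "g' n = trunc_approx' (real (Suc n)) k" for n
  have C: "C1_bounded (\<lambda>r s. g n r) (\<lambda>r s. g' n r) (\<lambda>_ _. 0)" for n
  proof (rule C1_bounded_of_real)
    show "isCont (g' n) r" for r
      unfolding g'_def trunc_approx'_def[abs_def]
      by (intro continuous_intros isCont_o2[OF _ isCont_pos_approx'])  auto
    show "\<bar>g' n r\<bar> \<le> 1" for r unfolding g'_def by (rule trunc_approx_bounds) simp
  qed (simp add: g_def g'_def DERIV_trunc_approx)
  have gm [measurable]: "(\<lambda>x. g n (w x)) \<in> borel_measurable M" "(\<lambda>x. g' n (w x)) \<in> borel_measurable M" for n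
    using compose_measurable(1,2)[OF w w C] .
  have eq: "(\<integral>x. g n (w x) * partial i \<eta> x \<partial>M) = - (\<integral>x. g' n (w x) * W x $ i * \<eta> x \<partial>M)" for n
    using has_weak_gradD(3)[OF chain_rule[OF w w C] \<eta>, of n i] by simp
  have l1: "(\<lambda>n. \<integral>x. g n (w x) * partial i \<eta> x \<partial>M) \<longlonglongrightarrow> (\<integral>x. trunc k (w x) * partial i \<eta> x \<partial>M)"
  proof (rule integral_dominated_convergence)
    show "integrable M (\<lambda>x. \<bar>w x\<bar> * \<bar>partial i \<eta> x\<bar>)"
      by (rule integrable_mult_bounded(1)[OF integrable_abs[OF a(3)], of _ B']) (use B' in auto)
    show "AE x in M. (\<lambda>n. g n (w x) * partial i \<eta> x) \<longlonglongrightarrow> trunc k (w x) * partial i \<eta> x"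
      unfolding g_def by (intro AE_I2 tendsto_mult trunc_approx_tendsto k tendsto_const)
    show "AE x in M. norm (g n (w x) * partial i \<eta> x) \<le> \<bar>w x\<bar> * \<bar>partial i \<eta> x\<bar>" for n
      unfolding g_def by (auto simp: abs_mult intro!: mult_right_mono trunc_approx_bounds)
  qed measurable
  have l2: "(\<lambda>n. \<integral>x. g' n (w x) * W x $ i * \<eta> x \<partial>M) \<longlonglongrightarrow>
      (\<integral>x. indicator {r. \<bar>r\<bar> < k} (w x) * W x $ i * \<eta> x \<partial>M)"
  proof (rule integral_dominated_convergence)
    show "integrable M (\<lambda>x. \<bar>W x $ i\<bar> * \<bar>\<eta> x\<bar>)"
      by (rule integrable_mult_bounded(1)[OF integrable_abs[OF WL1], of _ B]) (use B in auto)
    show "AE x in M. (\<lambda>n. g' n (w x) * W x $ i * \<eta> x) \<longlonglongrightarrow> indicator {r. \<bar>r\<bar> < k} (w x) * W x $ i * \<eta> x"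
      unfolding g'_def by (intro AE_I2 tendsto_mult trunc_approx_tendsto k tendsto_const)
    show "AE x in M. norm (g' n (w x) * W x $ i * \<eta> x) \<le> \<bar>W x $ i\<bar> * \<bar>\<eta> x\<bar>" for n
    proof (rule AE_I2)
      fix x
      have "\<bar>g' n (w x)\<bar> * (\<bar>W x $ i\<bar> * \<bar>\<eta> x\<bar>) \<le> 1 * (\<bar>W x $ i\<bar> * \<bar>\<eta> x\<bar>)"
        unfolding g'_def by (intro mult_right_mono trunc_approx_bounds) auto
      then show "norm (g' n (w x) * W x $ i * \<eta> x) \<le> \<bar>W x $ i\<bar> * \<bar>\<eta> x\<bar>" by (simp add: abs_mult mult.assoc)
    qed
  qed measurable
  have "(\<integral>x. trunc k (w x) * partial i \<eta> x \<partial>M) = - (\<integral>x. indicator {r. \<bar>r\<bar> < k} (w x) * W x $ i * \<eta> x \<partial>M)"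
    using LIMSEQ_unique[OF l1] tendsto_minus[OF l2] unfolding eq by blast
  then show "(\<integral>x. trunc k (w x) * partial i \<eta> x \<partial>M) =
      - (\<integral>x. (indicat_real {x. \<bar>w x\<bar> < k} x *\<^sub>R W x) $ i * \<eta> x \<partial>M)"
    using fun_cong[OF ind] by simp
qed

lemma weak_grad_trunc_le:
  assumes u: "(\<lambda>x. trunc m (u x)) \<in> W1p_0 \<Omega> p" and km: "0 < k" "k \<le> m"
  shows "AE x in M. weak_grad \<Omega> (\<lambda>x. trunc k (u x)) x = indicat_real {x. \<bar>u x\<bar> < k} x *\<^sub>R weak_grad \<Omega> (\<lambda>x. trunc m (u x)) x"
proof -
  obtain \<phi> where \<phi>: "approximates \<Omega> p \<phi> (\<lambda>x. trunc m (u x)) (weak_grad \<Omega> (\<lambda>x. trunc m (u x)))"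
    by (rule W1p_0_approximates[OF u])
  have "trunc k (trunc m r) = trunc k r" "\<bar>trunc m r\<bar> < k \<longleftrightarrow> \<bar>r\<bar> < k" for r
    using km by (auto simp: trunc_def max_def min_def abs_if)
  with weak_grad_eq_AE[OF open_domain has_weak_grad_trunc[OF \<phi> km(1)]] show ?thesis
    by simp
qed

text \<open>
  The generalized gradient is glued together from the gradients of the truncations at integer levels: at
  a point \<open>x\<close> take the least integer level above \<open>|u x|\<close>.  Gradients of
  truncations at different levels agree where both levels exceed \<open>|u|\<close>, by the chain rule
  for truncations.
\<close>

lemma gen_gradD:
  assumes um: "u \<in> borel_measurable M" and u: "\<And>k. 0 < k \<Longrightarrow> (\<lambda>x. trunc k (u x)) \<in> W1p_0 \<Omega> p"
  shows "gen_grad \<Omega> u \<in> borel_measurable M"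
    and "0 < k \<Longrightarrow> AE x in M. weak_grad \<Omega> (\<lambda>y. trunc k (u y)) x = indicat_real {y. \<bar>u y\<bar> < k} x *\<^sub>R gen_grad \<Omega> u x"
proof -
  define D where "D k = weak_grad \<Omega> (\<lambda>x. trunc k (u x))" for k
  define G where "G x = D (real (nat \<lfloor>\<bar>u x\<bar>\<rfloor>) + 1) x" for x
  have Dm: "D k \<in> borel_measurable M" if "0 < k" for k
    using weak_gradD(3)[of "\<lambda>x. trunc k (u x)"] u[OF that]
    unfolding borel_measurable_vec_iff D_def W1p_0_def by blast
  have "(\<lambda>x. D (real (nat \<lfloor>\<bar>u x\<bar>\<rfloor>) + 1) x) \<in> borel_measurable M"
  proof (rule measurable_compose_countable[of "\<lambda>n. D (real n + 1)"])
    note [measurable] = um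
    show "(\<lambda>x. nat \<lfloor>\<bar>u x\<bar>\<rfloor>) \<in> measurable M (count_space UNIV)" by measurable
  qed (simp add: Dm)
  then have Gm: "G \<in> borel_measurable M" by (simp add: G_def[abs_def])
  have G: "AE x in M. D k x = indicat_real {y. \<bar>u y\<bar> < k} x *\<^sub>R G x" if k: "0 < k" for k
  proof -
    have le: "AE x in M. D k x = indicat_real {x. \<bar>u x\<bar> < k} x *\<^sub>R D m x" if "0 < k" "k \<le> m" for k m
      unfolding D_def by (rule weak_grad_trunc_le) (use that u in auto)
    have "AE x in M. \<forall>n. D k x = indicat_real {x. \<bar>u x\<bar> < k} x *\<^sub>R D (max k (real n + 1)) x \<and>
      D (real n + 1) x = indicat_real {x. \<bar>u x\<bar> < real n + 1} x *\<^sub>R D (max k (real n + 1)) x"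
      unfolding AE_all_countable using k by (intro allI AE_conjI le) auto
    then show ?thesis
    proof eventually_elim
      case (elim x)
      let ?n = "nat \<lfloor>\<bar>u x\<bar>\<rfloor>"
      have "\<bar>u x\<bar> < real ?n + 1" by linarith
      then have "G x = D (max k (real ?n + 1)) x"
        using elim[rule_format, of ?n] by (simp add: G_def)
      then show ?case using elim[rule_format, of ?n] by simp
    qed
  qed
  have "gen_grad \<Omega> u \<in> borel_measurable M \<and> (\<forall>k>0. AE x in M. D k x = indicat_real {y. \<bar>u y\<bar> < k} x *\<^sub>R gen_grad \<Omega> u x)"
    unfolding gen_grad_def D_def
    by (rule someI[of _ G]) (use Gm G in \<open>auto simp: D_def\<close>)
  then show "gen_grad \<Omega> u \<in> borel_measurable M"
    "0 < k \<Longrightarrow> AE x in M. weak_grad \<Omega> (\<lambda>y. trunc k (u y)) x = indicat_real {y. \<bar>u y\<bar> < k} x *\<^sub>R gen_grad \<Omega> u x"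
    by (auto simp: D_def)
qed

end

section \<open>Cutoffs and flux terms\<close>

text \<open>
  A smooth transition from 0 on the negative reals to 1 beyond 1; its denominator is positive because
  \<open>t\<close> or \<open>1 - t\<close> is.
\<close>

definition step :: "real \<Rightarrow> real" where
  "step t = flat 0 t / (flat 0 t + flat 0 (1 - t))"

definition step' :: "real \<Rightarrow> real" where
  "step' t = (flat 1 t * flat 0 (1 - t) + flat 0 t * flat 1 (1 - t)) / (flat 0 t + flat 0 (1 - t))\<^sup>2"

lemma flat_partition_pos: "0 < flat 0 t + flat 0 (1 - t)"
  using flat_0_pos[of t] flat_0_pos[of "1 - t"] flat_0_nonneg[of t] flat_0_nonneg[of "1 - t"]
  by (cases "0 < t") (auto intro: add_pos_nonneg add_nonneg_pos)

lemma DERIV_step: "(step has_real_derivative step' t) (at t)"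
proof -
  have d: "(flat 0 has_real_derivative flat 1 s) (at s)" for s
    using flat_has_derivative[of 0 s] by simp
  have 1: "((\<lambda>t. flat 0 (1 - t)) has_real_derivative - flat 1 (1 - t)) (at t)"
    by (rule DERIV_cong[OF DERIV_chain2[OF d]]) (auto intro!: derivative_eq_intros)
  let ?a = "flat 0 t" and ?b = "flat 0 (1 - t)" and ?c = "flat 1 t" and ?d = "flat 1 (1 - t)"
  have "(step has_real_derivative (?c * (?a + ?b) - ?a * (?c + - ?d)) / ((?a + ?b) * (?a + ?b))) (at t)"
    unfolding step_def[abs_def]
    by (rule DERIV_divide[OF d DERIV_add[OF d 1]]) (use flat_partition_pos[of t] in simp)
  also have "(?c * (?a + ?b) - ?a * (?c + - ?d)) / ((?a + ?b) * (?a + ?b)) = step' t"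
    by (simp add: step'_def power2_eq_square algebra_simps)
  finally show ?thesis .
qed

lemma isCont_step': "isCont step' t"
proof -
  have c: "isCont (\<lambda>t. flat j (1 - t)) t" for j
    by (rule isCont_o2[OF _ isCont_flat]) (intro continuous_intros)
  show ?thesis
    unfolding step'_def[abs_def]
    using flat_partition_pos[of t] by (intro continuous_intros isCont_flat c) auto
qed

lemma step_outside:
  "t \<le> 0 \<Longrightarrow> step t = 0" "1 \<le> t \<Longrightarrow> step t = 1"
  "t \<le> 0 \<Longrightarrow> step' t = 0" "1 \<le> t \<Longrightarrow> step' t = 0"
  using flat_partition_pos[of t] by (auto simp: step_def step'_def flat_0_nonpos)

lemma step_bounds: "0 \<le> step t" "step t \<le> 1"
  using flat_partition_pos[of t] flat_0_nonneg[of t] flat_0_nonneg[of "1 - t"]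
  by (auto simp: step_def divide_simps)

lemma step'_bounded: obtains C where "0 \<le> C" "\<And>t. \<bar>step' t\<bar> \<le> C"
proof -
  have "compact (step' ` {0..1})"
    by (intro compact_continuous_image continuous_at_imp_continuous_on) (auto simp: isCont_step')
  then obtain C where C: "\<forall>t\<in>{0..1}. \<bar>step' t\<bar> \<le> C"
    using compact_imp_bounded by (fastforce simp: bounded_iff)
  have "\<bar>step' t\<bar> \<le> \<bar>C\<bar>" for t
  proof (cases "t \<in> {0..1}")
    case True
    then show ?thesis using C by force
  next
    case False
    then have "step' t = 0" using step_outside(3,4)[of t] by force
    then show ?thesis by simp
  qed
  then show ?thesis using that[of "\<bar>C\<bar>"] by simp
qed

definition cutoff :: "real \<Rightarrow> real \<Rightarrow> real" where
  "cutoff l r = step (l + 1 - r) * step (l + 1 + r)"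

definition cutoff' :: "real \<Rightarrow> real \<Rightarrow> real" where
  "cutoff' l r = step (l + 1 - r) * step' (l + 1 + r) - step' (l + 1 - r) * step (l + 1 + r)"

lemma DERIV_cutoff: "(cutoff l has_real_derivative cutoff' l r) (at r)"
proof -
  have 1: "((\<lambda>r. step (l + 1 - r)) has_real_derivative - step' (l + 1 - r)) (at r)"
    by (rule DERIV_cong[OF DERIV_chain2[OF DERIV_step]]) (auto intro!: derivative_eq_intros)
  have 2: "((\<lambda>r. step (l + 1 + r)) has_real_derivative step' (l + 1 + r)) (at r)"
    by (rule DERIV_cong[OF DERIV_chain2[OF DERIV_step]]) (auto intro!: derivative_eq_intros)
  show ?thesis
    unfolding cutoff_def[abs_def] cutoff'_def
    by (rule DERIV_cong[OF DERIV_mult[OF 1 2]]) (simp add: algebra_simps)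
qed

lemma isCont_cutoff': "isCont (cutoff' l) r"
proof -
  have s: "isCont step t" for t using DERIV_step DERIV_isCont by blast
  have "isCont (\<lambda>r. step (l + 1 - r)) r" "isCont (\<lambda>r. step (l + 1 + r)) r"
    "isCont (\<lambda>r. step' (l + 1 - r)) r" "isCont (\<lambda>r. step' (l + 1 + r)) r"
    by (rule isCont_o2[OF _ s] isCont_o2[OF _ isCont_step']; intro continuous_intros)+
  then show ?thesis
    unfolding cutoff'_def[abs_def] by (intro continuous_intros)
qed

lemma cutoff_inside: "0 \<le> l \<Longrightarrow> \<bar>r\<bar> \<le> l \<Longrightarrow> cutoff l r = 1"
  and cutoff'_inside: "0 \<le> l \<Longrightarrow> \<bar>r\<bar> \<le> l \<Longrightarrow> cutoff' l r = 0"
  and cutoff_outside: "0 \<le> l \<Longrightarrow> l + 1 \<le> \<bar>r\<bar> \<Longrightarrow> cutoff l r = 0"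
  and cutoff'_outside: "0 \<le> l \<Longrightarrow> l + 1 \<le> \<bar>r\<bar> \<Longrightarrow> cutoff' l r = 0"
  by (auto simp: cutoff_def cutoff'_def abs_if step_outside split: if_splits)

lemma cutoff_bounds: "0 \<le> cutoff l r" "cutoff l r \<le> 1" "\<bar>cutoff l r\<bar> \<le> 1"
  using step_bounds by (auto simp: cutoff_def intro!: mult_nonneg_nonneg mult_le_one)

text \<open>
  One constant serves for all levels \<open>l\<close>, because all cutoffs are products of translates of
  the same step; the comparison at level \<open>l\<close> needs this when \<open>l\<close> tends to
  infinity.
\<close>

lemma cutoff'_bounded:
  obtains C where "0 \<le> C" "\<And>l r. \<bar>cutoff' l r\<bar> \<le> C" "\<And>l r s. \<bar>cutoff l r - cutoff l s\<bar> \<le> C * \<bar>r - s\<bar>"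
proof -
  obtain C where C: "0 \<le> C" "\<And>t. \<bar>step' t\<bar> \<le> C"
    using step'_bounded by metis
  have 1: "\<bar>cutoff' l r\<bar> \<le> 2 * C" for l r
  proof -
    have "\<bar>step (l + 1 - r) * step' (l + 1 + r)\<bar> \<le> 1 * C" "\<bar>step' (l + 1 - r) * step (l + 1 + r)\<bar> \<le> C * 1"
      unfolding abs_mult
      by (intro mult_mono; use C(1,2) step_bounds[of "l + 1 - r"] step_bounds[of "l + 1 + r"] in simp)+
    then show ?thesis unfolding cutoff'_def by linarith
  qed
  have "norm (cutoff l r - cutoff l s) \<le> 2 * C * norm (r - s)" for l r s
    by (rule field_differentiable_bound[of UNIV "cutoff l" "cutoff' l"]) (use 1 DERIV_cutoff in auto)
  with 1 C(1) show ?thesis using that[of "2 * C"] by simp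
qed

lemma cutoff_C1_compact_support:
  assumes "0 \<le> l" shows "cutoff l \<in> C1_compact_support"
proof -
  have "{r. cutoff l r \<noteq> 0} \<subseteq> {- (l + 1)..l + 1}"
    using cutoff_outside[OF assms] by (force simp: abs_le_iff not_le)
  then have "bounded {r. cutoff l r \<noteq> 0}" by (rule bounded_subset[OF bounded_closed_interval])
  moreover have "cutoff l C1_differentiable_on UNIV"
    unfolding C1_differentiable_on_def
    using DERIV_cutoff[of l] isCont_cutoff'
    by (intro exI[of _ "cutoff' l"]) (auto simp: has_real_derivative_iff_has_vector_derivative intro!: continuous_at_imp_continuous_on)
  ultimately show ?thesis
    by (simp add: C1_compact_support_def)
qed

text \<open>
  The functions of \<open>r = v(x)\<close> and \<open>s = w(x)\<close> in the comparison argument have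
  the form \<open>(A(r) + B(s)) e(m(r - s))\<close>.  In the derivative the factor
  \<open>A(r) + B(s)\<close> may grow linearly in \<open>|r - s|\<close>, since
  \<open>(r - s) m e'(m(r - s))\<close> is bounded.
\<close>

lemma C1_bounded_times_flat:
  fixes A A' B B' :: "real \<Rightarrow> real"
  assumes A: "\<And>r. (A has_real_derivative A' r) (at r)" "\<And>r. isCont A' r" "\<And>r. \<bar>A' r\<bar> \<le> C"
    and B: "\<And>r. (B has_real_derivative B' r) (at r)" "\<And>r. isCont B' r" "\<And>r. \<bar>B' r\<bar> \<le> C"
    and AB: "\<And>r s. \<bar>A r + B s\<bar> \<le> C * (1 + \<bar>r - s\<bar>)" and m: "0 < m"
  shows "C1_bounded (\<lambda>r s. (A r + B s) * flat 0 (m * (r - s)))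
    (\<lambda>r s. A' r * flat 0 (m * (r - s)) + (A r + B s) * (m * flat 1 (m * (r - s))))
    (\<lambda>r s. B' s * flat 0 (m * (r - s)) - (A r + B s) * (m * flat 1 (m * (r - s))))"
  unfolding C1_bounded_def
proof (intro conjI allI)
  have d: "(flat 0 has_real_derivative flat 1 s) (at s)" for s
    using flat_has_derivative[of 0 s] by simp
  fix r s :: real
  have 1: "((\<lambda>z. A (fst z)) has_derivative (\<lambda>h. A' r * fst h)) (at (r, s))"
    using has_derivative_compose[of fst fst "(r, s)" UNIV A "(*) (A' r)"] A(1)[of r]
    by (simp add: has_field_derivative_def has_derivative_fst)
  have 2: "((\<lambda>z. B (snd z)) has_derivative (\<lambda>h. B' s * snd h)) (at (r, s))"
    using has_derivative_compose[of snd snd "(r, s)" UNIV B "(*) (B' s)"] B(1)[of s]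
    by (simp add: has_field_derivative_def has_derivative_snd)
  have "((\<lambda>z. m * (fst z - snd z)) has_derivative (\<lambda>h. m * (fst h - snd h))) (at (r, s))"
    by (auto intro!: derivative_eq_intros)
  from has_derivative_compose[OF this, of "flat 0" "(*) (flat 1 (m * (r - s)))"] d[of "m * (r - s)"]
  have 3: "((\<lambda>z. flat 0 (m * (fst z - snd z))) has_derivative (\<lambda>h. flat 1 (m * (r - s)) * (m * (fst h - snd h)))) (at (r, s))"
    by (simp add: has_field_derivative_def)
  show "((\<lambda>z. (A (fst z) + B (snd z)) * flat 0 (m * (fst z - snd z))) has_derivative
    (\<lambda>h. (A' r * flat 0 (m * (r - s)) + (A r + B s) * (m * flat 1 (m * (r - s)))) * fst h +
         (B' s * flat 0 (m * (r - s)) - (A r + B s) * (m * flat 1 (m * (r - s)))) * snd h)) (at (r, s))"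
    by (rule has_derivative_eq_rhs[OF has_derivative_mult[OF has_derivative_add[OF 1 2] 3]])
      (simp add: fun_eq_iff algebra_simps)
next
  have c: "continuous_on UNIV (\<lambda>z :: real \<times> real. H (fst z))" "continuous_on UNIV (\<lambda>z :: real \<times> real. H (snd z))"
    "continuous_on UNIV (\<lambda>z :: real \<times> real. H (m * (fst z - snd z)))"
    if "\<And>r. isCont H r" for H :: "real \<Rightarrow> real"
  proof -
    have H: "continuous_on UNIV H" using that by (simp add: continuous_at_imp_continuous_on)
    show "continuous_on UNIV (\<lambda>z :: real \<times> real. H (fst z))" "continuous_on UNIV (\<lambda>z :: real \<times> real. H (snd z))"
      "continuous_on UNIV (\<lambda>z :: real \<times> real. H (m * (fst z - snd z)))"
      by (rule continuous_on_compose2[OF H]; auto intro!: continuous_intros)+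
  qed
  have A0: "isCont A r" and B0: "isCont B r" for r using A(1) B(1) DERIV_isCont by blast+
  show "continuous_on UNIV (\<lambda>z. A' (fst z) * flat 0 (m * (fst z - snd z)) +
      (A (fst z) + B (snd z)) * (m * flat 1 (m * (fst z - snd z))))"
    "continuous_on UNIV (\<lambda>z. B' (snd z) * flat 0 (m * (fst z - snd z)) -
      (A (fst z) + B (snd z)) * (m * flat 1 (m * (fst z - snd z))))"
    by (intro continuous_intros c(1)[OF A(2)] c(2)[OF B(2)] c(1)[OF A0] c(2)[OF B0] c(3)[OF isCont_flat])+
next
  have C0: "0 \<le> C" using A(3)[of 0] by linarith
  have bd: "\<bar>(A r + B s) * (m * flat 1 (m * (r - s)))\<bar> \<le> C * (2 * m + 1)" for r s
  proof (cases "r \<le> s")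
    case True
    then have "flat 1 (m * (r - s)) = 0" using m by (intro flat_0_nonpos) (simp add: mult_nonneg_nonpos)
    then show ?thesis using C0 m by simp
  next
    case False
    have "\<bar>(A r + B s) * (m * flat 1 (m * (r - s)))\<bar> = \<bar>A r + B s\<bar> * (m * flat 1 (m * (r - s)))"
      using flat_1_nonneg m by (simp add: abs_mult)
    also have "\<dots> \<le> C * (1 + \<bar>r - s\<bar>) * (m * flat 1 (m * (r - s)))"
      using flat_1_nonneg m by (intro mult_right_mono AB) auto
    also have "\<dots> = C * (m * flat 1 (m * (r - s)) + m * (r - s) * flat 1 (m * (r - s)))"
      using False by (simp add: algebra_simps)
    also have "\<dots> \<le> C * (m * 2 + 1)"
      using C0 m flat_1_le mult_flat_1_le by (intro mult_left_mono add_mono) auto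
    finally show ?thesis by (simp add: mult.commute)
  qed
  have bA: "\<bar>A' r * flat 0 t\<bar> \<le> C * 1" "\<bar>B' r * flat 0 t\<bar> \<le> C * 1" for r t
    unfolding abs_mult
    by (intro mult_mono; use A(3) B(3) C0 flat_0_nonneg[of t] flat_0_le_1[of t] in simp)+
  show "\<exists>b. \<forall>r s. \<bar>A' r * flat 0 (m * (r - s)) + (A r + B s) * (m * flat 1 (m * (r - s)))\<bar> \<le> b \<and>
     \<bar>B' s * flat 0 (m * (r - s)) - (A r + B s) * (m * flat 1 (m * (r - s)))\<bar> \<le> b"
  proof (intro exI allI conjI)
    fix r s
    show "\<bar>A' r * flat 0 (m * (r - s)) + (A r + B s) * (m * flat 1 (m * (r - s)))\<bar> \<le> C * 1 + C * (2 * m + 1)"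
      using bd[of r s] bA(1)[of r "m * (r - s)"] by linarith
    show "\<bar>B' s * flat 0 (m * (r - s)) - (A r + B s) * (m * flat 1 (m * (r - s)))\<bar> \<le> C * 1 + C * (2 * m + 1)"
      using bd[of r s] bA(2)[of s "m * (r - s)"] by linarith
  qed
qed

lemma antiderivative_of_continuous:
  fixes f :: "real \<Rightarrow> real"
  assumes "\<And>r. isCont f r"
  obtains G where "\<And>r. (G has_real_derivative f r) (at r)"
proof -
  have "\<exists>G. \<forall>x::real. -\<infinity> < ereal x \<longrightarrow> ereal x < \<infinity> \<longrightarrow> (G has_vector_derivative f x) (at x)"
    by (rule einterval_antiderivative) (auto simp: assms)
  then show ?thesis using that by (auto simp: has_real_derivative_iff_has_vector_derivative)
qed

text \<open>
  For simple functions \<open>G\<close> the claim is measurability in \<open>x\<close>; the general case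
  is a limit by continuity, which holds only off a null set.
\<close>

lemma (in anisotropic_domain) caratheodory_measurable:
  assumes a: "caratheodory \<Omega> a" and G: "G \<in> borel_measurable M"
  shows "(\<lambda>x. a x (G x)) \<in> borel_measurable M"
proof -
  have am: "(\<lambda>x. a x \<xi>) \<in> borel_measurable M" for \<xi> using a by (simp add: caratheodory_def)
  have ac: "AE x in M. continuous_on UNIV (a x)" using a by (simp add: caratheodory_def)
  obtain s where s: "\<And>i. simple_function M (s i)" "\<And>x. x \<in> space M \<Longrightarrow> (\<lambda>i. s i x) \<longlonglongrightarrow> G x"
    using borel_measurable_implies_sequence_metric[OF G] by blast
  have sm: "(\<lambda>x. a x (s i x)) \<in> borel_measurable M" for i
  proof (rule measurable_compose_countable'[where I="s i ` space M" and g="s i" and f="\<lambda>\<xi> x. a x \<xi>"])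
    show "s i \<in> measurable M (count_space (s i ` space M))"
    proof (rule measurableI)
      show "s i -` A \<inter> space M \<in> sets M" for A
        using measurable_sets[OF measurable_simple_function[OF s(1)[of i]], of A] by simp
    qed auto
    show "countable (s i ` space M)" using simple_functionD(1)[OF s(1)] by (rule countable_finite)
  qed (rule am)
  \<comment> \<open>Outside the null set \<open>N\<close> the limit is taken pointwise; on \<open>N\<close> the functions are set to 0.\<close>
  obtain N where N: "N \<in> null_sets M" "\<And>x. x \<in> space M \<Longrightarrow> x \<notin> N \<Longrightarrow> continuous_on UNIV (a x)"
    using ac by (auto elim!: AE_E3)
  have Nm: "N \<in> sets M" using N(1) by auto
  have "(\<lambda>x. indicator (space M - N) x *\<^sub>R a x (G x)) \<in> borel_measurable M"
  proof (rule borel_measurable_LIMSEQ_metric)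
    show "(\<lambda>x. indicator (space M - N) x *\<^sub>R a x (s i x)) \<in> borel_measurable M" for i
      using Nm sm by (intro borel_measurable_scaleR borel_measurable_indicator) auto
    fix x assume x: "x \<in> space M"
    show "(\<lambda>i. indicat_real (space M - N) x *\<^sub>R a x (s i x)) \<longlonglongrightarrow> indicat_real (space M - N) x *\<^sub>R a x (G x)"
    proof (cases "x \<in> N")
      case False
      have "isCont (a x) (G x)" using N(2)[OF x False] by (simp add: continuous_on_eq_continuous_at)
      from isCont_tendsto_compose[OF this s(2)[OF x]] show ?thesis
        by (intro tendsto_scaleR tendsto_const)
    qed simp
  qed
  moreover have "AE x in M. indicat_real (space M - N) x *\<^sub>R a x (G x) = a x (G x)"
    using AE_not_in[OF N(1)] AE_space by eventually_elim simp
  ultimately show ?thesis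
    by (rule borel_measurable_AE_lebesgue_on[OF domain_measurable])
qed

text \<open>
  Young's inequality without its sharp constants, in the two forms in which it bounds the growth
  condition times a gradient: either \<open>y\<close> is at most \<open>x\<close>, or it is larger, and
  each case gives one term on the right.
\<close>

lemma mult_le_powr_conjugate:
  fixes x y q :: real
  assumes x: "0 \<le> x" and y: "0 \<le> y" and q: "1 < q"
  shows "x * y \<le> x powr (q / (q - 1)) + y powr q" "x powr (q - 1) * y \<le> x powr q + y powr q"
proof -
  have 1: "x powr (q - 1) * y \<le> x powr q + y powr q" if x: "0 \<le> x" for x
  proof (cases "y \<le> x")
    case True
    have "x powr (q - 1) * y \<le> x powr (q - 1) * x" using True by (intro mult_left_mono) auto
    also have "\<dots> = x powr q" using x q by (cases "x = 0") (auto simp: powr_diff)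
    finally show ?thesis by (simp add: add_increasing2)
  next
    case False
    have "x powr (q - 1) * y \<le> y powr (q - 1) * y"
      using False x y q by (intro mult_right_mono powr_mono2) auto
    also have "\<dots> = y powr q" using y q by (cases "y = 0") (auto simp: powr_diff)
    finally show ?thesis by (simp add: add_increasing)
  qed
  have "(x powr (1 / (q - 1))) powr (q - 1) * y \<le> (x powr (1 / (q - 1))) powr q + y powr q"
    by (rule 1) simp
  moreover have "(x powr (1 / (q - 1))) powr (q - 1) = x" "(x powr (1 / (q - 1))) powr q = x powr (q / (q - 1))"
    using x q by (simp_all add: powr_powr)
  ultimately show "x * y \<le> x powr (q / (q - 1)) + y powr q" by simp
  show "x powr (q - 1) * y \<le> x powr q + y powr q" by (rule 1[OF x])
qed

section \<open>The equations tested with a smoothed indicator\<close>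

text \<open>
  The derivative of \<open>t \<mapsto> e(m t)\<close> for \<open>e = flat 0\<close>.
\<close>

definition flat_slope :: "real \<Rightarrow> real \<Rightarrow> real" where
  "flat_slope m t = m * flat 1 (m * t)"

lemma flat_slope_nonneg: "0 < m \<Longrightarrow> 0 \<le> flat_slope m t"
  unfolding flat_slope_def by (intro mult_nonneg_nonneg flat_1_nonneg) simp

lemma flat_slope_mult_abs: "0 < m \<Longrightarrow> flat_slope m t * \<bar>t\<bar> = m * t * flat 1 (m * t)"
  by (cases "t \<le> 0") (simp_all add: flat_slope_def flat_0_nonpos mult_nonneg_nonpos)

text \<open>
  The gradients of \<open>h(v) \<Phi>\<close> and \<open>h(w) \<Phi>\<close>, where \<open>h\<close> is
  the cutoff at level \<open>l\<close>, \<open>\<Phi> = e(m(v - w))\<close>, and \<open>V\<close>,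
  \<open>W\<close> are the gradients of \<open>v\<close>, \<open>w\<close>.
\<close>

definition cut_grad1 :: "real \<Rightarrow> real \<Rightarrow> (real^'n \<Rightarrow> real) \<Rightarrow> (real^'n \<Rightarrow> real) \<Rightarrow>
    (real^'n \<Rightarrow> real^'n) \<Rightarrow> (real^'n \<Rightarrow> real^'n) \<Rightarrow> real^'n \<Rightarrow> real^'n" where
  "cut_grad1 l m v w V W x =
     (cutoff' l (v x) * flat 0 (m * (v x - w x))) *\<^sub>R V x + (cutoff l (v x) * flat_slope m (v x - w x)) *\<^sub>R (V x - W x)"

definition cut_grad2 :: "real \<Rightarrow> real \<Rightarrow> (real^'n \<Rightarrow> real) \<Rightarrow> (real^'n \<Rightarrow> real) \<Rightarrow>
    (real^'n \<Rightarrow> real^'n) \<Rightarrow> (real^'n \<Rightarrow> real^'n) \<Rightarrow> real^'n \<Rightarrow> real^'n" where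
  "cut_grad2 l m v w V W x =
     (cutoff' l (w x) * flat 0 (m * (v x - w x))) *\<^sub>R W x + (cutoff l (w x) * flat_slope m (v x - w x)) *\<^sub>R (V x - W x)"

text \<open>
  Coerciveness is recorded as the sign of \<open>a(x, \<xi>) \<bullet> \<xi>\<close>, which makes the
  energy on \<open>{l < |u| < l + 1}\<close> a bound for the terms with \<open>h'\<close>.
\<close>

locale elliptic_problem = anisotropic_domain \<Omega> p
  for \<Omega> :: "(real^'n) set" and p :: "real^'n" +
  fixes \<beta> :: "real^'n \<Rightarrow> real \<Rightarrow> real set" and a :: "real^'n \<Rightarrow> real^'n \<Rightarrow> real^'n"
    and F :: "real \<Rightarrow> real^'n" and d :: "real^'n \<Rightarrow> real^'n" and \<gamma> :: real and f :: "real^'n \<Rightarrow> real"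
  assumes F_lipschitz: "local_lipschitz (UNIV :: real set) UNIV (\<lambda>_. F)"
    and a_caratheodory: "caratheodory \<Omega> a"
    and \<gamma>_pos: "0 < \<gamma>"
    and d_Lp: "\<And>i. (\<lambda>x. d x $ i) \<in> Lp \<Omega> (p $ i / (p $ i - 1))"
    and growth: "AE x in lebesgue_on \<Omega>. \<forall>\<xi> i. \<bar>a x \<xi> $ i\<bar> \<le> \<gamma> * (d x $ i + \<bar>\<xi> $ i\<bar> powr (p $ i - 1))"
    and a_monotone: "AE x in lebesgue_on \<Omega>. \<forall>\<xi> \<eta>. (a x \<xi> - a x \<eta>) \<bullet> (\<xi> - \<eta>) \<ge> 0"
    and a_nonneg: "AE x in lebesgue_on \<Omega>. \<forall>\<xi>. 0 \<le> a x \<xi> \<bullet> \<xi>"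
    and \<beta>_strict: "AE x in lebesgue_on \<Omega>. strictly_monotone_graph (\<beta> x)"
    and f_L1: "f \<in> Lp \<Omega> 1"
begin

lemma F_lipschitz_on: obtains L where "L-lipschitz_on {-R..R} F"
proof -
  have "local_lipschitz {0::real} {-R..R} (\<lambda>_. F)"
    using F_lipschitz by (rule local_lipschitz_subset) auto
  from local_lipschitz_compact_implies_lipschitz[OF this, of thesis] that show ?thesis by simp
qed

lemma F_continuous: "continuous_on UNIV F"
  using local_lipschitz_continuous_on[OF F_lipschitz, of 0] by simp

lemma F_measurable: "u \<in> borel_measurable N \<Longrightarrow> (\<lambda>x. F (u x)) \<in> borel_measurable N"
  by (rule borel_measurable_continuous_on[OF F_continuous])

lemma flux_integrable:
  assumes V: "\<And>i. (\<lambda>x. V x $ i) \<in> borel_measurable M"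
      "\<And>i. integrable M (\<lambda>x. \<bar>V x $ i\<bar> powr (p $ i))"
    and Z: "\<And>i. (\<lambda>x. Z x $ i) \<in> borel_measurable M" "\<And>i. integrable M (\<lambda>x. \<bar>Z x $ i\<bar> powr (p $ i))"
  shows "integrable M (\<lambda>x. a x (V x) \<bullet> Z x)"
proof -
  have "(\<lambda>x. a x (V x)) \<in> borel_measurable M"
    by (rule caratheodory_measurable[OF a_caratheodory]) (simp add: borel_measurable_vec_iff V)
  then have am [measurable]: "(\<lambda>x. a x (V x) $ i) \<in> borel_measurable M" for i
    by (simp add: borel_measurable_vec_iff)
  note [measurable] = V(1) Z(1)
  have "integrable M (\<lambda>x. a x (V x) $ i * Z x $ i)" for i
  proof (rule Bochner_Integration.integrable_bound)
    let ?q = "p $ i / (p $ i - 1)"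
    let ?D = "\<lambda>x. \<gamma> * (\<bar>d x $ i\<bar> powr ?q + 2 * \<bar>Z x $ i\<bar> powr (p $ i) + \<bar>V x $ i\<bar> powr (p $ i))"
    have "integrable M (\<lambda>x. \<bar>d x $ i\<bar> powr ?q)" using d_Lp[of i] by (simp add: Lp_def)
    then show "integrable M ?D" using V(2) Z(2) by simp
    show "AE x in M. norm (a x (V x) $ i * Z x $ i) \<le> norm (?D x)"
      using growth
    proof eventually_elim
      case (elim x)
      let ?z = "\<bar>Z x $ i\<bar>" and ?v = "\<bar>V x $ i\<bar>"
      have "\<bar>a x (V x) $ i\<bar> \<le> \<gamma> * (d x $ i + ?v powr (p $ i - 1))" using elim by blast
      also have "\<dots> \<le> \<gamma> * (\<bar>d x $ i\<bar> + ?v powr (p $ i - 1))"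
        using \<gamma>_pos by (intro mult_left_mono) auto
      finally have "\<bar>a x (V x) $ i\<bar> * ?z \<le> \<gamma> * (\<bar>d x $ i\<bar> + ?v powr (p $ i - 1)) * ?z"
        by (rule mult_right_mono) simp
      also have "\<dots> = \<gamma> * (\<bar>d x $ i\<bar> * ?z + ?v powr (p $ i - 1) * ?z)" by (simp add: algebra_simps)
      also have "\<dots> \<le> \<gamma> * ((\<bar>d x $ i\<bar> powr ?q + ?z powr (p $ i)) + (?v powr (p $ i) + ?z powr (p $ i)))"
        using \<gamma>_pos by (intro mult_left_mono add_mono mult_le_powr_conjugate p_gt_1) auto
      also have "\<dots> = ?D x" by (simp add: algebra_simps)
      finally show ?case using \<gamma>_pos by (simp add: abs_mult)
    qed
  qed measurable
  then show ?thesis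
    by (simp add: inner_vec_def)
qed

context
  fixes \<phi> \<psi> :: "nat \<Rightarrow> real^'n \<Rightarrow> real" and v w :: "real^'n \<Rightarrow> real" and V W :: "real^'n \<Rightarrow> real^'n" and l :: real
  assumes v: "approximates \<Omega> p \<phi> v V" and w: "approximates \<Omega> p \<psi> w W" and l: "0 \<le> l"
    and v_le: "\<And>x. \<bar>v x\<bar> \<le> l + 1" and w_le: "\<And>x. \<bar>w x\<bar> \<le> l + 1"
begin

text \<open>
  The smoothed indicator of \<open>{v > w}\<close> is an admissible test function.
\<close>

lemma flat_diff_approximates:
  assumes m: "0 < m"
  obtains \<Phi> G where "approximates \<Omega> p \<Phi> (\<lambda>x. flat 0 (m * (v x - w x))) G"
proof -
  have "C1_bounded (\<lambda>r s. (1 + 0) * flat 0 (m * (r - s)))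
    (\<lambda>r s. 0 * flat 0 (m * (r - s)) + (1 + 0) * (m * flat 1 (m * (r - s))))
    (\<lambda>r s. 0 * flat 0 (m * (r - s)) - (1 + 0) * (m * flat 1 (m * (r - s))))"
    by (rule C1_bounded_times_flat[of "\<lambda>_. 1" "\<lambda>_. 0" 1 "\<lambda>_. 0" "\<lambda>_. 0" m]) (auto simp: m)
  from compose_approximates[OF v w this] that show ?thesis
    by (simp add: smooth_flat smooth_cmult smooth_diff flat_0_nonpos)
qed

lemma cut_grad_eqs:
  assumes m: "0 < m"
  shows "has_weak_grad \<Omega> (\<lambda>x. cutoff l (v x) * flat 0 (m * (v x - w x))) (cut_grad1 l m v w V W)"
    and "has_weak_grad \<Omega> (\<lambda>x. cutoff l (w x) * flat 0 (m * (v x - w x))) (cut_grad2 l m v w V W)"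
    and "(\<lambda>x. cut_grad1 l m v w V W x $ i) \<in> borel_measurable M"
    and "(\<lambda>x. cut_grad2 l m v w V W x $ i) \<in> borel_measurable M"
    and "integrable M (\<lambda>x. \<bar>cut_grad1 l m v w V W x $ i\<bar> powr (p $ i))"
    and "integrable M (\<lambda>x. \<bar>cut_grad2 l m v w V W x $ i\<bar> powr (p $ i))"
proof -
  obtain C where C: "0 \<le> C" "\<And>l r. \<bar>cutoff' l r\<bar> \<le> C" by (metis cutoff'_bounded)
  have AB: "\<bar>cutoff l r + 0\<bar> \<le> (C + 1) * (1 + \<bar>r - s\<bar>)" "\<bar>0 + cutoff l s\<bar> \<le> (C + 1) * (1 + \<bar>r - s\<bar>)" for r s
  proof -
    have "1 * 1 \<le> (C + 1) * (1 + \<bar>r - s\<bar>)" using C(1) by (intro mult_mono) auto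
    then show "\<bar>cutoff l r + 0\<bar> \<le> (C + 1) * (1 + \<bar>r - s\<bar>)" "\<bar>0 + cutoff l s\<bar> \<le> (C + 1) * (1 + \<bar>r - s\<bar>)"
      using cutoff_bounds(3)[of l r] cutoff_bounds(3)[of l s] by linarith+
  qed
  have b: "\<bar>cutoff' l r\<bar> \<le> C + 1" "\<bar>0\<bar> \<le> C + 1" for r using C(1) C(2)[of l r] by linarith+
  note K1 = C1_bounded_times_flat[OF DERIV_cutoff isCont_cutoff' b(1) DERIV_const continuous_const b(2) AB(1) m]
  note K2 = C1_bounded_times_flat[OF DERIV_const continuous_const b(2) DERIV_cutoff isCont_cutoff' b(1) AB(2) m]
  have e1: "(\<lambda>x. (cutoff' l (v x) * flat 0 (m * (v x - w x)) + (cutoff l (v x) + 0) * (m * flat 1 (m * (v x - w x)))) *\<^sub>R V x +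
      (0 * flat 0 (m * (v x - w x)) - (cutoff l (v x) + 0) * (m * flat 1 (m * (v x - w x)))) *\<^sub>R W x) = cut_grad1 l m v w V W"
    by (simp add: cut_grad1_def fun_eq_iff vec_eq_iff flat_slope_def algebra_simps)
  have e2: "(\<lambda>x. (0 * flat 0 (m * (v x - w x)) + (0 + cutoff l (w x)) * (m * flat 1 (m * (v x - w x)))) *\<^sub>R V x +
      (cutoff' l (w x) * flat 0 (m * (v x - w x)) - (0 + cutoff l (w x)) * (m * flat 1 (m * (v x - w x)))) *\<^sub>R W x) = cut_grad2 l m v w V W"
    by (simp add: cut_grad2_def fun_eq_iff vec_eq_iff flat_slope_def algebra_simps)
  show "has_weak_grad \<Omega> (\<lambda>x. cutoff l (v x) * flat 0 (m * (v x - w x))) (cut_grad1 l m v w V W)"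
    using chain_rule[OF v w K1] unfolding e1 by simp
  show "has_weak_grad \<Omega> (\<lambda>x. cutoff l (w x) * flat 0 (m * (v x - w x))) (cut_grad2 l m v w V W)"
    using chain_rule[OF v w K2] unfolding e2 by simp
  have c1: "(\<lambda>x. cut_grad1 l m v w V W x $ i) = (\<lambda>x. (cutoff' l (v x) * flat 0 (m * (v x - w x)) + (cutoff l (v x) + 0) * (m * flat 1 (m * (v x - w x)))) * V x $ i +
      (0 * flat 0 (m * (v x - w x)) - (cutoff l (v x) + 0) * (m * flat 1 (m * (v x - w x)))) * W x $ i)"
    unfolding e1[symmetric] by simp
  have c2: "(\<lambda>x. cut_grad2 l m v w V W x $ i) = (\<lambda>x. (0 * flat 0 (m * (v x - w x)) + (0 + cutoff l (w x)) * (m * flat 1 (m * (v x - w x)))) * V x $ i +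
      (cutoff' l (w x) * flat 0 (m * (v x - w x)) - (0 + cutoff l (w x)) * (m * flat 1 (m * (v x - w x)))) * W x $ i)"
    unfolding e2[symmetric] by simp
  show "(\<lambda>x. cut_grad1 l m v w V W x $ i) \<in> borel_measurable M"
    unfolding c1 by (rule Lp_convD(2)[OF compose_grad_conv[OF v w K1]])
  show "(\<lambda>x. cut_grad2 l m v w V W x $ i) \<in> borel_measurable M"
    unfolding c2 by (rule Lp_convD(2)[OF compose_grad_conv[OF v w K2]])
  show "integrable M (\<lambda>x. \<bar>cut_grad1 l m v w V W x $ i\<bar> powr (p $ i))"
    using compose_grad_integrable[OF v w K1, of i] unfolding fun_cong[OF c1] .
  show "integrable M (\<lambda>x. \<bar>cut_grad2 l m v w V W x $ i\<bar> powr (p $ i))"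
    using compose_grad_integrable[OF v w K2, of i] unfolding fun_cong[OF c2] .
qed

lemma F_component_bounded: obtains B where "\<And>x i. \<bar>F (v x) $ i\<bar> \<le> B" "\<And>x i. \<bar>F (w x) $ i\<bar> \<le> B"
    "\<And>r i. \<bar>r\<bar> \<le> l + 1 \<Longrightarrow> \<bar>F r $ i\<bar> \<le> B"
proof -
  have "bounded (F ` {-(l+1)..l+1})"
    by (intro compact_imp_bounded compact_continuous_image continuous_on_subset[OF F_continuous]) auto
  then obtain B where B: "\<forall>y\<in>F ` {-(l+1)..l+1}. norm y \<le> B" unfolding bounded_iff by blast
  have "\<bar>F r $ i\<bar> \<le> B" if "\<bar>r\<bar> \<le> l + 1" for r i
  proof -
    have "norm (F r) \<le> B" using B that by (auto simp: abs_le_iff)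
    then show ?thesis using component_le_norm_cart[of "F r" i] by linarith
  qed
  then show ?thesis using that v_le w_le by blast
qed

lemma convection_integrable:
  assumes "0 < m"
  shows "integrable M (\<lambda>x. F (v x) \<bullet> cut_grad1 l m v w V W x)" "integrable M (\<lambda>x. F (w x) \<bullet> cut_grad2 l m v w V W x)"
proof -
  obtain B where B: "\<And>x i. \<bar>F (v x) $ i\<bar> \<le> B" "\<And>x i. \<bar>F (w x) $ i\<bar> \<le> B" by (metis F_component_bounded)
  note g = cut_grad_eqs[OF assms]
  have Fm: "(\<lambda>x. F (v x) $ i) \<in> borel_measurable M" "(\<lambda>x. F (w x) $ i) \<in> borel_measurable M" for i
    using F_measurable[OF approximatesD(7)[OF v]] F_measurable[OF approximatesD(7)[OF w]]
    by (simp_all add: borel_measurable_vec_iff)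
  show "integrable M (\<lambda>x. F (v x) \<bullet> cut_grad1 l m v w V W x)"
    unfolding inner_vec_def inner_real_def
    by (intro Bochner_Integration.integrable_sum integrable_mult_bounded(2)[OF integrable_of_powr[OF p_pos(3) g(3,5)] Fm(1) B(1)])
  show "integrable M (\<lambda>x. F (w x) \<bullet> cut_grad2 l m v w V W x)"
    unfolding inner_vec_def inner_real_def
    by (intro Bochner_Integration.integrable_sum integrable_mult_bounded(2)[OF integrable_of_powr[OF p_pos(3) g(4,6)] Fm(2) B(2)])
qed

lemma flux_cut_grad_integrable:
  assumes "0 < m"
  shows "integrable M (\<lambda>x. a x (V x) \<bullet> cut_grad1 l m v w V W x)" "integrable M (\<lambda>x. a x (W x) \<bullet> cut_grad2 l m v w V W x)"
  by (intro flux_integrable cut_grad_eqs[OF assms] approximatesD(5,8)[OF v] approximatesD(5,8)[OF w])+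

lemma grad_diff_integrable:
  "(\<lambda>x. (V x - W x) $ i) \<in> borel_measurable M" "integrable M (\<lambda>x. \<bar>(V x - W x) $ i\<bar> powr (p $ i))"
  "integrable M (\<lambda>x. \<bar>V x $ i - W x $ i\<bar>)"
proof -
  note [measurable] = approximatesD(8)[OF v] approximatesD(8)[OF w]
  show 1: "(\<lambda>x. (V x - W x) $ i) \<in> borel_measurable M" by simp
  show 2: "integrable M (\<lambda>x. \<bar>(V x - W x) $ i\<bar> powr (p $ i))"
    unfolding vector_minus_component
    by (intro integrable_powr_add p_pos approximatesD(5,8)[OF v] approximatesD(5,8)[OF w])
  show "integrable M (\<lambda>x. \<bar>V x $ i - W x $ i\<bar>)"
    using integrable_abs[OF integrable_of_powr[OF p_pos(3) 1 2]] by simp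
qed

text \<open>
  The weight \<open>t e'(t)\<close> at \<open>t = m(v - w)\<close>, which multiplies all errors below
  and tends to 0 as \<open>m\<close> tends to infinity.
\<close>

abbreviation (input) weight :: "real \<Rightarrow> real^'n \<Rightarrow> real" where
  "weight m x \<equiv> m * (v x - w x) * flat 1 (m * (v x - w x))"

lemma weight_measurable: "weight m \<in> borel_measurable M"
proof -
  have [measurable]: "flat 1 \<in> borel_measurable borel"
    by (intro borel_measurable_continuous_onI continuous_at_imp_continuous_on) (simp add: isCont_flat)
  note [measurable] = approximatesD(7)[OF v] approximatesD(7)[OF w]
  show ?thesis by measurable
qed

lemma weight_le_1: "\<bar>weight m x\<bar> \<le> 1"
  using mult_flat_1_le[of "m * (v x - w x)"] mult_flat_1_nonneg[of "m * (v x - w x)"] by simp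

text \<open>
  Two parts are combined.  Where the derivative falls on the cutoff,
  \<open>h'(v) F(v) \<bullet> V\<close> is the divergence of \<open>G(v)\<close> with
  \<open>G' = h' F\<close>; since \<open>(G(v) - G(w)) \<Phi>\<close> is a \<open>C\<^sup>1\<close>
  function of \<open>v\<close> and \<open>w\<close> that vanishes at \<open>(0, 0)\<close>, its
  divergence integrates to 0, and the derivative is moved to \<open>\<Phi>\<close>.  Then every
  remaining term contains \<open>q(v) - q(w)\<close> with the Lipschitz function
  \<open>q = h F - G\<close>, multiplied with the derivative of \<open>\<Phi>\<close>, which produces
  the weight.
\<close>

lemma convection_lower_bound:
  obtains E where "integrable M E" "\<And>m. 0 < m \<Longrightarrow>
    - (\<integral>x. weight m x * E x \<partial>M) \<le>
      (\<integral>x. F (v x) \<bullet> cut_grad1 l m v w V W x \<partial>M) - (\<integral>x. F (w x) \<bullet> cut_grad2 l m v w V W x \<partial>M)"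
proof -
  obtain C where C: "0 \<le> C" "\<And>l r. \<bar>cutoff' l r\<bar> \<le> C" "\<And>l r s. \<bar>cutoff l r - cutoff l s\<bar> \<le> C * \<bar>r - s\<bar>"
    by (metis cutoff'_bounded)
  obtain B where B: "\<And>r i. \<bar>r\<bar> \<le> l + 1 \<Longrightarrow> \<bar>F r $ i\<bar> \<le> B" by (metis F_component_bounded)
  have B0: "0 \<le> B" using B[of 0 undefined] l by linarith
  obtain L where L: "L-lipschitz_on {-(l+1)..l+1} F" by (metis F_lipschitz_on)
  have L0: "0 \<le> L" by (rule lipschitz_on_nonneg[OF L])
  have FL: "\<bar>F r $ i - F s $ i\<bar> \<le> L * \<bar>r - s\<bar>" if "\<bar>r\<bar> \<le> l + 1" "\<bar>s\<bar> \<le> l + 1" for r s i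
  proof -
    have "norm (F r - F s) \<le> L * \<bar>r - s\<bar>"
      using lipschitz_onD[OF L, of r s] that by (auto simp: dist_norm abs_le_iff)
    then show ?thesis using component_le_norm_cart[of "F r - F s" i] by simp
  qed
  let ?g = "\<lambda>i r. cutoff' l r * F r $ i"
  have gc: "isCont (?g i) r" for i r
  proof -
    have "isCont F r" using F_continuous by (simp add: continuous_on_eq_continuous_at)
    then show ?thesis by (intro continuous_intros isCont_cutoff')
  qed
  have gb: "\<bar>?g i r\<bar> \<le> C * B" for i r
  proof (cases "\<bar>r\<bar> \<le> l + 1")
    case True
    then show ?thesis unfolding abs_mult using C B B0 by (intro mult_mono) auto
  next
    case False
    then show ?thesis using cutoff'_outside[OF l, of r] C(1) B0 by simp
  qed
  have "\<exists>G. \<forall>r. (G has_real_derivative ?g i r) (at r)" for i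
    using antiderivative_of_continuous[of "?g i"] gc by metis
  then obtain G where G: "\<And>i r. (G i has_real_derivative ?g i r) (at r)" by metis
  have GL: "\<bar>G i r - G i s\<bar> \<le> C * B * \<bar>r - s\<bar>" for i r s
  proof -
    have "norm (G i r - G i s) \<le> C * B * norm (r - s)"
      by (rule field_differentiable_bound[of UNIV "G i" "?g i"]) (use gb G in auto)
    then show ?thesis by simp
  qed
  \<comment> \<open>What is left of the convection after subtracting the divergence of \<open>(G v - G w) \<Phi>\<close>.\<close>
  define q where "q i r = cutoff l r * F r $ i - G i r" for i r
  define Q where "Q = L + C * B + C * B"
  have qL: "\<bar>q i r - q i s\<bar> \<le> Q * \<bar>r - s\<bar>" if "\<bar>r\<bar> \<le> l + 1" "\<bar>s\<bar> \<le> l + 1" for r s i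
  proof -
    have "q i r - q i s = cutoff l r * (F r $ i - F s $ i) + (cutoff l r - cutoff l s) * F s $ i - (G i r - G i s)"
      by (simp add: q_def algebra_simps)
    moreover have "\<bar>cutoff l r * (F r $ i - F s $ i)\<bar> \<le> 1 * (L * \<bar>r - s\<bar>)"
      unfolding abs_mult by (intro mult_mono cutoff_bounds FL that) auto
    moreover have "\<bar>(cutoff l r - cutoff l s) * F s $ i\<bar> \<le> (C * \<bar>r - s\<bar>) * B"
      unfolding abs_mult using C by (intro mult_mono B that) auto
    ultimately have "\<bar>q i r - q i s\<bar> \<le> L * \<bar>r - s\<bar> + C * \<bar>r - s\<bar> * B + C * B * \<bar>r - s\<bar>"
      using GL[of i r s] by linarith
    then show ?thesis by (simp add: Q_def algebra_simps)
  qed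
  let ?E = "\<lambda>x. Q * (\<Sum>i\<in>UNIV. \<bar>V x $ i - W x $ i\<bar>)"
  have E: "integrable M ?E" using grad_diff_integrable(3) by simp
  show ?thesis
  proof (rule that[OF E])
    fix m :: real assume m: "0 < m"
    have AB: "\<bar>G i r + - G i s\<bar> \<le> C * B * (1 + \<bar>r - s\<bar>)" for i r s
    proof -
      have "C * B * \<bar>r - s\<bar> \<le> C * B * (1 + \<bar>r - s\<bar>)" using C(1) B0 by (intro mult_left_mono) auto
      then show ?thesis using GL[of i r s] by linarith
    qed
    have mG: "((\<lambda>s. - G i s) has_real_derivative - ?g i s) (at s)" for i s by (intro DERIV_minus G)
    have mg: "isCont (\<lambda>s. - ?g i s) s" "\<bar>- ?g i s\<bar> \<le> C * B" for i s
      using gb[of s i] by (auto intro: continuous_minus gc)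
    let ?P = "\<lambda>x. flat 0 (m * (v x - w x))" and ?S = "\<lambda>x. flat_slope m (v x - w x)"
    let ?D = "\<lambda>i x. (?g i (v x) * ?P x + (G i (v x) + - G i (w x)) * (m * flat 1 (m * (v x - w x)))) * V x $ i +
      (- ?g i (w x) * ?P x - (G i (v x) + - G i (w x)) * (m * flat 1 (m * (v x - w x)))) * W x $ i"
    note K = C1_bounded_times_flat[OF G gc gb mG mg AB m]
    \<comment> \<open>\<open>?D i\<close> is the \<open>i\<close>-th partial derivative of \<open>(G i v - G i w) \<Phi>\<close>.\<close>
    have D: "integrable M (?D i)" "(\<integral>x. ?D i x \<partial>M) = 0" for i
      by (rule integral_chain_rule_eq_0[OF v w K]; simp add: flat_0_nonpos)+
    let ?H = "\<lambda>x. F (v x) \<bullet> cut_grad1 l m v w V W x - F (w x) \<bullet> cut_grad2 l m v w V W x"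
    have H: "integrable M ?H" using convection_integrable[OF m] by simp
    have eq: "?H x = (\<Sum>i\<in>UNIV. ?D i x) + (\<Sum>i\<in>UNIV. ?S x * (q i (v x) - q i (w x)) * (V x $ i - W x $ i))" for x
      unfolding inner_vec_def sum_subtractf[symmetric] sum.distrib[symmetric]
      by (rule sum.cong[OF refl]) (simp add: cut_grad1_def cut_grad2_def q_def flat_slope_def algebra_simps)
    have "- (weight m x * ?E x) \<le> ?H x - (\<Sum>i\<in>UNIV. ?D i x)" for x
    proof -
      have "\<bar>?S x * (q i (v x) - q i (w x)) * (V x $ i - W x $ i)\<bar> \<le> weight m x * (Q * \<bar>V x $ i - W x $ i\<bar>)" for i
      proof -
        have "\<bar>?S x * (q i (v x) - q i (w x)) * (V x $ i - W x $ i)\<bar> = ?S x * \<bar>q i (v x) - q i (w x)\<bar> * \<bar>V x $ i - W x $ i\<bar>"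
          using flat_slope_nonneg[OF m] by (simp add: abs_mult)
        also have "\<dots> \<le> ?S x * (Q * \<bar>v x - w x\<bar>) * \<bar>V x $ i - W x $ i\<bar>"
          using flat_slope_nonneg[OF m] by (intro mult_right_mono mult_left_mono qL v_le w_le) auto
        also have "\<dots> = (?S x * \<bar>v x - w x\<bar>) * (Q * \<bar>V x $ i - W x $ i\<bar>)" by (simp add: algebra_simps)
        finally show ?thesis by (simp only: flat_slope_mult_abs[OF m])
      qed
      then have "- (weight m x * (Q * \<bar>V x $ i - W x $ i\<bar>)) \<le> ?S x * (q i (v x) - q i (w x)) * (V x $ i - W x $ i)" for i
        by (simp only: abs_le_iff) (metis minus_le_iff)
      then have "(\<Sum>i\<in>UNIV. - (weight m x * (Q * \<bar>V x $ i - W x $ i\<bar>))) \<le>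
          (\<Sum>i\<in>UNIV. ?S x * (q i (v x) - q i (w x)) * (V x $ i - W x $ i))"
        by (intro sum_mono)
      moreover have "(\<Sum>i\<in>UNIV. - (weight m x * (Q * \<bar>V x $ i - W x $ i\<bar>))) = - (weight m x * ?E x)"
        by (simp only: sum_negf sum_distrib_left)
      ultimately show ?thesis using eq[of x] by linarith
    qed
    moreover have wE: "integrable M (\<lambda>x. weight m x * ?E x)"
      by (rule integrable_mult_bounded(2)[OF E weight_measurable weight_le_1])
    moreover have DH: "integrable M (\<lambda>x. ?H x - (\<Sum>i\<in>UNIV. ?D i x))"
      by (intro Bochner_Integration.integrable_diff H Bochner_Integration.integrable_sum D(1))
    ultimately have "(\<integral>x. - (weight m x * ?E x) \<partial>M) \<le> (\<integral>x. ?H x - (\<Sum>i\<in>UNIV. ?D i x) \<partial>M)"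
      by (intro integral_mono) auto
    also have "\<dots> = (\<integral>x. ?H x \<partial>M) - (\<Sum>i\<in>UNIV. \<integral>x. ?D i x \<partial>M)"
      using H D(1) by (simp only: Bochner_Integration.integral_diff Bochner_Integration.integral_sum Bochner_Integration.integrable_sum)
    also have "\<dots> = (\<integral>x. ?H x \<partial>M)" by (simp only: D(2)) simp
    also have "\<dots> = (\<integral>x. F (v x) \<bullet> cut_grad1 l m v w V W x \<partial>M) - (\<integral>x. F (w x) \<bullet> cut_grad2 l m v w V W x \<partial>M)"
      using convection_integrable[OF m] by simp
    finally show "- (\<integral>x. weight m x * ?E x \<partial>M) \<le> \<dots>" by simp
  qed
qed

text \<open>
  Write \<open>h(v) a(V) - h(w) a(W) = h(v) (a(V) - a(W)) + (h(v) - h(w)) a(W)\<close>.  Tested with the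
  derivative of \<open>\<Phi>\<close>, the first part is nonnegative by monotonicity, and the second is
  an error with the weight because \<open>h\<close> is Lipschitz.  The terms with \<open>h'\<close> are
  bounded by the energies.
\<close>

lemma flux_lower_bound:
  assumes C: "0 \<le> C" "\<And>l r. \<bar>cutoff' l r\<bar> \<le> C" "\<And>l r s. \<bar>cutoff l r - cutoff l s\<bar> \<le> C * \<bar>r - s\<bar>"
  obtains E where "integrable M E" "\<And>m. 0 < m \<Longrightarrow>
    - C * (\<integral>x. indicator {r. l < \<bar>r\<bar> \<and> \<bar>r\<bar> < l + 1} (v x) * (a x (V x) \<bullet> V x) \<partial>M)
    - C * (\<integral>x. indicator {r. l < \<bar>r\<bar> \<and> \<bar>r\<bar> < l + 1} (w x) * (a x (W x) \<bullet> W x) \<partial>M)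
    - (\<integral>x. weight m x * E x \<partial>M) \<le>
      (\<integral>x. a x (V x) \<bullet> cut_grad1 l m v w V W x \<partial>M) - (\<integral>x. a x (W x) \<bullet> cut_grad2 l m v w V W x \<partial>M)"
proof -
  let ?I = "indicator {r. l < \<bar>r\<bar> \<and> \<bar>r\<bar> < l + 1} :: real \<Rightarrow> real"
  let ?E = "\<lambda>x. C * \<bar>a x (W x) \<bullet> (V x - W x)\<bar>"
  have E: "integrable M ?E"
    by (intro integrable_mult_right integrable_abs flux_integrable approximatesD(5,8)[OF w] grad_diff_integrable)
  have "{r. l < \<bar>r\<bar> \<and> \<bar>r\<bar> < l + 1} \<in> sets borel" by measurable
  then have Im: "(\<lambda>x. ?I (v x)) \<in> borel_measurable M" "(\<lambda>x. ?I (w x)) \<in> borel_measurable M"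
    using approximatesD(7)[OF v] approximatesD(7)[OF w] by measurable
  have Ib: "\<bar>?I r\<bar> \<le> 1" for r by (simp add: indicator_def)
  have R: "integrable M (\<lambda>x. ?I (v x) * (a x (V x) \<bullet> V x))" "integrable M (\<lambda>x. ?I (w x) * (a x (W x) \<bullet> W x))"
    by (rule integrable_mult_bounded(2)[OF _ Im(1) Ib] integrable_mult_bounded(2)[OF _ Im(2) Ib],
        intro flux_integrable approximatesD(5,8)[OF v] approximatesD(5,8)[OF w])+
  have cut: "\<bar>cutoff' l r\<bar> \<le> C * ?I r" for r
  proof (cases "l < \<bar>r\<bar> \<and> \<bar>r\<bar> < l + 1")
    case False
    then have "cutoff' l r = 0" using cutoff'_inside[OF l, of r] cutoff'_outside[OF l, of r] by force
    then show ?thesis using C(1) by simp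
  qed (use C(2) in simp)
  show ?thesis
  proof (rule that[OF E])
    fix m :: real assume m: "0 < m"
    let ?P = "\<lambda>x. flat 0 (m * (v x - w x))" and ?S = "\<lambda>x. flat_slope m (v x - w x)"
    note int = flux_cut_grad_integrable[OF m]
    have wE: "integrable M (\<lambda>x. weight m x * ?E x)"
      by (rule integrable_mult_bounded(2)[OF E weight_measurable weight_le_1])
    have "AE x in M. - C * (?I (v x) * (a x (V x) \<bullet> V x)) - C * (?I (w x) * (a x (W x) \<bullet> W x)) - weight m x * ?E x \<le>
      a x (V x) \<bullet> cut_grad1 l m v w V W x - a x (W x) \<bullet> cut_grad2 l m v w V W x"
      using a_monotone a_nonneg
    proof eventually_elim
      case (elim x)
      have mono: "0 \<le> (a x (V x) - a x (W x)) \<bullet> (V x - W x)" and nn: "0 \<le> a x (V x) \<bullet> V x" "0 \<le> a x (W x) \<bullet> W x"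
        using elim by auto
      have eq: "a x (V x) \<bullet> cut_grad1 l m v w V W x - a x (W x) \<bullet> cut_grad2 l m v w V W x =
        cutoff' l (v x) * ?P x * (a x (V x) \<bullet> V x) - cutoff' l (w x) * ?P x * (a x (W x) \<bullet> W x) +
        cutoff l (v x) * ?S x * ((a x (V x) - a x (W x)) \<bullet> (V x - W x)) +
        ?S x * (cutoff l (v x) - cutoff l (w x)) * (a x (W x) \<bullet> (V x - W x))"
        by (simp add: cut_grad1_def cut_grad2_def inner_add_right inner_diff_left inner_diff_right algebra_simps)
      have h: "\<bar>cutoff' l r * ?P x * t\<bar> \<le> C * (?I r * t)" if "0 \<le> t" for r t
      proof -
        have "\<bar>cutoff' l r\<bar> * \<bar>?P x\<bar> * \<bar>t\<bar> \<le> (C * ?I r) * 1 * \<bar>t\<bar>"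
          using cut[of r] flat_0_nonneg[of "m * (v x - w x)"] flat_0_le_1[of "m * (v x - w x)"] C(1)
          by (intro mult_right_mono mult_mono) auto
        then show ?thesis using that by (simp add: abs_mult mult.assoc)
      qed
      have s: "\<bar>?S x * (cutoff l (v x) - cutoff l (w x)) * (a x (W x) \<bullet> (V x - W x))\<bar> \<le> weight m x * ?E x"
      proof -
        have "\<bar>?S x * (cutoff l (v x) - cutoff l (w x)) * (a x (W x) \<bullet> (V x - W x))\<bar> =
          ?S x * \<bar>cutoff l (v x) - cutoff l (w x)\<bar> * \<bar>a x (W x) \<bullet> (V x - W x)\<bar>"
          using flat_slope_nonneg[OF m] by (simp add: abs_mult)
        also have "\<dots> \<le> ?S x * (C * \<bar>v x - w x\<bar>) * \<bar>a x (W x) \<bullet> (V x - W x)\<bar>"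
          using flat_slope_nonneg[OF m] C(3) by (intro mult_right_mono mult_left_mono) auto
        also have "\<dots> = (?S x * \<bar>v x - w x\<bar>) * ?E x" by (simp add: algebra_simps)
        finally show ?thesis by (simp only: flat_slope_mult_abs[OF m])
      qed
      have "0 \<le> cutoff l (v x) * ?S x * ((a x (V x) - a x (W x)) \<bullet> (V x - W x))"
        by (intro mult_nonneg_nonneg cutoff_bounds flat_slope_nonneg m mono)
      then show ?case
        unfolding eq using h[OF nn(1), of "v x"] h[OF nn(2), of "w x"] s by linarith
    qed
    then have "(\<integral>x. - C * (?I (v x) * (a x (V x) \<bullet> V x)) - C * (?I (w x) * (a x (W x) \<bullet> W x)) - weight m x * ?E x \<partial>M) \<le>
      (\<integral>x. a x (V x) \<bullet> cut_grad1 l m v w V W x - a x (W x) \<bullet> cut_grad2 l m v w V W x \<partial>M)"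
      by (intro integral_mono_AE Bochner_Integration.integrable_diff integrable_mult_right R wE int)
    moreover have "(\<integral>x. - C * (?I (v x) * (a x (V x) \<bullet> V x)) - C * (?I (w x) * (a x (W x) \<bullet> W x)) - weight m x * ?E x \<partial>M) =
      - C * (\<integral>x. ?I (v x) * (a x (V x) \<bullet> V x) \<partial>M) - C * (\<integral>x. ?I (w x) * (a x (W x) \<bullet> W x) \<partial>M) - (\<integral>x. weight m x * ?E x \<partial>M)"
      by (simp only: Bochner_Integration.integral_diff Bochner_Integration.integrable_diff integrable_mult_right R wE integral_mult_right_zero)
    moreover have "(\<integral>x. a x (V x) \<bullet> cut_grad1 l m v w V W x - a x (W x) \<bullet> cut_grad2 l m v w V W x \<partial>M) =
      (\<integral>x. a x (V x) \<bullet> cut_grad1 l m v w V W x \<partial>M) - (\<integral>x. a x (W x) \<bullet> cut_grad2 l m v w V W x \<partial>M)"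
      by (rule Bochner_Integration.integral_diff[OF int])
    ultimately show "- C * (\<integral>x. ?I (v x) * (a x (V x) \<bullet> V x) \<partial>M) - C * (\<integral>x. ?I (w x) * (a x (W x) \<bullet> W x) \<partial>M)
      - (\<integral>x. weight m x * ?E x \<partial>M) \<le>
      (\<integral>x. a x (V x) \<bullet> cut_grad1 l m v w V W x \<partial>M) - (\<integral>x. a x (W x) \<bullet> cut_grad2 l m v w V W x \<partial>M)"
      by simp
  qed
qed

end

end

section \<open>Comparison and uniqueness\<close>

lemma flat_diff_tendsto: "(\<lambda>n. flat 0 (real (Suc n) * t)) \<longlonglongrightarrow> indicator {0<..} t"
  and weight_tendsto: "(\<lambda>n. real (Suc n) * t * flat 1 (real (Suc n) * t)) \<longlonglongrightarrow> 0"
proof -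
  have lim: "filterlim (\<lambda>n. real (Suc n) * t) at_top sequentially" if "0 < t"
    using filterlim_tendsto_pos_mult_at_top[OF tendsto_const that
        filterlim_compose[OF filterlim_real_sequentially filterlim_Suc]]
    by (simp add: mult.commute)
  have np: "real (Suc n) * t \<le> 0" if "t \<le> 0" for n using that by (simp add: mult_nonneg_nonpos)
  show "(\<lambda>n. flat 0 (real (Suc n) * t)) \<longlonglongrightarrow> indicator {0<..} t"
  proof (cases "0 < t")
    case True
    then show ?thesis using filterlim_compose[OF flat_0_tendsto lim[OF True]] by simp
  next
    case False
    then have "flat 0 (real (Suc n) * t) = 0" for n using np by (intro flat_0_nonpos) simp
    then show ?thesis using False by simp
  qed
  show "(\<lambda>n. real (Suc n) * t * flat 1 (real (Suc n) * t)) \<longlonglongrightarrow> 0"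
  proof (cases "0 < t")
    case True
    show ?thesis using filterlim_compose[OF mult_flat_1_tendsto lim[OF True]] .
  next
    case False
    then have "flat 1 (real (Suc n) * t) = 0" for n using np by (intro flat_0_nonpos) simp
    then show ?thesis by simp
  qed
qed

lemma abs_trunc_le: "0 \<le> k \<Longrightarrow> \<bar>trunc k r\<bar> \<le> k"
  by (auto simp: trunc_def)

lemma trunc_id: "\<bar>r\<bar> \<le> k \<Longrightarrow> trunc k r = r"
  by (auto simp: trunc_def)

lemma trunc_abs_large: "0 \<le> k \<Longrightarrow> k \<le> \<bar>r\<bar> \<Longrightarrow> \<bar>trunc k r\<bar> = k"
  by (auto simp: trunc_def abs_if min_def max_def split: if_splits)

lemma cutoff_trunc:
  assumes "0 \<le> l"
  shows "cutoff l (trunc (l + 1) r) = cutoff l r" "cutoff' l (trunc (l + 1) r) = cutoff' l r"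
proof -
  have "cutoff l (trunc (l + 1) r) = cutoff l r \<and> cutoff' l (trunc (l + 1) r) = cutoff' l r"
  proof (cases "\<bar>r\<bar> \<le> l + 1")
    case True
    then show ?thesis by (simp add: trunc_id)
  next
    case False
    then show ?thesis
      using assms trunc_abs_large[of "l + 1" r] by (simp add: cutoff_outside cutoff'_outside)
  qed
  then show "cutoff l (trunc (l + 1) r) = cutoff l r" "cutoff' l (trunc (l + 1) r) = cutoff' l r" by auto
qed

context elliptic_problem
begin

abbreviation "solution u b \<equiv> renormalized_solution \<Omega> p \<beta> a F f u b"

lemma solutionD:
  assumes "solution u b"
  shows "u \<in> borel_measurable M" "integrable M b" "b \<in> borel_measurable M"
    and "AE x in M. b x \<in> \<beta> x (u x)"
    and "\<And>k. 0 < k \<Longrightarrow> (\<lambda>x. trunc k (u x)) \<in> W1p_0 \<Omega> p"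
    and "\<And>h \<phi>. h \<in> C1_compact_support \<Longrightarrow> \<phi> \<in> W1p_0 \<Omega> p \<inter> Linf \<Omega> \<Longrightarrow>
         (\<integral>x. b x * h (u x) * \<phi> x \<partial>M) +
         (\<integral>x. (a x (gen_grad \<Omega> u x) + F (u x)) \<bullet> weak_grad \<Omega> (\<lambda>y. h (u y) * \<phi> y) x \<partial>M) =
         (\<integral>x. f x * h (u x) * \<phi> x \<partial>M)"
    and "((\<lambda>k::real. \<integral>x\<in>{x \<in> \<Omega>. k < \<bar>u x\<bar> \<and> \<bar>u x\<bar> < k + 1}. a x (gen_grad \<Omega> u x) \<bullet> gen_grad \<Omega> u x \<partial>lebesgue)
        \<longlongrightarrow> 0) at_top"
proof -
  have "b \<in> Lp \<Omega> 1" using assms by (simp add: renormalized_solution_def)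
  then show "integrable M b" "b \<in> borel_measurable M" by (auto simp: Lp_def integrable_abs_iff)
qed (use assms in \<open>auto simp: renormalized_solution_def\<close>)

lemma f_integrable: "integrable M f" "f \<in> borel_measurable M"
  using f_L1 by (auto simp: Lp_def integrable_abs_iff)

lemma solution_gen_grad:
  assumes sol: "solution u b" and l: "0 \<le> l"
  shows "AE x in M. \<bar>u x\<bar> < l + 1 \<longrightarrow> gen_grad \<Omega> u x = weak_grad \<Omega> (\<lambda>x. trunc (l + 1) (u x)) x"
proof -
  have "AE x in M. weak_grad \<Omega> (\<lambda>y. trunc (l + 1) (u y)) x = indicat_real {y. \<bar>u y\<bar> < l + 1} x *\<^sub>R gen_grad \<Omega> u x"
    by (rule gen_gradD(2)[OF solutionD(1)[OF sol] solutionD(5)[OF sol]]) (use l in auto)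
  then show ?thesis by eventually_elim simp
qed

text \<open>
  The cutoff vanishes where \<open>|u| \<ge> l + 1\<close>, so the equation involves only the truncation
  \<open>v\<close> and its gradient.
\<close>

lemma cutoff_tested_equation:
  assumes v: "v = (\<lambda>x. trunc (l + 1) (u x))" and V: "V = weak_grad \<Omega> v"
    and sol: "solution u b" and l: "0 \<le> l" and \<Phi>: "\<Phi> \<in> W1p_0 \<Omega> p \<inter> Linf \<Omega>"
    and Z: "has_weak_grad \<Omega> (\<lambda>x. cutoff l (v x) * \<Phi> x) Z"
    and Z0: "\<And>x. \<bar>v x\<bar> = l + 1 \<Longrightarrow> Z x = 0"
  shows "(\<integral>x. b x * cutoff l (u x) * \<Phi> x \<partial>M) + (\<integral>x. (a x (V x) + F (v x)) \<bullet> Z x \<partial>M) =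
    (\<integral>x. f x * cutoff l (u x) * \<Phi> x \<partial>M)"
proof -
  have "(\<lambda>y. cutoff l (u y) * \<Phi> y) = (\<lambda>x. cutoff l (v x) * \<Phi> x)"
    by (simp add: v cutoff_trunc l)
  then have wg: "AE x in M. weak_grad \<Omega> (\<lambda>y. cutoff l (u y) * \<Phi> y) x = Z x"
    using weak_grad_eq_AE[OF open_domain Z] by simp
  have "(\<integral>x. (a x (gen_grad \<Omega> u x) + F (u x)) \<bullet> weak_grad \<Omega> (\<lambda>y. cutoff l (u y) * \<Phi> y) x \<partial>M) =
    (\<integral>x. (a x (V x) + F (v x)) \<bullet> Z x \<partial>M)"
  proof (rule integral_lebesgue_on_cong_AE[OF domain_measurable])
    show "AE x in M. (a x (gen_grad \<Omega> u x) + F (u x)) \<bullet> weak_grad \<Omega> (\<lambda>y. cutoff l (u y) * \<Phi> y) x =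
      (a x (V x) + F (v x)) \<bullet> Z x"
      using wg solution_gen_grad[OF sol l]
    proof eventually_elim
      case (elim x)
      show ?case
      proof (cases "\<bar>u x\<bar> < l + 1")
        case True
        then have "gen_grad \<Omega> u x = V x" "v x = u x"
          using elim(2) by (simp_all add: V v trunc_id)
        then show ?thesis using elim(1) by simp
      next
        case False
        then have "Z x = 0" using trunc_abs_large[of "l + 1" "u x"] l by (intro Z0) (simp add: v)
        then show ?thesis using elim(1) by simp
      qed
    qed
  qed
  with solutionD(6)[OF sol cutoff_C1_compact_support[OF l] \<Phi>] show ?thesis by simp
qed

definition annulus_energy :: "(real^'n \<Rightarrow> real) \<Rightarrow> real \<Rightarrow> real" where
  "annulus_energy u k =
     (\<integral>x\<in>{x \<in> \<Omega>. k < \<bar>u x\<bar> \<and> \<bar>u x\<bar> < k + 1}. a x (gen_grad \<Omega> u x) \<bullet> gen_grad \<Omega> u x \<partial>lebesgue)"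

lemma annulus_energy_trunc:
  assumes v: "v = (\<lambda>x. trunc (l + 1) (u x))" and V: "V = weak_grad \<Omega> v"
    and sol: "solution u b" and l: "0 \<le> l"
  shows "(\<integral>x. indicator {r. l < \<bar>r\<bar> \<and> \<bar>r\<bar> < l + 1} (v x) * (a x (V x) \<bullet> V x) \<partial>M) = annulus_energy u l"
proof -
  let ?I = "indicator {r. l < \<bar>r\<bar> \<and> \<bar>r\<bar> < l + 1} :: real \<Rightarrow> real"
  let ?g = "gen_grad \<Omega> u"
  have Iv: "?I (v x) = ?I (u x)" for x
    using l trunc_abs_large[of "l + 1" "u x"] trunc_id[of "u x" "l + 1"]
    by (cases "\<bar>u x\<bar> < l + 1") (auto simp: v indicator_def)
  have "annulus_energy u l = (\<integral>x. indicator \<Omega> x *\<^sub>R (?I (u x) * (a x (?g x) \<bullet> ?g x)) \<partial>lebesgue)"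
    unfolding annulus_energy_def set_lebesgue_integral_def
    by (rule Bochner_Integration.integral_cong) (auto simp: indicator_def)
  also have "\<dots> = (\<integral>x. ?I (u x) * (a x (?g x) \<bullet> ?g x) \<partial>M)"
    using domain_measurable by (simp add: integral_restrict_space)
  also have "\<dots> = (\<integral>x. ?I (v x) * (a x (V x) \<bullet> V x) \<partial>M)"
  proof (rule integral_lebesgue_on_cong_AE[OF domain_measurable])
    show "AE x in M. ?I (u x) * (a x (?g x) \<bullet> ?g x) = ?I (v x) * (a x (V x) \<bullet> V x)"
      using solution_gen_grad[OF sol l]
    proof eventually_elim
      case (elim x)
      then show ?case
        unfolding Iv by (cases "\<bar>u x\<bar> < l + 1") (simp_all add: V v)
    qed
  qed
  finally show ?thesis ..
qed

text \<open>
  Here \<open>m\<close> tends to infinity while \<open>l\<close> is fixed.  The smoothed indicators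
  vanish identically on \<open>{v \<le> w}\<close>, so they converge exactly to the indicator function
  of \<open>{v > w}\<close>.
\<close>

lemma comparison_at_level:
  assumes sol: "solution u b" and sol': "solution u' b'" and l: "0 \<le> l"
    and C: "0 \<le> C" "\<And>l r. \<bar>cutoff' l r\<bar> \<le> C" "\<And>l r s. \<bar>cutoff l r - cutoff l s\<bar> \<le> C * \<bar>r - s\<bar>"
  shows "(\<integral>x. (b x * cutoff l (u x) - b' x * cutoff l (u' x) - f x * (cutoff l (u x) - cutoff l (u' x))) *
      indicator {0<..} (trunc (l + 1) (u x) - trunc (l + 1) (u' x)) \<partial>M)
    \<le> C * annulus_energy u l + C * annulus_energy u' l"
proof -
  note s = solutionD[OF sol] and s' = solutionD[OF sol']
  define v where "v = (\<lambda>x. trunc (l + 1) (u x))"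
  define w where "w = (\<lambda>x. trunc (l + 1) (u' x))"
  define V where "V = weak_grad \<Omega> v"
  define W where "W = weak_grad \<Omega> w"
  have vW: "v \<in> W1p_0 \<Omega> p" "w \<in> W1p_0 \<Omega> p" unfolding v_def w_def using s(5) s'(5) l by auto
  obtain \<phi> where v: "approximates \<Omega> p \<phi> v V" unfolding V_def by (rule W1p_0_approximates[OF vW(1)])
  obtain \<psi> where w: "approximates \<Omega> p \<psi> w W" unfolding W_def by (rule W1p_0_approximates[OF vW(2)])
  have vb: "\<bar>v x\<bar> \<le> l + 1" and wb: "\<bar>w x\<bar> \<le> l + 1" for x
    unfolding v_def w_def using l by (auto intro!: abs_trunc_le)
  note ctx = v w l vb wb
  let ?weight = "\<lambda>m x. m * (v x - w x) * flat 1 (m * (v x - w x))"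
  let ?c = "\<lambda>x. b x * cutoff l (u x) - b' x * cutoff l (u' x) - f x * (cutoff l (u x) - cutoff l (u' x))"
  let ?P = "\<lambda>m x. flat 0 (m * (v x - w x))"
  obtain E1 where E1: "integrable M E1" "\<And>m. 0 < m \<Longrightarrow> - (\<integral>x. ?weight m x * E1 x \<partial>M) \<le>
      (\<integral>x. F (v x) \<bullet> cut_grad1 l m v w V W x \<partial>M) - (\<integral>x. F (w x) \<bullet> cut_grad2 l m v w V W x \<partial>M)"
    by (rule convection_lower_bound[OF ctx]) blast
  obtain E2 where E2: "integrable M E2" "\<And>m. 0 < m \<Longrightarrow>
    - C * (\<integral>x. indicator {r. l < \<bar>r\<bar> \<and> \<bar>r\<bar> < l + 1} (v x) * (a x (V x) \<bullet> V x) \<partial>M)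
    - C * (\<integral>x. indicator {r. l < \<bar>r\<bar> \<and> \<bar>r\<bar> < l + 1} (w x) * (a x (W x) \<bullet> W x) \<partial>M)
    - (\<integral>x. ?weight m x * E2 x \<partial>M) \<le>
      (\<integral>x. a x (V x) \<bullet> cut_grad1 l m v w V W x \<partial>M) - (\<integral>x. a x (W x) \<bullet> cut_grad2 l m v w V W x \<partial>M)"
    by (rule flux_lower_bound[OF ctx C]) blast
  note wt = weight_measurable[OF ctx] weight_le_1[OF ctx]
  have energy: "(\<integral>x. indicator {r. l < \<bar>r\<bar> \<and> \<bar>r\<bar> < l + 1} (v x) * (a x (V x) \<bullet> V x) \<partial>M) = annulus_energy u l"
    "(\<integral>x. indicator {r. l < \<bar>r\<bar> \<and> \<bar>r\<bar> < l + 1} (w x) * (a x (W x) \<bullet> W x) \<partial>M) = annulus_energy u' l"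
    by (rule annulus_energy_trunc[OF v_def V_def sol l] annulus_energy_trunc[OF w_def W_def sol' l])+
  have cutm: "(\<lambda>x. cutoff l (u x)) \<in> borel_measurable M" "(\<lambda>x. cutoff l (u' x)) \<in> borel_measurable M"
  proof -
    have "continuous_on UNIV (cutoff l)"
      by (intro continuous_at_imp_continuous_on ballI DERIV_isCont[OF DERIV_cutoff])
    then show "(\<lambda>x. cutoff l (u x)) \<in> borel_measurable M" "(\<lambda>x. cutoff l (u' x)) \<in> borel_measurable M"
      using s(1) s'(1) by (auto intro: borel_measurable_continuous_on)
  qed
  have int_c: "integrable M (\<lambda>x. b x * cutoff l (u x))" "integrable M (\<lambda>x. b' x * cutoff l (u' x))"
    "integrable M (\<lambda>x. f x * cutoff l (u x))" "integrable M (\<lambda>x. f x * cutoff l (u' x))"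
    by (intro integrable_mult_bounded(1)[OF _ _ cutoff_bounds(3)] s s' f_integrable cutm)+
  then have c_int: "integrable M ?c" by (simp add: right_diff_distrib)
  have Pm: "?P m \<in> borel_measurable M" for m
  proof -
    have "continuous_on UNIV (flat 0)" by (intro continuous_at_imp_continuous_on ballI isCont_flat)
    then show ?thesis
      by (rule borel_measurable_continuous_on)
        (intro borel_measurable_times borel_measurable_diff borel_measurable_const approximatesD(7)[OF v] approximatesD(7)[OF w])
  qed
  have Pb: "\<bar>?P m x\<bar> \<le> 1" for m x using flat_0_nonneg flat_0_le_1 by simp
  \<comment> \<open>The difference of the two tested equations, with the lower bounds for flux and convection inserted.\<close>
  have ineq: "(\<integral>x. ?c x * ?P m x \<partial>M) \<le> C * annulus_energy u l + C * annulus_energy u' l +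
      (\<integral>x. ?weight m x * E1 x \<partial>M) + (\<integral>x. ?weight m x * E2 x \<partial>M)" if m: "0 < m" for m
  proof -
    obtain \<zeta> G where "approximates \<Omega> p \<zeta> (?P m) G" by (rule flat_diff_approximates[OF ctx m])
    then have "?P m \<in> W1p_0 \<Omega> p" by (rule approximates_W1p_0)
    moreover have "?P m \<in> Linf \<Omega>" using Pm[of m] Pb[of m] by (auto simp: Linf_def)
    ultimately have \<Phi>: "?P m \<in> W1p_0 \<Omega> p \<inter> Linf \<Omega>" by simp
    note g = cut_grad_eqs[OF ctx m]
    note iF = convection_integrable[OF ctx m] and ia = flux_cut_grad_integrable[OF ctx m]
    have e1: "(\<integral>x. b x * cutoff l (u x) * ?P m x \<partial>M) + (\<integral>x. (a x (V x) + F (v x)) \<bullet> cut_grad1 l m v w V W x \<partial>M) =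
      (\<integral>x. f x * cutoff l (u x) * ?P m x \<partial>M)"
      by (rule cutoff_tested_equation[OF v_def V_def sol l \<Phi> g(1)])
        (simp add: cut_grad1_def cutoff_outside cutoff'_outside l)
    have e2: "(\<integral>x. b' x * cutoff l (u' x) * ?P m x \<partial>M) + (\<integral>x. (a x (W x) + F (w x)) \<bullet> cut_grad2 l m v w V W x \<partial>M) =
      (\<integral>x. f x * cutoff l (u' x) * ?P m x \<partial>M)"
      by (rule cutoff_tested_equation[OF w_def W_def sol' l \<Phi> g(2)])
        (simp add: cut_grad2_def cutoff_outside cutoff'_outside l)
    note i4 = int_c[THEN integrable_mult_bounded(1)[OF _ Pm Pb]]
    have "(\<integral>x. ?c x * ?P m x \<partial>M) =
      (\<integral>x. b x * cutoff l (u x) * ?P m x \<partial>M) - (\<integral>x. b' x * cutoff l (u' x) * ?P m x \<partial>M)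
      - ((\<integral>x. f x * cutoff l (u x) * ?P m x \<partial>M) - (\<integral>x. f x * cutoff l (u' x) * ?P m x \<partial>M))"
      using i4[of m] by (simp add: left_diff_distrib right_diff_distrib)
    moreover have "(\<integral>x. (a x (V x) + F (v x)) \<bullet> cut_grad1 l m v w V W x \<partial>M) =
      (\<integral>x. a x (V x) \<bullet> cut_grad1 l m v w V W x \<partial>M) + (\<integral>x. F (v x) \<bullet> cut_grad1 l m v w V W x \<partial>M)"
      using iF ia by (simp add: inner_add_left)
    moreover have "(\<integral>x. (a x (W x) + F (w x)) \<bullet> cut_grad2 l m v w V W x \<partial>M) =
      (\<integral>x. a x (W x) \<bullet> cut_grad2 l m v w V W x \<partial>M) + (\<integral>x. F (w x) \<bullet> cut_grad2 l m v w V W x \<partial>M)"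
      using iF ia by (simp add: inner_add_left)
    ultimately show ?thesis
      using e1 e2 E1(2)[OF m] E2(2)[OF m] unfolding energy by linarith
  qed
  have Em: "E1 \<in> borel_measurable M" "E2 \<in> borel_measurable M" using E1(1) E2(1) by auto
  have weight0: "(\<lambda>n. \<integral>x. ?weight (real (Suc n)) x * E x \<partial>M) \<longlonglongrightarrow> 0" if E: "integrable M E" for E
  proof -
    have "(\<lambda>n. \<integral>x. ?weight (real (Suc n)) x * E x \<partial>M) \<longlonglongrightarrow> (\<integral>x. 0 \<partial>M)"
    proof (rule integral_dominated_convergence[OF _ _ integrable_norm[OF E]])
      show "AE x in M. (\<lambda>n. ?weight (real (Suc n)) x * E x) \<longlonglongrightarrow> 0"
        by (intro AE_I2 tendsto_mult_left_zero weight_tendsto)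
      show "AE x in M. norm (?weight (real (Suc n)) x * E x) \<le> norm (E x)" for n
      proof (rule AE_I2)
        fix x
        have "\<bar>?weight (real (Suc n)) x\<bar> * \<bar>E x\<bar> \<le> 1 * \<bar>E x\<bar>" by (intro mult_right_mono wt) simp
        then show "norm (?weight (real (Suc n)) x * E x) \<le> norm (E x)" by (simp only: real_norm_def abs_mult mult_1)
      qed
      show "(\<lambda>x. ?weight (real (Suc n)) x * E x) \<in> borel_measurable M" for n
        by (intro borel_measurable_times[OF wt(1)] borel_measurable_integrable E)
    qed simp
    then show ?thesis by simp
  qed
  have lim: "(\<lambda>n. \<integral>x. ?c x * ?P (real (Suc n)) x \<partial>M) \<longlonglongrightarrow> (\<integral>x. ?c x * indicator {0<..} (v x - w x) \<partial>M)"
  proof (rule integral_dominated_convergence[OF _ _ integrable_norm[OF c_int]])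
    show "AE x in M. (\<lambda>n. ?c x * ?P (real (Suc n)) x) \<longlonglongrightarrow> ?c x * indicator {0<..} (v x - w x)"
      by (intro AE_I2 tendsto_mult tendsto_const flat_diff_tendsto)
    show "AE x in M. norm (?c x * ?P (real (Suc n)) x) \<le> norm (?c x)" for n
    proof (rule AE_I2)
      fix x
      have "\<bar>?c x\<bar> * \<bar>?P (real (Suc n)) x\<bar> \<le> \<bar>?c x\<bar> * 1" by (intro mult_left_mono Pb) simp
      then show "norm (?c x * ?P (real (Suc n)) x) \<le> norm (?c x)" by (simp only: real_norm_def abs_mult mult_1_right)
    qed
    show "(\<lambda>x. ?c x * ?P (real (Suc n)) x) \<in> borel_measurable M" for n
      by (intro borel_measurable_times[OF borel_measurable_integrable[OF c_int] Pm])
    have "(\<lambda>x. v x - w x) \<in> borel_measurable M"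
      by (intro borel_measurable_diff approximatesD(7)[OF v] approximatesD(7)[OF w])
    then have "(\<lambda>x. indicat_real {0<..} (v x - w x)) \<in> borel_measurable M" by measurable
    then show "(\<lambda>x. ?c x * indicator {0<..} (v x - w x)) \<in> borel_measurable M"
      by (intro borel_measurable_times[OF borel_measurable_integrable[OF c_int]])
  qed
  have "(\<lambda>n. C * annulus_energy u l + C * annulus_energy u' l + (\<integral>x. ?weight (real (Suc n)) x * E1 x \<partial>M) +
      (\<integral>x. ?weight (real (Suc n)) x * E2 x \<partial>M)) \<longlonglongrightarrow> C * annulus_energy u l + C * annulus_energy u' l + 0 + 0"
    by (intro tendsto_add tendsto_const weight0 E1 E2)
  from LIMSEQ_le[OF lim this] ineq show ?thesis
    unfolding v_def w_def by (simp only: add_0_right) (metis of_nat_0_less_iff zero_less_Suc)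
qed

text \<open>
  Here \<open>l\<close> tends to infinity: the energies vanish by the third condition on renormalized
  solutions, and the contribution of \<open>f\<close> disappears because both cutoffs tend to 1.
\<close>

lemma integral_strict_comparison:
  assumes sol: "solution u b" and sol': "solution u' b'"
  shows "(\<integral>x. (b x - b' x) * indicator {0<..} (u x - u' x) \<partial>M) \<le> 0"
proof -
  note s = solutionD[OF sol] and s' = solutionD[OF sol']
  obtain C where C: "0 \<le> C" "\<And>l r. \<bar>cutoff' l r\<bar> \<le> C" "\<And>l r s. \<bar>cutoff l r - cutoff l s\<bar> \<le> C * \<bar>r - s\<bar>"
    by (metis cutoff'_bounded)
  let ?c = "\<lambda>l x. b x * cutoff l (u x) - b' x * cutoff l (u' x) - f x * (cutoff l (u x) - cutoff l (u' x))"
  let ?I = "\<lambda>l x. indicat_real {0<..} (trunc (l + 1) (u x) - trunc (l + 1) (u' x))"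
  have lim: "(\<lambda>n. \<integral>x. ?c (real n) x * ?I (real n) x \<partial>M) \<longlonglongrightarrow> (\<integral>x. (b x - b' x) * indicator {0<..} (u x - u' x) \<partial>M)"
  proof (rule integral_dominated_convergence)
    show "integrable M (\<lambda>x. \<bar>b x\<bar> + \<bar>b' x\<bar> + 2 * \<bar>f x\<bar>)"
      using s(2) s'(2) f_integrable(1) by simp
    show "AE x in M. (\<lambda>n. ?c (real n) x * ?I (real n) x) \<longlonglongrightarrow> (b x - b' x) * indicator {0<..} (u x - u' x)"
    proof (rule AE_I2)
      fix x
      have "\<forall>\<^sub>F n in sequentially. max \<bar>u x\<bar> \<bar>u' x\<bar> < real n"
        using filterlim_real_sequentially unfolding filterlim_at_top_dense by blast
      then have "\<forall>\<^sub>F n in sequentially. ?c (real n) x * ?I (real n) x = (b x - b' x) * indicator {0<..} (u x - u' x)"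
        by eventually_elim (simp add: cutoff_inside trunc_id)
      then show "(\<lambda>n. ?c (real n) x * ?I (real n) x) \<longlonglongrightarrow> (b x - b' x) * indicator {0<..} (u x - u' x)"
        by (rule tendsto_eventually)
    qed
    show "AE x in M. norm (?c (real n) x * ?I (real n) x) \<le> \<bar>b x\<bar> + \<bar>b' x\<bar> + 2 * \<bar>f x\<bar>" for n
    proof (rule AE_I2)
      fix x
      let ?h = "cutoff (real n) (u x)" and ?h' = "cutoff (real n) (u' x)"
      have "\<bar>b x * ?h\<bar> \<le> \<bar>b x\<bar> * 1" "\<bar>b' x * ?h'\<bar> \<le> \<bar>b' x\<bar> * 1" "\<bar>f x * (?h - ?h')\<bar> \<le> \<bar>f x\<bar> * 2"
        unfolding abs_mult
        using cutoff_bounds[of "real n" "u x"] cutoff_bounds[of "real n" "u' x"]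
        by (intro mult_left_mono; simp)+
      then have "\<bar>?c (real n) x\<bar> \<le> \<bar>b x\<bar> + \<bar>b' x\<bar> + 2 * \<bar>f x\<bar>" by linarith
      moreover have "\<bar>?c (real n) x * ?I (real n) x\<bar> \<le> \<bar>?c (real n) x\<bar>"
        by (simp add: abs_mult indicator_def)
      ultimately show "norm (?c (real n) x * ?I (real n) x) \<le> \<bar>b x\<bar> + \<bar>b' x\<bar> + 2 * \<bar>f x\<bar>" by simp
    qed
    note [measurable] = s(1,3) s'(1,3) f_integrable(2)
    have [measurable]: "cutoff l \<in> borel_measurable borel" for l
      by (intro borel_measurable_continuous_onI continuous_at_imp_continuous_on ballI DERIV_isCont[OF DERIV_cutoff])
    have [measurable]: "trunc k \<in> borel_measurable borel" for k unfolding trunc_def[abs_def] by measurable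
    show "(\<lambda>x. ?c (real n) x * ?I (real n) x) \<in> borel_measurable M" for n by measurable
    show "(\<lambda>x. (b x - b' x) * indicator {0<..} (u x - u' x)) \<in> borel_measurable M" by measurable
  qed
  have en: "(\<lambda>n. annulus_energy u (real n)) \<longlonglongrightarrow> 0" "(\<lambda>n. annulus_energy u' (real n)) \<longlonglongrightarrow> 0"
    unfolding annulus_energy_def
    by (rule filterlim_compose[OF s(7) filterlim_real_sequentially] filterlim_compose[OF s'(7) filterlim_real_sequentially])+
  have "(\<lambda>n. C * annulus_energy u (real n) + C * annulus_energy u' (real n)) \<longlonglongrightarrow> C * 0 + C * 0"
    by (intro tendsto_add tendsto_mult tendsto_const en)
  from LIMSEQ_le[OF lim this] comparison_at_level[OF sol sol' _ C] show ?thesis by auto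
qed

text \<open>
  On \<open>{u > u'}\<close> strict monotonicity gives \<open>b > b'\<close>, so a positive function has
  a nonpositive integral over that set.
\<close>

lemma comparison:
  assumes sol: "solution u b" and sol': "solution u' b'"
  shows "AE x in M. u x \<le> u' x"
proof -
  note s = solutionD[OF sol] and s' = solutionD[OF sol']
  let ?g = "\<lambda>x. (b x - b' x) * indicat_real {0<..} (u x - u' x)"
  have pos: "AE x in M. u' x < u x \<longrightarrow> 0 < b x - b' x"
    using s(4) s'(4) \<beta>_strict
    by eventually_elim (auto simp: strictly_monotone_graph_def)
  have nn: "AE x in M. 0 \<le> ?g x" using pos by eventually_elim (auto simp: indicator_def)
  note [measurable] = s(1) s'(1)
  have g: "integrable M ?g"
    by (rule integrable_mult_bounded(1)[of _ _ _ 1]) (use s(2) s'(2) in \<open>auto simp: indicator_def\<close>)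
  have "(\<integral>x. ?g x \<partial>M) = 0"
    using integral_strict_comparison[OF sol sol'] integral_nonneg_AE[OF nn] by linarith
  then have "AE x in M. ?g x = 0"
    using integral_nonneg_eq_0_iff_AE[OF g nn] by simp
  then show ?thesis
    using pos by eventually_elim (force simp: indicator_def)
qed

text \<open>
  The graph \<open>\<beta>(x, \<cdot>)\<close> may be multivalued, so \<open>u = u'\<close> alone does
  not identify \<open>b\<close> and \<open>b'\<close>; the equations do, since all their other terms
  coincide.
\<close>

lemma solution_unique:
  assumes sol: "solution u b" and sol': "solution u' b'"
  shows "(AE x in M. u x = u' x) \<and> (AE x in M. b x = b' x)"
proof
  note s = solutionD[OF sol] and s' = solutionD[OF sol']
  show uu': "AE x in M. u x = u' x"
    using comparison[OF sol sol'] comparison[OF sol' sol] by eventually_elim simp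
  have trunc_eq: "weak_grad \<Omega> (\<lambda>y. trunc k (u y)) = weak_grad \<Omega> (\<lambda>y. trunc k (u' y))" for k
  proof (rule weak_grad_cong_AE[OF open_domain])
    show "AE x in M. trunc k (u x) = trunc k (u' x)" using uu' by eventually_elim simp
    show "(\<lambda>x. trunc k (u x)) \<in> borel_measurable M" "(\<lambda>x. trunc k (u' x)) \<in> borel_measurable M"
      using s(1) s'(1) unfolding trunc_def by measurable
  qed
  have grad_eq: "AE x in M. gen_grad \<Omega> u x = gen_grad \<Omega> u' x"
  proof -
    have "AE x in M. \<forall>n. (\<bar>u x\<bar> < real n + 1 \<longrightarrow> gen_grad \<Omega> u x = weak_grad \<Omega> (\<lambda>x. trunc (real n + 1) (u x)) x) \<and>
      (\<bar>u' x\<bar> < real n + 1 \<longrightarrow> gen_grad \<Omega> u' x = weak_grad \<Omega> (\<lambda>x. trunc (real n + 1) (u x)) x)"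
      unfolding AE_all_countable
      by (intro allI AE_conjI solution_gen_grad[OF sol] solution_gen_grad[OF sol', folded trunc_eq]) auto
    then show ?thesis using uu'
    proof eventually_elim
      case (elim x)
      obtain n where "\<bar>u x\<bar> < real n" using reals_Archimedean2 by blast
      then have "\<bar>u x\<bar> < real n + 1" by simp
      then show ?case using elim by metis
    qed
  qed
  have "AE x in M. (b x - b' x) * cutoff (real n) (u x) = 0" for n
  proof (rule fundamental_lemma[OF open_domain])
    let ?h = "cutoff (real n)"
    have hc: "continuous_on UNIV ?h"
      by (intro continuous_at_imp_continuous_on ballI DERIV_isCont[OF DERIV_cutoff])
    have hm: "(\<lambda>x. ?h (u x)) \<in> borel_measurable M" "(\<lambda>x. ?h (u' x)) \<in> borel_measurable M"
      using borel_measurable_continuous_on[OF hc] s(1) s'(1) by auto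
    have int: "integrable M (\<lambda>x. b x * ?h (u x))" "integrable M (\<lambda>x. b' x * ?h (u x))"
      by (intro integrable_mult_bounded(1)[OF _ hm(1) cutoff_bounds(3)] s s')+
    show "locally_integrable \<Omega> (\<lambda>x. (b x - b' x) * ?h (u x))"
      using int by (intro integrable_imp_locally_integrable[OF domain_measurable]) (simp add: left_diff_distrib)
    fix \<phi> assume \<phi>: "\<phi> \<in> test_functions \<Omega>"
    obtain B where B: "\<And>x. \<bar>\<phi> x\<bar> \<le> B" using test_functions_bounded[OF \<phi>] by blast
    note \<phi>m = test_functions_measurable[OF \<phi>]
    have \<Phi>: "\<phi> \<in> W1p_0 \<Omega> p \<inter> Linf \<Omega>"
      using approximates_W1p_0[OF test_functions_approximates[OF \<phi>]] \<phi>m B by (auto simp: Linf_def)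
    have h: "?h \<in> C1_compact_support" by (rule cutoff_C1_compact_support) simp
    have wg: "weak_grad \<Omega> (\<lambda>y. ?h (u y) * \<phi> y) = weak_grad \<Omega> (\<lambda>y. ?h (u' y) * \<phi> y)"
    proof (rule weak_grad_cong_AE[OF open_domain])
      show "AE x in M. ?h (u x) * \<phi> x = ?h (u' x) * \<phi> x" using uu' by eventually_elim simp
    qed (intro borel_measurable_times hm \<phi>m)+
    define D where "D = weak_grad \<Omega> (\<lambda>y. ?h (u y) * \<phi> y)"
    have flux: "(\<integral>x. (a x (gen_grad \<Omega> u x) + F (u x)) \<bullet> D x \<partial>M) = (\<integral>x. (a x (gen_grad \<Omega> u' x) + F (u' x)) \<bullet> D x \<partial>M)"
    proof (rule integral_lebesgue_on_cong_AE[OF domain_measurable])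
      show "AE x in M. (a x (gen_grad \<Omega> u x) + F (u x)) \<bullet> D x = (a x (gen_grad \<Omega> u' x) + F (u' x)) \<bullet> D x"
        using grad_eq uu' by eventually_elim simp
    qed
    have rhs: "(\<integral>x. f x * ?h (u x) * \<phi> x \<partial>M) = (\<integral>x. f x * ?h (u' x) * \<phi> x \<partial>M)"
      by (rule integral_lebesgue_on_cong_AE[OF domain_measurable]) (use uu' in \<open>eventually_elim, simp\<close>)
    have b': "(\<integral>x. b' x * ?h (u' x) * \<phi> x \<partial>M) = (\<integral>x. b' x * ?h (u x) * \<phi> x \<partial>M)"
      by (rule integral_lebesgue_on_cong_AE[OF domain_measurable]) (use uu' in \<open>eventually_elim, simp\<close>)
    have "(\<integral>x. b x * ?h (u x) * \<phi> x \<partial>M) = (\<integral>x. b' x * ?h (u x) * \<phi> x \<partial>M)"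
      using s(6)[OF h \<Phi>] s'(6)[OF h \<Phi>] flux rhs b' unfolding wg D_def by linarith
    then show "(\<integral>x. (b x - b' x) * ?h (u x) * \<phi> x \<partial>M) = 0"
      using integrable_mult_bounded(1)[OF int(1) \<phi>m B] integrable_mult_bounded(1)[OF int(2) \<phi>m B]
      by (simp add: left_diff_distrib)
  qed
  then have "AE x in M. \<forall>n::nat. (b x - b' x) * cutoff (real n) (u x) = 0"
    unfolding AE_all_countable by blast
  then show "AE x in M. b x = b' x"
  proof eventually_elim
    case (elim x)
    obtain n where "\<bar>u x\<bar> < real n" using reals_Archimedean2 by blast
    then have "cutoff (real n) (u x) = 1" by (intro cutoff_inside) auto
    with elim[rule_format, of n] show ?case by simp
  qed
qed

end

theorem theorem4p2:
  fixes \<Omega> :: "(real^'n) set"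
    and p :: "real^'n"
    and F :: "real \<Rightarrow> real^'n"
    and \<beta> :: "real^'n \<Rightarrow> real \<Rightarrow> real set"
    and a :: "real^'n \<Rightarrow> real^'n \<Rightarrow> real^'n"
    and d :: "real^'n \<Rightarrow> real^'n"
    and lam \<gamma> :: real
    and f u b u' b' :: "real^'n \<Rightarrow> real"
  assumes domain: "bounded_domain \<Omega>"
    and lipschitz_bd: "CARD('n) \<ge> 2 \<Longrightarrow> lipschitz_boundary \<Omega>"
    and exponents: "\<And>i. 1 < p $ i"
    and F_lipschitz: "local_lipschitz (UNIV :: real set) UNIV (\<lambda>_. F)"
    and \<beta>_maximal: "AE x in lebesgue_on \<Omega>. maximal_monotone_graph (\<beta> x) \<and> 0 \<in> \<beta> x 0"
    and a_caratheodory: "caratheodory \<Omega> a"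
    and constants: "lam > 0" "\<gamma> > 0"
    and coercive: "AE x in lebesgue_on \<Omega>. \<forall>\<xi>.
        (\<Sum>i\<in>UNIV. a x \<xi> $ i * \<xi> $ i) \<ge> lam * (\<Sum>i\<in>UNIV. \<bar>\<xi> $ i\<bar> powr (p $ i))"
    and d_pos: "AE x in lebesgue_on \<Omega>. \<forall>i. d x $ i > 0"
    and d_Lp: "\<And>i. (\<lambda>x. d x $ i) \<in> Lp \<Omega> (p $ i / (p $ i - 1))"
    and growth: "AE x in lebesgue_on \<Omega>. \<forall>\<xi> i.
        \<bar>a x \<xi> $ i\<bar> \<le> \<gamma> * (d x $ i + \<bar>\<xi> $ i\<bar> powr (p $ i - 1))"
    and a_monotone: "AE x in lebesgue_on \<Omega>. \<forall>\<xi> \<eta>. (a x \<xi> - a x \<eta>) \<bullet> (\<xi> - \<eta>) \<ge> 0"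
    and \<beta>_strict: "AE x in lebesgue_on \<Omega>. strictly_monotone_graph (\<beta> x)"
    and f_L1: "f \<in> Lp \<Omega> 1"
    and sol: "renormalized_solution \<Omega> p \<beta> a F f u b"
    and sol': "renormalized_solution \<Omega> p \<beta> a F f u' b'"
  shows "(AE x in lebesgue_on \<Omega>. u x = u' x) \<and> (AE x in lebesgue_on \<Omega>. b x = b' x)"
proof -
  interpret elliptic_problem \<Omega> p \<beta> a F d \<gamma> f
  proof unfold_locales
    show "open \<Omega>" "bounded \<Omega>" using domain by (auto simp: bounded_domain_def)
    show "AE x in lebesgue_on \<Omega>. \<forall>\<xi>. 0 \<le> a x \<xi> \<bullet> \<xi>"
      using coercive
    proof eventually_elim
      case (elim x)
      show ?case
      proof
        fix \<xi>
        have "0 \<le> lam * (\<Sum>i\<in>UNIV. \<bar>\<xi> $ i\<bar> powr (p $ i))"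
          using constants(1) by (simp add: sum_nonneg)
        also have "\<dots> \<le> a x \<xi> \<bullet> \<xi>" using elim by (simp add: inner_vec_def)
        finally show "0 \<le> a x \<xi> \<bullet> \<xi>" .
      qed
    qed
  qed (fact exponents F_lipschitz a_caratheodory constants(2) d_Lp growth a_monotone \<beta>_strict f_L1)+
  show ?thesis by (rule solution_unique[OF sol sol'])
qed

end
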